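(* Let $n,q$ be positive integers. The stabilizer $\mathcal{S}$ of the polynomial $IMM_q^n\in S^nV$ in $GL(V)$ is isomorphic to $\mathcal{S}_0\rtimes D_n$, where $\mathcal{S}_0$ is the connected component of the identity in $\mathcal{S}$ and $D_n$ is the dihedral group of the regular $n$-gon (of order $2n$). More specifically, $D_n=\mathbb{Z}_n\rtimes\mathbb{Z}_2$, where $\mathbb{Z}_n\subseteq\mathfrak{S}_n$ is the cyclic group generated by the $n$-cycle $(1,\dots,n)$, acting by permuting the matrices, i.e. generated by $(X_1,\dots,X_n)\mapsto(X_2,\dots,X_n,X_1)$, and $\mathbb{Z}_2=\langle\tau\rangle$ acts by $\tau(X_1,\dots,X_n)=(X_n^T,\dots,X_1^T)$.
   Context: Let $U_1,\dots,U_n$ be complex vector spaces of dimension $q$, with indices read modulo $n$ (so $U_{n+1}=U_1$). Put $A_\alpha=U_\alpha^*\otimes U_{\alpha+1}=\mathrm{Hom}(U_\alpha,U_{\alpha+1})$ and $V=A_1^*\oplus\cdots\oplus A_n^*$, so $V^*=A_1\oplus\cdots\oplus A_n$ is the space of $n$-tuples $(X_1,\dots,X_n)$ of linear maps $X_\alpha:U_\alpha\to U_{\alpha+1}$. Fixing bases of the $U_\alpha$ identifies $V^*$ with $Mat_q(\mathbb{C})^{\oplus n}$; transposes are taken with respect to these bases. $IMM_q^n\in S^nV$ is the degree-$n$ homogeneous polynomial on $V^*$ given by $IMM_q^n(X_1,\dots,X_n)=\mathrm{trace}(X_n\cdots X_1)$. $GL(V)$ acts naturally on $S^nV$; linear automorphisms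 of $V^*$ are regarded as elements of $GL(V)$ via the isomorphism $GL(V^* )\simeq GL(V)$ given by inverse transpose.
   Formalization: The formal theorem assumes n ≥ 3 and (q ≥ 2 or n = 3); the claim fails in all other cases: for n = 1 the stabilizer is connected, for n = 2 it is O(2q²) with two components, and for q = 1, n ≥ 4 the component group is the full symmetric group. *)

theory Defs
  imports "HOL-Analysis.Analysis" "HOL-Algebra.Elementary_Groups"
begin

text \<open>
  The type \<open>'n\<close> (with its linear order) plays the role of the index set \<open>{1,...,n}\<close> and \<open>'q\<close> that of
  the chosen bases of the spaces \<open>U\<^sub>\<alpha>\<close>; so \<open>n = CARD('n)\<close> and \<open>q = CARD('q)\<close>. A vector \<open>x\<close> of
  \<open>complex ^ ('n \<times> 'q \<times> 'q)\<close> is the tuple \<open>(X\<^sub>1,...,X\<^sub>n)\<close> of \<open>V\<^sup>*\<close> in which \<open>x $ (i, a, b)\<close> is the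
  \<open>(a, b)\<close> entry of the matrix with index \<open>i\<close>. The space \<open>V\<close> has the dual coordinates, so that
  \<open>GL(V)\<close> consists of the invertible matrices with rows and columns indexed by \<open>'n \<times> 'q \<times> 'q\<close>.
\<close>

definition blocks :: "complex ^ ('n::{finite,linorder} \<times> 'q::finite \<times> 'q) \<Rightarrow> (complex ^ 'q ^ 'q) list"
  where "blocks x = map (\<lambda>i. \<chi> a b. x $ (i, a, b)) (sorted_list_of_set (UNIV :: 'n set))"

text \<open>The number of indices below \<open>i\<close> is the position of \<open>i\<close> in the list, counted from 0.\<close>

definition of_blocks :: "(complex ^ 'q ^ 'q) list \<Rightarrow> complex ^ ('n::{finite,linorder} \<times> 'q::finite \<times> 'q)"
  where "of_blocks Xs = (\<chi> p. case p of (i, a, b) \<Rightarrow> Xs ! card {j. j < i} $ a $ b)"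

text \<open>
  The fold over \<open>[X\<^sub>1,...,X\<^sub>n]\<close> is \<open>X\<^sub>n ** (... ** (X\<^sub>1 ** mat 1))\<close>.
  Degenerate parameters: \<open>IMM\<close> is a linear form for \<open>n = 1\<close>, a nondegenerate quadratic form for
  \<open>n = 2\<close>, and the monomial \<open>x\<^sub>1 \<cdots> x\<^sub>n\<close> for \<open>q = 1\<close>. In these cases, apart from \<open>(n, q) = (3, 1)\<close>,
  the component group of the stabilizer is not the dihedral group.
\<close>

definition IMM :: "complex ^ ('n::{finite,linorder} \<times> 'q::finite \<times> 'q) \<Rightarrow> complex"
  where "IMM x = trace (fold (**) (blocks x) (mat 1))"

definition GL :: "(complex ^ 'm ^ 'm::finite) monoid"
  where "GL = \<lparr>carrier = {g. invertible g}, mult = (**), one = mat 1\<rparr>"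

text \<open>\<open>GL(V)\<close> acts on a polynomial, viewed as a function on \<open>V\<^sup>*\<close>, by substitution of the transpose.\<close>

definition poly_act :: "complex ^ 'm ^ 'm::finite \<Rightarrow> (complex ^ 'm \<Rightarrow> complex) \<Rightarrow> complex ^ 'm \<Rightarrow> complex"
  where "poly_act g f = (\<lambda>\<xi>. f (transpose g *v \<xi>))"

definition stabilizer :: "(complex ^ 'm::finite \<Rightarrow> complex) \<Rightarrow> (complex ^ 'm ^ 'm) set"
  where "stabilizer f = {g \<in> carrier GL. poly_act g f = f}"

text \<open>The identification of linear automorphisms of \<open>V\<^sup>*\<close> with elements of \<open>GL(V)\<close>.\<close>

definition inverse_transpose :: "(complex ^ 'm \<Rightarrow> complex ^ 'm) \<Rightarrow> complex ^ 'm ^ 'm::finite"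
  where "inverse_transpose h = transpose (matrix_inv (matrix h))"

definition cyc :: "complex ^ ('n::{finite,linorder} \<times> 'q::finite \<times> 'q) \<Rightarrow> complex ^ ('n \<times> 'q \<times> 'q)"
  where "cyc x = of_blocks (rotate1 (blocks x))"

definition tau :: "complex ^ ('n::{finite,linorder} \<times> 'q::finite \<times> 'q) \<Rightarrow> complex ^ ('n \<times> 'q \<times> 'q)"
  where "tau x = of_blocks (map transpose (rev (blocks x)))"

definition semidirect_product ::
    "('a, 'c) monoid_scheme \<Rightarrow> ('b, 'd) monoid_scheme \<Rightarrow> ('b \<Rightarrow> 'a \<Rightarrow> 'a) \<Rightarrow> ('a \<times> 'b) monoid"
  where "semidirect_product N H \<phi> =
    \<lparr>carrier = carrier N \<times> carrier H,
     mult = (\<lambda>(x, h) (y, k). (x \<otimes>\<^bsub>N\<^esub> \<phi> h y, h \<otimes>\<^bsub>H\<^esub> k)),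
     one = (\<one>\<^bsub>N\<^esub>, \<one>\<^bsub>H\<^esub>)\<rparr>"

text \<open>\<open>G = N \<rtimes> H\<close> for subgroups \<open>N\<close> and \<open>H\<close> of \<open>G\<close>, where \<open>H\<close> acts on \<open>N\<close> by conjugation.\<close>

definition is_semidirect_product :: "('a, 'c) monoid_scheme \<Rightarrow> 'a set \<Rightarrow> 'a set \<Rightarrow> bool"
  where "is_semidirect_product G N H \<longleftrightarrow>
    N \<lhd> G \<and> subgroup H G \<and>
    (\<lambda>(x, h). x \<otimes>\<^bsub>G\<^esub> h) \<in>
      iso (semidirect_product (G\<lparr>carrier := N\<rparr>) (G\<lparr>carrier := H\<rparr>)
            (\<lambda>h x. h \<otimes>\<^bsub>G\<^esub> x \<otimes>\<^bsub>G\<^esub> inv\<^bsub>G\<^esub> h)) G"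

text \<open>The symmetries of the regular \<open>n\<close>-gon whose vertices are the \<open>n\<close>-th roots of unity.\<close>

definition dihedral_group :: "nat \<Rightarrow> (complex \<Rightarrow> complex) monoid"
  where "dihedral_group n =
    \<lparr>carrier = {f. orthogonal_transformation f \<and> f ` {z. z ^ n = 1} = {z. z ^ n = 1}},
     mult = (\<circ>), one = id\<rparr>"

end

theory Submission
  imports Defs
begin

text \<open>
  Call two tangent vectors \<open>w\<close>, \<open>v\<close> orthogonal if the second mixed derivative of \<open>IMM\<close> in the
  directions \<open>w\<close>, \<open>v\<close> vanishes identically; every element of the stabilizer preserves this relation.
  Since \<open>n \<ge> 3\<close>, an invertible matrix in the block \<open>A\<^sub>i\<close> has exactly \<open>A\<^sub>i\<close> as its orthogonal space, which is
  totally isotropic. Conversely, a totally isotropic orthogonal space of an isotropic \<open>w\<close> is one of the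
  blocks: if \<open>w\<close> had two nonzero adjacent components \<open>w\<^sub>i\<close>, \<open>w\<^sub>i\<^sub>+\<^sub>1\<close>, its space would contain the tangent
  vectors \<open>(- R w\<^sub>i, w\<^sub>i\<^sub>+\<^sub>1 R)\<close> to the orbit of \<open>GL(U\<^sub>i\<^sub>+\<^sub>1)\<close>, which are not all isotropic. So the stabilizer
  permutes the blocks. For \<open>q \<ge> 2\<close> two different blocks are adjacent in the cycle iff they contain nonzero
  orthogonal vectors, hence the permutation is dihedral (for \<open>n = 3\<close> every permutation is).

  A symmetry fixing all blocks acts by linear maps with \<open>L\<^sub>i\<^sub>+\<^sub>1(Y) L\<^sub>i(X) = L\<^sub>i\<^sub>+\<^sub>1(1) L\<^sub>i(Y X)\<close>, so
  \<open>X \<mapsto> L\<^sub>i(X) L\<^sub>i(1)\<^sup>-\<^sup>1\<close> is an automorphism of the matrix algebra; by Skolem-Noether it is inner, and the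
  symmetry has the form \<open>X\<^sub>i \<mapsto> h\<^sub>i\<^sub>+\<^sub>1 X\<^sub>i h\<^sub>i\<^sup>-\<^sup>1\<close>. These symmetries form a connected set, as a complex line
  through two invertible matrices meets the singular ones in finitely many points, and the set is
  relatively clopen because the way in which the blocks are permuted is a closed condition.
\<close>

section \<open>Cyclic indices and the trace formula\<close>

definition pos :: "'n::{finite,linorder} \<Rightarrow> nat"
  where "pos i = card {j. j < i}"

text \<open>Reduction modulo n makes this total on the naturals, so passing from the last index to
  the first needs no case distinction.\<close>

definition idx :: "nat \<Rightarrow> 'n::{finite,linorder}"
  where "idx k = sorted_list_of_set UNIV ! (k mod CARD('n))"

definition nx :: "'n \<Rightarrow> 'n::{finite,linorder}"
  where "nx i = idx (Suc (pos i))"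

text \<open>Adding n - 1 is subtracting 1 modulo n without truncated subtraction.\<close>

definition pv :: "'n \<Rightarrow> 'n::{finite,linorder}"
  where "pv i = idx (pos i + (CARD('n) - 1))"

definition rv :: "'n \<Rightarrow> 'n::{finite,linorder}"
  where "rv i = idx (CARD('n) - 1 - pos i)"

lemma length_enum: "length (sorted_list_of_set (UNIV :: 'n::{finite,linorder} set)) = CARD('n)"
  by simp

lemma card_type_pos: "0 < CARD('n::finite)"
  by (simp add: finite_UNIV_card_ge_0)

lemma pos_nth:
  assumes "k < CARD('n::{finite,linorder})"
  shows "pos (sorted_list_of_set (UNIV :: 'n set) ! k) = k"
proof -
  define xs where "xs = sorted_list_of_set (UNIV :: 'n set)"
  have len: "length xs = CARD('n)" and s: "sorted_wrt (<) xs" and set: "set xs = UNIV"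
    by (simp_all add: xs_def)
  have less: "xs ! a < xs ! b \<longleftrightarrow> a < b" if "a < CARD('n)" "b < CARD('n)" for a b
    using that len s by (metis not_less_iff_gr_or_eq sorted_wrt_iff_nth_less)
  have "{j. j < xs ! k} = (!) xs ` {..<k}"
  proof (intro Set.set_eqI iffI)
    fix j assume "j \<in> {j. j < xs ! k}"
    moreover obtain a where "a < CARD('n)" "j = xs ! a"
      using set len by (metis UNIV_I in_set_conv_nth)
    ultimately show "j \<in> (!) xs ` {..<k}" using less assms by auto
  next
    fix j assume "j \<in> (!) xs ` {..<k}"
    then show "j \<in> {j. j < xs ! k}" using less assms by auto
  qed
  moreover have "inj_on ((!) xs) {..<k}"
    using assms len by (intro inj_onI) (metis less lessThan_iff less_trans not_less_iff_gr_or_eq)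
  ultimately show ?thesis
    by (simp add: pos_def xs_def[symmetric] card_image)
qed

lemma pos_idx [simp]: "pos (idx k :: 'n::{finite,linorder}) = k mod CARD('n)"
  by (simp add: idx_def pos_nth card_type_pos)

lemma idx_mod [simp]: "idx (k mod CARD('n)) = (idx k :: 'n::{finite,linorder})"
  by (simp add: idx_def)

lemma idx_surj: "\<exists>k < CARD('n). (i :: 'n::{finite,linorder}) = idx k"
proof -
  have "i \<in> set (sorted_list_of_set (UNIV :: 'n set))" by simp
  then obtain k where "k < CARD('n)" "sorted_list_of_set UNIV ! k = i"
    by (metis in_set_conv_nth length_enum)
  then show ?thesis by (auto simp: idx_def)
qed

lemma idx_pos [simp]: "idx (pos i) = (i :: 'n::{finite,linorder})"
  using idx_surj[of i] by auto

lemma pos_less [simp]: "pos (i :: 'n::{finite,linorder}) < CARD('n)"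
  using idx_surj[of i] by auto

lemma idx_eq_iff: "(idx k :: 'n::{finite,linorder}) = idx l \<longleftrightarrow> k mod CARD('n) = l mod CARD('n)"
  by (metis idx_mod pos_idx)

lemma nx_idx [simp]: "nx (idx k) = (idx (Suc k) :: 'n::{finite,linorder})"
  by (simp add: nx_def idx_eq_iff mod_Suc_eq)

lemma pv_idx: "pv (idx k) = (idx (k + (CARD('n) - 1)) :: 'n::{finite,linorder})"
  unfolding pv_def idx_eq_iff pos_idx by (rule mod_add_left_eq)

lemma pv_nx [simp]: "pv (nx i) = (i :: 'n::{finite,linorder})"
proof -
  obtain k where k: "i = idx k" using idx_surj by blast
  have "Suc k + (CARD('n) - 1) = k + CARD('n)" using card_type_pos[where 'n='n] by simp
  then show ?thesis unfolding k nx_idx pv_idx by (simp add: idx_eq_iff)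
qed

lemma nx_pv [simp]: "nx (pv i) = (i :: 'n::{finite,linorder})"
proof -
  obtain k where k: "i = idx k" using idx_surj by blast
  have "Suc (k + (CARD('n) - 1)) = k + CARD('n)" using card_type_pos[where 'n='n] by simp
  then show ?thesis unfolding k nx_idx pv_idx by (simp add: idx_eq_iff)
qed

lemma nx_inject [simp]: "nx i = nx j \<longleftrightarrow> i = (j :: 'n::{finite,linorder})"
  by (metis pv_nx)

lemma nx_funpow_idx: "(nx ^^ m) (idx k) = (idx (k + m) :: 'n::{finite,linorder})"
  by (induction m) auto

lemma nx_funpow_card: "nx ^^ CARD('n) = (id :: 'n \<Rightarrow> 'n::{finite,linorder})"
proof
  fix i :: 'n
  obtain k where "i = idx k" using idx_surj by blast
  then show "(nx ^^ CARD('n)) i = id i" by (simp add: nx_funpow_idx idx_eq_iff)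
qed

text \<open>\<open>nx\<close> is a single n-cycle, so a power of it with one fixed index has to be
  trivial.\<close>

lemma nx_funpow_eq_self:
  assumes "(nx ^^ m) i = (i :: 'n::{finite,linorder})"
  shows "CARD('n) dvd m"
proof -
  obtain k where "i = idx k" using idx_surj by blast
  with assms have "(k + m) mod CARD('n) = (k + 0) mod CARD('n)"
    by (simp add: nx_funpow_idx idx_eq_iff)
  then show ?thesis
    using mod_eq_dvd_iff_nat[of k "k + m" "CARD('n)"] by simp
qed

lemma nx_transitive: "\<exists>m < CARD('n). (nx ^^ m) i = (j :: 'n::{finite,linorder})"
proof -
  obtain k l where kl: "k < CARD('n)" "l < CARD('n)" "i = idx k" "j = idx l" using idx_surj by meson
  let ?m = "(l + (CARD('n) - k)) mod CARD('n)"
  have "(k + ?m) mod CARD('n) = (k + (l + (CARD('n) - k))) mod CARD('n)" by (simp add: mod_add_right_eq)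
  also have "\<dots> = l mod CARD('n)" using kl by simp
  finally have "(nx ^^ ?m) i = j" using kl by (simp add: nx_funpow_idx idx_eq_iff)
  then show ?thesis using card_type_pos[where 'n='n] by (metis mod_less_divisor)
qed

lemma rv_rv [simp]: "rv (rv i) = (i :: 'n::{finite,linorder})"
  using pos_less[of i] by (simp add: rv_def del: pos_less)

text \<open>Reversal turns the direction of the cycle around; this is the dihedral relation on the
  level of indices.\<close>

lemma rv_nx: "rv (nx i) = (pv (rv i) :: 'n::{finite,linorder})"
proof -
  obtain k where k: "k < CARD('n)" "i = idx k" using idx_surj by blast
  show ?thesis
  proof (cases "Suc k = CARD('n)")
    case True
    then show ?thesis using k by (simp add: rv_def pv_idx)
  next
    case False
    then have "(CARD('n) - 1 - k) + (CARD('n) - 1) = (CARD('n) - 1 - Suc k) + CARD('n)"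
      using k by auto
    then have "idx ((CARD('n) - 1 - k) + (CARD('n) - 1)) = (idx (CARD('n) - 1 - Suc k) :: 'n)"
      by (simp only: idx_eq_iff mod_add_self2)
    then show ?thesis using k False by (simp add: rv_def pv_idx del: add_diff_assoc diff_add_assoc2)
  qed
qed

lemma nx_neq:
  assumes "2 \<le> CARD('n)"
  shows "nx i \<noteq> (i :: 'n::{finite,linorder})"
  using nx_funpow_eq_self[of 1 i] assms by auto

lemma nx_nx_neq:
  assumes "3 \<le> CARD('n)"
  shows "nx (nx i) \<noteq> (i :: 'n::{finite,linorder})"
  using nx_funpow_eq_self[of 2 i] assms by (auto simp: numeral_2_eq_2 dest!: dvd_imp_le)

section \<open>Adjacency of blocks and the trace as a sum over closed walks\<close>

definition adj :: "'n \<Rightarrow> 'n::{finite,linorder} \<Rightarrow> bool"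
  where "adj i j \<longleftrightarrow> j = nx i \<or> i = nx j"

text \<open>The trace of X_n ... X_1 written out: c chooses a basis index for each space U_i, and
  block i contributes the entry leading from \<open>c i\<close> to \<open>c (nx i)\<close>. In this
  form no block is distinguished as the first.\<close>

definition cyclic_trace :: "('n::{finite,linorder} \<Rightarrow> complex ^ 'q ^ 'q) \<Rightarrow> complex"
  where "cyclic_trace X = (\<Sum>c\<in>UNIV. \<Prod>i\<in>UNIV. X i $ c (nx i) $ c i)"

definition bl :: "complex ^ ('n::finite \<times> 'q::finite \<times> 'q) \<Rightarrow> 'n \<Rightarrow> complex ^ 'q ^ 'q"
  where "bl x i = (\<chi> a b. x $ (i, a, b))"

definition unbl :: "('n \<Rightarrow> complex ^ 'q ^ 'q) \<Rightarrow> complex ^ ('n::finite \<times> 'q::finite \<times> 'q)"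
  where "unbl X = (\<chi> p. case p of (i, a, b) \<Rightarrow> X i $ a $ b)"

lemma bl_nth [simp]: "bl x i $ a $ b = x $ (i, a, b)"
  by (simp add: bl_def)

lemma unbl_nth [simp]: "unbl X $ (i, a, b) = X i $ a $ b"
  by (simp add: unbl_def)

lemma bl_unbl [simp]: "bl (unbl X) = X"
  by (auto simp: vec_eq_iff)

lemma unbl_bl [simp]: "unbl (bl x) = x"
  by (auto simp: vec_eq_iff)

text \<open>An entry of an iterated product is a sum over paths that end at a. Paths are extensional
  functions on {..<m}, and the update at m supplies the end; for m = 0 this update also selects row
  a of \<open>M\<close>.\<close>

lemma fold_matrix_mult_nth:
  fixes X :: "nat \<Rightarrow> complex ^ 'q ^ 'q"
  shows "fold (**) (map X [0..<m]) M $ a $ b =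
    (\<Sum>c\<in>{..<m} \<rightarrow>\<^sub>E UNIV. (\<Prod>k<m. X k $ (c(m := a)) (Suc k) $ c k) * M $ (c(m := a)) 0 $ b)"
proof (induction m arbitrary: a)
  case 0
  then show ?case by simp
next
  case (Suc m)
  let ?T = "\<lambda>a d c. X m $ a $ d * ((\<Prod>k<m. X k $ (c(m := d)) (Suc k) $ c k) * M $ (c(m := d)) 0 $ b)"
  have "fold (**) (map X [0..<Suc m]) M $ a $ b =
      (\<Sum>d\<in>UNIV. \<Sum>c\<in>{..<m} \<rightarrow>\<^sub>E UNIV. ?T a d c)"
    by (simp add: matrix_matrix_mult_def Suc.IH sum_distrib_left)
  also have "\<dots> = (\<Sum>(d, c)\<in>UNIV \<times> ({..<m} \<rightarrow>\<^sub>E UNIV). ?T a d c)"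
    by (simp add: sum.cartesian_product)
  also have "\<dots> = (\<Sum>c\<in>{..<Suc m} \<rightarrow>\<^sub>E UNIV.
      (\<Prod>k<Suc m. X k $ (c(Suc m := a)) (Suc k) $ c k) * M $ (c(Suc m := a)) 0 $ b)"
  \<comment> \<open>The last inner index d is split off; resetting it to \<open>undefined\<close>
    restores extensionality.\<close>
  proof (rule sum.reindex_bij_witness[of _ "\<lambda>c. (c m, c(m := undefined))" "\<lambda>(d, c). c(m := d)"])
    fix x :: "'q \<times> (nat \<Rightarrow> 'q)" assume "x \<in> UNIV \<times> ({..<m} \<rightarrow>\<^sub>E UNIV)"
    then show "(case x of (d, c) \<Rightarrow> c(m := d)) \<in> {..<Suc m} \<rightarrow>\<^sub>E UNIV"
      by (auto simp: PiE_def extensional_def)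
    show "((case x of (d, c) \<Rightarrow> c(m := d)) m, (case x of (d, c) \<Rightarrow> c(m := d))(m := undefined)) = x"
      using \<open>x \<in> _\<close> by (auto simp: PiE_def extensional_def)
    obtain d c where x: "x = (d, c)" by fastforce
    let ?c = "c(m := d)"
    have "(\<Prod>k<m. X k $ (?c(Suc m := a)) (Suc k) $ ?c k) = (\<Prod>k<m. X k $ ?c (Suc k) $ c k)"
      by (rule prod.cong) auto
    then show "(\<Prod>k<Suc m. X k $ ((case x of (d, c) \<Rightarrow> c(m := d))(Suc m := a)) (Suc k) $
          (case x of (d, c) \<Rightarrow> c(m := d)) k) *
        M $ ((case x of (d, c) \<Rightarrow> c(m := d))(Suc m := a)) 0 $ b = (case x of (d, c) \<Rightarrow> ?T a d c)"
      by (simp add: x)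
  next
    fix c :: "nat \<Rightarrow> 'q" assume "c \<in> {..<Suc m} \<rightarrow>\<^sub>E UNIV"
    then show "(c m, c(m := undefined)) \<in> UNIV \<times> ({..<m} \<rightarrow>\<^sub>E UNIV)"
      by (auto simp: PiE_def extensional_def)
  qed auto
  finally show ?case .
qed

lemma enum_eq_map_idx: "sorted_list_of_set (UNIV :: 'n::{finite,linorder} set) = map idx [0..<CARD('n)]"
  by (rule nth_equalityI) (simp_all add: idx_def)

lemma blocks_eq: "blocks (x :: complex ^ ('n::{finite,linorder} \<times> 'q::finite \<times> 'q))
    = map (\<lambda>k. bl x (idx k)) [0..<CARD('n)]"
  by (simp add: blocks_def enum_eq_map_idx bl_def[abs_def])

lemma IMM_eq_cyclic_trace:
  fixes x :: "complex ^ ('n::{finite,linorder} \<times> 'q::finite \<times> 'q)"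
  shows "IMM x = cyclic_trace (bl x)"
proof -
  let ?n = "CARD('n)"
  let ?X = "\<lambda>k. bl x (idx k)"
  have n: "0 < ?n" by (rule card_type_pos)
  have "IMM x = (\<Sum>a\<in>UNIV. \<Sum>c\<in>{..<?n} \<rightarrow>\<^sub>E UNIV.
      (\<Prod>k<?n. ?X k $ (c(?n := a)) (Suc k) $ c k) * mat 1 $ (c(?n := a)) 0 $ a)"
    unfolding IMM_def trace_def blocks_eq fold_matrix_mult_nth ..
  \<comment> \<open>The factor \<open>mat 1\<close> forces a = c 0, which closes the path. Since n >
    0, the update at n does not touch position 0.\<close>
  also have "\<dots> = (\<Sum>c\<in>{..<?n} \<rightarrow>\<^sub>E UNIV. \<Sum>a\<in>UNIV.
      if a = c 0 then \<Prod>k<?n. ?X k $ (c(?n := a)) (Suc k) $ c k else 0)"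
    by (subst sum.swap, intro sum.cong refl) (use n in \<open>auto simp: mat_def\<close>)
  also have "\<dots> = (\<Sum>c\<in>{..<?n} \<rightarrow>\<^sub>E UNIV. \<Prod>k<?n. ?X k $ (c(?n := c 0)) (Suc k) $ c k)"
    by simp
  also have "\<dots> = cyclic_trace (bl x)"
    unfolding cyclic_trace_def
  proof (rule sum.reindex_bij_witness[of _ "\<lambda>c. restrict (\<lambda>k. c (idx k)) {..<?n}" "\<lambda>c i. c (pos i)"])
    fix c :: "nat \<Rightarrow> 'q" assume c: "c \<in> {..<?n} \<rightarrow>\<^sub>E UNIV"
    show "restrict (\<lambda>k. c (pos (idx k :: 'n))) {..<?n} = c"
    proof
      fix k
      show "restrict (\<lambda>k. c (pos (idx k :: 'n))) {..<?n} k = c k"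
        using c by (cases "k < ?n") (auto simp: PiE_def extensional_def)
    qed
    show "(\<Prod>i\<in>UNIV. bl x i $ c (pos (nx i)) $ c (pos i)) =
        (\<Prod>k<?n. ?X k $ (c(?n := c 0)) (Suc k) $ c k)"
    proof (rule prod.reindex_bij_witness[of _ idx pos])
      fix i :: 'n
      \<comment> \<open>The updated value at position n is the step from the last block back to the
        first.\<close>
      have "c (pos (nx i)) = (c(?n := c 0)) (Suc (pos i))"
        using pos_less[of i] by (cases "Suc (pos i) = ?n") (auto simp: nx_def simp del: pos_less)
      then show "?X (pos i) $ (c(?n := c 0)) (Suc (pos i)) $ c (pos i) =
          bl x i $ c (pos (nx i)) $ c (pos i)" by simp
    qed auto
  qed auto
  finally show ?thesis .
qed

lemma bl_of_blocks: "bl (of_blocks Xs :: complex ^ ('n::{finite,linorder} \<times> 'q::finite \<times> 'q)) i = Xs ! pos i"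
  by (simp add: vec_eq_iff of_blocks_def pos_def)

lemma bl_cyc: "bl (cyc x) i = bl x (nx (i :: 'n::{finite,linorder}))"
proof -
  have "rotate1 (blocks x) ! pos i = bl x (idx (Suc (pos i)))"
    by (subst nth_rotate1) (simp_all add: blocks_eq card_type_pos)
  then show ?thesis unfolding cyc_def bl_of_blocks nx_def .
qed

lemma bl_tau: "bl (tau x) i = transpose (bl x (rv (i :: 'n::{finite,linorder})))"
proof -
  have "map transpose (rev (blocks x)) ! pos i = transpose (bl x (idx (CARD('n) - 1 - pos i)))"
    by (simp add: blocks_eq rev_nth)
  then show ?thesis unfolding tau_def bl_of_blocks rv_def .
qed

section \<open>Multilinearity and separation of blocks\<close>

text \<open>Products with \<open>mat z\<close> serve as the scalar multiples of matrices from here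
  on.\<close>

lemma mat_mult_nth [simp]: "(mat z ** A) $ a $ b = z * A $ a $ b" for A :: "complex ^ 'q ^ 'p"
  by (simp add: matrix_matrix_mult_def mat_def if_distrib[of "\<lambda>x. x * _"] cong: if_cong)

lemma matrix_zero_mult [simp]: "(0 :: complex ^ 'q ^ 'p) ** A = 0" "A ** (0 :: complex ^ 'q ^ 'p) = 0"
  by (simp_all add: matrix_matrix_mult_def vec_eq_iff)

lemma cyclic_trace_split:
  "cyclic_trace X = (\<Sum>c\<in>UNIV. X i $ c (nx i) $ c i * (\<Prod>k\<in>UNIV - {i}. X k $ c (nx k) $ c k))"
  by (simp add: cyclic_trace_def prod.remove[of UNIV i])

lemma cyclic_trace_update:
  "cyclic_trace (X(i := A)) = (\<Sum>c\<in>UNIV. A $ c (nx i) $ c i * (\<Prod>k\<in>UNIV - {i}. X k $ c (nx k) $ c k))"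
proof -
  have "(\<Prod>k\<in>UNIV - {i}. (X(i := A)) k $ c (nx k) $ c k) = (\<Prod>k\<in>UNIV - {i}. X k $ c (nx k) $ c k)" for c
    by (rule prod.cong) auto
  then show ?thesis by (simp add: cyclic_trace_split[of _ i])
qed

lemma cyclic_trace_update_uminus:
  "cyclic_trace (X(i := - A)) = - cyclic_trace (X(i := A))"
  by (simp add: cyclic_trace_update sum_negf)

lemma cyclic_trace_zero: "X i = 0 \<Longrightarrow> cyclic_trace X = 0"
  by (simp add: cyclic_trace_split[of _ i])

lemma cyclic_trace_split2:
  assumes "i \<noteq> j"
  shows "cyclic_trace (X(i := A, j := B)) =
    (\<Sum>c\<in>UNIV. A $ c (nx i) $ c i * B $ c (nx j) $ c j * (\<Prod>k\<in>UNIV - {i, j}. X k $ c (nx k) $ c k))"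
proof -
  have "(\<Prod>k\<in>UNIV. (X(i := A, j := B)) k $ c (nx k) $ c k) =
      A $ c (nx i) $ c i * B $ c (nx j) $ c j * (\<Prod>k\<in>UNIV - {i, j}. X k $ c (nx k) $ c k)" for c
  proof -
    have "(\<Prod>k\<in>UNIV - {i, j}. (X(i := A, j := B)) k $ c (nx k) $ c k) =
        (\<Prod>k\<in>UNIV - {i, j}. X k $ c (nx k) $ c k)"
      by (rule prod.cong) auto
    moreover have "UNIV - {i} - {j} = UNIV - {i, j}" by auto
    ultimately show ?thesis
      using assms by (simp add: prod.remove[of UNIV i] prod.remove[of "UNIV - {i}" j])
  qed
  then show ?thesis by (simp add: cyclic_trace_def)
qed

text \<open>Both sides contain the same composite B R A through the space shared by the two
  neighbours, so R may be attached to either of them.\<close>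

lemma cyclic_trace_slide:
  fixes X :: "'n::{finite,linorder} \<Rightarrow> complex ^ 'q ^ 'q"
  assumes n: "2 \<le> CARD('n)"
  shows "cyclic_trace (X(i := R ** A, nx i := B)) = cyclic_trace (X(i := A, nx i := B ** R))"
proof -
  let ?j = "nx i"
  have ij: "i \<noteq> ?j" "?j \<noteq> nx ?j" using nx_neq[OF n] by metis+
  define P where "P c = (\<Prod>k\<in>UNIV - {i, ?j}. X k $ c (nx k) $ c k)" for c
  have P: "P (c(?j := d)) = P c" for c d
    unfolding P_def by (rule prod.cong) auto
  have "cyclic_trace (X(i := R ** A, ?j := B)) = (\<Sum>c\<in>UNIV. \<Sum>d\<in>UNIV.
      R $ c ?j $ d * A $ d $ c i * B $ c (nx ?j) $ c ?j * P c)"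
    unfolding cyclic_trace_split2[OF ij(1)] P_def[symmetric]
    by (simp add: matrix_matrix_mult_def sum_distrib_right)
  also have "\<dots> = (\<Sum>(c, d)\<in>UNIV. R $ c ?j $ d * A $ d $ c i * B $ c (nx ?j) $ c ?j * P c)"
    by (simp add: sum.cartesian_product)
  also have "\<dots> = (\<Sum>(c, d)\<in>UNIV. A $ c ?j $ c i * (B $ c (nx ?j) $ d * R $ d $ c ?j) * P c)"
    \<comment> \<open>The summation index d trades places with the value of c at the shared space,
      on which \<open>P\<close> does not depend.\<close>
    by (rule sum.reindex_bij_witness[of _ "\<lambda>(c, d). (c(?j := d), c ?j)" "\<lambda>(c, d). (c(?j := d), c ?j)"])
      (use ij in \<open>auto simp: P\<close>)
  also have "\<dots> = (\<Sum>c\<in>UNIV. \<Sum>d\<in>UNIV. A $ c ?j $ c i * (B $ c (nx ?j) $ d * R $ d $ c ?j) * P c)"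
    by (simp add: sum.cartesian_product)
  also have "\<dots> = cyclic_trace (X(i := A, ?j := B ** R))"
    unfolding cyclic_trace_split2[OF ij(1)] P_def[symmetric]
    by (simp add: matrix_matrix_mult_def sum_distrib_left sum_distrib_right)
  finally show ?thesis .
qed

section \<open>Test tuples of matrix units\<close>

definition munit :: "'a \<Rightarrow> 'b \<Rightarrow> complex ^ 'b ^ 'a"
  where "munit a b = (\<chi> x y. if x = a \<and> y = b then 1 else 0)"

lemma munit_nth: "munit a b $ x $ y = (if x = a \<and> y = b then 1 else 0)"
  by (simp add: munit_def)

lemma mult_if_delta: "x * (if b then 1 else 0) = (if b then x else (0 :: complex))"
  by simp

text \<open>Matrix units along the walk c in all other blocks leave c as the only contributing walk:
  as i and j are not adjacent, each space still touches a block outside {i, j}, which pins the value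
  there.\<close>

lemma cyclic_trace_nonadjacent:
  assumes n: "2 \<le> CARD('n::{finite,linorder})" and ij: "i \<noteq> j" "\<not> adj i (j :: 'n)"
  shows "cyclic_trace ((\<lambda>k. munit (c (nx k)) (c k))(i := A, j := B)) = A $ c (nx i) $ c i * B $ c (nx j) $ c j"
proof -
  let ?P = "\<lambda>c'. \<Prod>k\<in>UNIV - {i, j}. munit (c (nx k)) (c k) $ c' (nx k) $ c' k"
  have "?P c' = (if c' = c then 1 else 0)" for c'
  proof (cases "c' = c")
    case False
    then obtain l where l: "c' l \<noteq> c l" by blast
    \<comment> \<open>Block l starts at the space l and block \<open>pv l\<close> ends there; one of
      the two lies outside {i, j}.\<close>
    define k where "k = (if l \<in> {i, j} then pv l else l)"
    have "k \<notin> {i, j}"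
    proof (cases "l \<in> {i, j}")
      case True
      then have "nx k \<in> {i, j}" "nx k = l" by (auto simp: k_def)
      moreover have "nx i \<noteq> i" "nx j \<noteq> j" using nx_neq[OF n] by blast+
      ultimately show ?thesis using ij by (auto simp: adj_def)
    qed (simp add: k_def)
    moreover have "munit (c (nx k)) (c k) $ c' (nx k) $ c' k = 0"
      using l by (auto simp: munit_nth k_def split: if_splits)
    ultimately show ?thesis using False by (auto intro!: prod_zero)
  qed (simp add: munit_nth)
  then show ?thesis
    unfolding cyclic_trace_split2[OF ij(1)] by (simp only: mult_if_delta) simp
qed

text \<open>The space between the neighbours touches no other block, so the walk is free there.
  After sliding A into B the identity in block i makes \<open>c(j := c i)\<close> the only
  contributing walk.\<close>

lemma cyclic_trace_adjacent:
  fixes A B :: "complex ^ 'q ^ 'q"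
  assumes n: "3 \<le> CARD('n::{finite,linorder})" and j: "j = nx (i :: 'n)"
  shows "cyclic_trace ((\<lambda>k. munit (c (nx k)) (c k))(i := A, j := B)) = (B ** A) $ c (nx j) $ c i"
proof -
  have n2: "2 \<le> CARD('n)" using n by simp
  have ij: "i \<noteq> j" "nx j \<noteq> i" using nx_neq[OF n2] nx_nx_neq[OF n] j by metis+
  let ?E = "\<lambda>k. munit (c (nx k)) (c k)"
  let ?P = "\<lambda>c'. \<Prod>k\<in>UNIV - {i, j}. munit (c (nx k)) (c k) $ c' (nx k) $ c' k"
  have "cyclic_trace (?E(i := A, j := B)) = cyclic_trace (?E(i := mat 1, j := B ** A))"
    using cyclic_trace_slide[OF n2, of ?E i A "mat 1" B] j by simp
  also have "\<dots> = (\<Sum>c'\<in>UNIV. if c' = c(j := c i) then (B ** A) $ c (nx j) $ c i else 0)"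
    unfolding cyclic_trace_split2[OF ij(1)]
  proof (rule sum.cong)
    fix c'
    show "mat 1 $ c' (nx i) $ c' i * (B ** A) $ c' (nx j) $ c' j * ?P c' =
      (if c' = c(j := c i) then (B ** A) $ c (nx j) $ c i else 0)"
    proof (cases "\<forall>l. l \<noteq> j \<longrightarrow> c' l = c l")
      case True
      have "?P c' = 1"
        by (rule prod.neutral) (use True j in \<open>auto simp: munit_nth\<close>)
      moreover have "c' = c(j := c i) \<longleftrightarrow> c' j = c i" using True by auto
      moreover have "nx j \<noteq> j" using nx_neq[OF n2] by metis
      ultimately show ?thesis using True ij by (auto simp: mat_def j[symmetric])
    next
      case False
      then obtain l where l: "l \<noteq> j" "c' l \<noteq> c l" by blast
      define k where "k = (if l = i then pv l else l)"
      have "k \<notin> {i, j}"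
      proof (cases "l = i")
        case True
        then have "nx k = i" by (simp add: k_def)
        then show ?thesis using ij nx_neq[OF n2, of i] by auto
      qed (use l in \<open>simp add: k_def\<close>)
      moreover have "munit (c (nx k)) (c k) $ c' (nx k) $ c' k = 0"
        using l by (auto simp: munit_nth k_def split: if_splits)
      ultimately have "?P c' = 0" by (auto intro!: prod_zero)
      moreover have "c' \<noteq> c(j := c i)" using l by auto
      ultimately show ?thesis by simp
    qed
  qed simp
  finally show ?thesis by simp
qed

lemma adjacent_mult_eqI:
  fixes A B :: "complex ^ 'q ^ 'q"
  assumes n: "3 \<le> CARD('n::{finite,linorder})"
    and eq: "\<And>X. cyclic_trace (X(i := A, nx (i :: 'n) := B)) = cyclic_trace (X(i := A', nx i := B'))"
  shows "B ** A = B' ** A'"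
proof -
  have "(B ** A) $ a $ b = (B' ** A') $ a $ b" for a b
  proof -
    \<comment> \<open>Row and column of the product can be prescribed independently because i and
      \<open>nx (nx i)\<close> differ for n \<ge> 3.\<close>
    define c where "c = (\<lambda>_. a)(i := b)"
    have "c (nx (nx i)) = a" "c i = b" using nx_nx_neq[OF n, of i] by (simp_all add: c_def)
    moreover have "(B ** A) $ c (nx (nx i)) $ c i = (B' ** A') $ c (nx (nx i)) $ c i"
      unfolding cyclic_trace_adjacent[OF n refl, symmetric] by (rule eq)
    ultimately show ?thesis by simp
  qed
  then show ?thesis by (simp add: vec_eq_iff)
qed

lemma adjacent_mult_zeroI:
  fixes A B :: "complex ^ 'q ^ 'q"
  assumes n: "3 \<le> CARD('n::{finite,linorder})"
    and eq: "\<And>X. cyclic_trace (X(i := A, nx (i :: 'n) := B)) = 0"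
  shows "B ** A = 0"
proof -
  have "cyclic_trace (X(i := A, nx i := B)) = cyclic_trace (X(i := A, nx i := 0))" for X
    using cyclic_trace_zero[of "X(i := A, nx i := 0)" "nx i"] eq by simp
  from adjacent_mult_eqI[OF n this] show ?thesis by simp
qed

lemma nonadjacent_zeroD:
  fixes A B :: "complex ^ 'q ^ 'q"
  assumes n: "2 \<le> CARD('n::{finite,linorder})" and ij: "i \<noteq> j" "\<not> adj i (j :: 'n)"
    and eq: "\<And>X. cyclic_trace (X(i := A, j := B)) = 0"
  shows "A = 0 \<or> B = 0"
proof (rule ccontr)
  assume "\<not> ?thesis"
  then obtain a b a' b' where ab: "A $ a $ b \<noteq> 0" "B $ a' $ b' \<noteq> 0" by (auto simp: vec_eq_iff)
  \<comment> \<open>The four ends i, \<open>nx i\<close>, j, \<open>nx j\<close> are distinct for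
    non-adjacent blocks, so a walk can pass through both nonzero entries.\<close>
  define c where "c = (\<lambda>_. a)(i := b, nx j := a', j := b')"
  have "j \<noteq> nx j" "i \<noteq> nx i" using nx_neq[OF n] by metis+
  then have c: "c (nx i) = a" "c i = b" "c (nx j) = a'" "c j = b'"
    using ij by (auto simp: adj_def c_def)
  have "A $ c (nx i) $ c i * B $ c (nx j) $ c j = 0"
    unfolding cyclic_trace_nonadjacent[OF n ij, symmetric] by (rule eq)
  then show False using ab by (simp add: c)
qed

section \<open>The second derivative and the permutation of blocks\<close>

text \<open>The trace is linear in each block, so the product rule replaces one block at a time by
  its direction.\<close>

lemma DERIV_cyclic_trace:
  "((\<lambda>s. cyclic_trace (\<lambda>i. A i + mat s ** B i)) has_field_derivative
    (\<Sum>j\<in>UNIV. cyclic_trace ((\<lambda>i. A i + mat s ** B i)(j := B j)))) (at s)"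
proof -
  let ?g = "\<lambda>c i s. A i $ c (nx i) $ c i + s * B i $ c (nx i) $ c i"
  have "((\<lambda>s. \<Sum>c\<in>UNIV. \<Prod>i\<in>UNIV. ?g c i s) has_field_derivative
      (\<Sum>c\<in>UNIV. \<Sum>j\<in>UNIV. B j $ c (nx j) $ c j * (\<Prod>i\<in>UNIV - {j}. ?g c i s))) (at s)"
    by (intro DERIV_sum has_field_derivative_prod) (auto intro!: derivative_eq_intros)
  moreover have "(\<Sum>c\<in>UNIV. \<Sum>j\<in>UNIV. B j $ c (nx j) $ c j * (\<Prod>i\<in>UNIV - {j}. ?g c i s)) =
      (\<Sum>j\<in>UNIV. cyclic_trace ((\<lambda>i. A i + mat s ** B i)(j := B j)))"
    by (subst sum.swap) (simp add: cyclic_trace_update)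
  ultimately show ?thesis by (simp add: cyclic_trace_def)
qed

text \<open>Defining this by differentiation of the trace makes its invariance under linear
  symmetries immediate; the explicit formula follows separately.\<close>

definition second_diff :: "('n \<Rightarrow> complex ^ 'q ^ 'q) \<Rightarrow> ('n \<Rightarrow> complex ^ 'q ^ 'q) \<Rightarrow>
    ('n::{finite,linorder} \<Rightarrow> complex ^ 'q ^ 'q) \<Rightarrow> complex"
  where "second_diff w v X =
    deriv (\<lambda>t. deriv (\<lambda>s. cyclic_trace (\<lambda>i. X i + mat t ** w i + mat s ** v i)) 0) 0"

lemma second_diff_eq:
  "second_diff w v X = (\<Sum>(i, j)\<in>UNIV. if i \<noteq> j then cyclic_trace (X(i := w i, j := v j)) else 0)"
proof -
  have 1: "deriv (\<lambda>s. cyclic_trace (\<lambda>i. X i + mat t ** w i + mat s ** v i)) 0 =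
      (\<Sum>j\<in>UNIV. cyclic_trace ((\<lambda>i. X i + mat t ** w i)(j := v j)))" for t
    using DERIV_imp_deriv[OF DERIV_cyclic_trace[of "\<lambda>i. X i + mat t ** w i" v 0]] by simp
  \<comment> \<open>With block j frozen at \<open>v j\<close>, the tuple still moves on a line, now
    in the direction \<open>w(j := 0)\<close>, so the first derivative formula applies
    again.\<close>
  have 2: "(\<lambda>i. X i + mat t ** w i)(j := v j) = (\<lambda>i. (X(j := v j)) i + mat t ** (w(j := 0)) i)" for t j
    by (auto simp: vec_eq_iff)
  have 3: "(X(j := v j))(i := (w(j := 0)) i) = (if i = j then X(i := 0) else X(i := w i, j := v j))" for i j
    by (auto simp: fun_eq_iff)
  have "((\<lambda>t. \<Sum>j\<in>UNIV. cyclic_trace ((\<lambda>i. X i + mat t ** w i)(j := v j))) has_field_derivative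
      (\<Sum>j\<in>UNIV. \<Sum>i\<in>UNIV. cyclic_trace ((\<lambda>i. (X(j := v j)) i + mat 0 ** (w(j := 0)) i)(i := (w(j := 0)) i)))) (at 0)"
    unfolding 2 by (intro DERIV_sum DERIV_cyclic_trace)
  then have "second_diff w v X = (\<Sum>j\<in>UNIV. \<Sum>i\<in>UNIV. cyclic_trace ((X(j := v j))(i := (w(j := 0)) i)))"
    unfolding second_diff_def 1 mat_0 matrix_zero_mult add_0_right
    by (rule DERIV_imp_deriv)
  also have "\<dots> = (\<Sum>i\<in>UNIV. \<Sum>j\<in>UNIV. if i \<noteq> j then cyclic_trace (X(i := w i, j := v j)) else 0)"
    unfolding 3 by (subst sum.swap) (auto intro!: sum.cong cyclic_trace_zero[of "X(_ := 0)"])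
  finally show ?thesis by (simp add: sum.cartesian_product)
qed

text \<open>The identical vanishing of the mixed second derivative, split into one condition for
  each pair of blocks.\<close>

definition orth :: "('n \<Rightarrow> complex ^ 'q ^ 'q) \<Rightarrow> ('n::{finite,linorder} \<Rightarrow> complex ^ 'q ^ 'q) \<Rightarrow> bool"
  where "orth w v \<longleftrightarrow> (\<forall>i j X. i \<noteq> j \<longrightarrow>
    cyclic_trace (X(i := w i, j := v j)) + cyclic_trace (X(i := v i, j := w j)) = 0)"

lemma orthD:
  "orth w v \<Longrightarrow> i \<noteq> j \<Longrightarrow> cyclic_trace (X(i := w i, j := v j)) + cyclic_trace (X(i := v i, j := w j)) = 0"
  by (simp add: orth_def)

text \<open>Setting \<open>X i = X j = 0\<close> isolates the contribution of the blocks \<open>i\<close> and \<open>j\<close>.\<close>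

lemma orth_iff_second_diff:
  fixes w v :: "'n::{finite,linorder} \<Rightarrow> complex ^ 'q ^ 'q"
  shows "orth w v \<longleftrightarrow> (\<forall>X. second_diff w v X = 0)"
proof
  assume o: "orth w v"
  show "\<forall>X. second_diff w v X = 0"
  proof
    fix X :: "'n \<Rightarrow> complex ^ 'q ^ 'q"
    let ?a = "\<lambda>i j :: 'n. if i \<noteq> j then cyclic_trace (X(i := w i, j := v j)) else 0"
    \<comment> \<open>Exchanging the two indices turns the sum into its own negative.\<close>
    have "second_diff w v X = (\<Sum>(i, j)\<in>(UNIV :: ('n \<times> 'n) set). ?a j i)"
      unfolding second_diff_eq
      by (rule sum.reindex_bij_witness[of _ "\<lambda>(i, j). (j, i)" "\<lambda>(i, j). (j, i)"]) auto
    also have "\<dots> = (\<Sum>(i, j)\<in>UNIV. - ?a i j)"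
    proof (rule sum.cong)
      fix p :: "'n \<times> 'n"
      obtain i j where p: "p = (i, j)" by fastforce
      have "i \<noteq> j \<Longrightarrow> ?a i j + ?a j i = 0"
        using orthD[OF o, of i j X] fun_upd_twist[of j i X "w j" "v i"] by simp
      then show "(case p of (i, j) \<Rightarrow> ?a j i) = (case p of (i, j) \<Rightarrow> - ?a i j)"
        by (auto simp: p eq_neg_iff_add_eq_0 add.commute)
    qed simp
    also have "\<dots> = - second_diff w v X"
      unfolding second_diff_eq by (simp add: sum_negf[symmetric] case_prod_unfold)
    finally show "second_diff w v X = 0" by simp
  qed
next
  assume o: "\<forall>X. second_diff w v X = 0"
  show "orth w v" unfolding orth_def
  proof (intro allI impI)
    fix i j :: 'n and X :: "'n \<Rightarrow> complex ^ 'q ^ 'q" assume ij: "i \<noteq> j"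
    let ?X = "X(i := 0, j := 0)"
    let ?a = "\<lambda>k l. if k \<noteq> l then cyclic_trace (?X(k := w k, l := v l)) else 0"
    have z: "?a k l = 0" if "(k, l) \<notin> {(i, j), (j, i)}" for k l
    proof (cases "k = l")
      case False
      then have "(?X(k := w k, l := v l)) i = 0 \<or> (?X(k := w k, l := v l)) j = 0"
        using that ij by auto
      then have "cyclic_trace (?X(k := w k, l := v l)) = 0" using cyclic_trace_zero by blast
      then show ?thesis by (simp only: if_cancel)
    qed simp
    have "second_diff w v ?X = (\<Sum>(k, l)\<in>{(i, j), (j, i)}. ?a k l)"
      unfolding second_diff_eq
      by (rule sum.mono_neutral_right) (use z in auto)
    also have "\<dots> = cyclic_trace (?X(i := w i, j := v j)) + cyclic_trace (?X(j := w j, i := v i))"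
      using ij by simp
    also have "?X(i := w i, j := v j) = X(i := w i, j := v j)" by auto
    also have "?X(j := w j, i := v i) = X(i := v i, j := w j)" using ij by auto
    finally show "cyclic_trace (X(i := w i, j := v j)) + cyclic_trace (X(i := v i, j := w j)) = 0"
      using o by metis
  qed
qed

definition imm_sym :: "(('n::{finite,linorder} \<Rightarrow> complex ^ 'q ^ 'q) \<Rightarrow> 'n \<Rightarrow> complex ^ 'q ^ 'q) \<Rightarrow> bool"
  where "imm_sym G \<longleftrightarrow> bij G \<and> (\<forall>X Y z. G (\<lambda>i. X i + mat z ** Y i) = (\<lambda>i. G X i + mat z ** G Y i)) \<and>
    (\<forall>X. cyclic_trace (G X) = cyclic_trace X)"

lemma imm_sym_linear: "imm_sym G \<Longrightarrow> G (\<lambda>i. X i + mat z ** Y i) = (\<lambda>i. G X i + mat z ** G Y i)"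
  by (simp add: imm_sym_def)

lemma imm_sym_add: "imm_sym G \<Longrightarrow> G (\<lambda>i. X i + Y i) = (\<lambda>i. G X i + G Y i)"
  using imm_sym_linear[of G X 1 Y] by simp

lemma imm_sym_zero: "imm_sym G \<Longrightarrow> G (\<lambda>i. 0) = (\<lambda>i. 0)"
  using imm_sym_add[of G "\<lambda>i. 0" "\<lambda>i. 0"] by (simp add: fun_eq_iff)

text \<open>A linear symmetry carries the family X + t w + s v to a family of the same kind with
  equal traces. Surjectivity makes its image cover all base points.\<close>

lemma imm_sym_orth:
  assumes G: "imm_sym G"
  shows "orth (G w) (G v) \<longleftrightarrow> orth w v"
proof -
  have "second_diff (G w) (G v) (G X) = second_diff w v X" for X
  proof -
    have "cyclic_trace (\<lambda>i. G X i + mat t ** G w i + mat s ** G v i) =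
        cyclic_trace (\<lambda>i. X i + mat t ** w i + mat s ** v i)" for s t
      using G unfolding imm_sym_def by metis
    then show ?thesis by (simp add: second_diff_def)
  qed
  moreover have "surj G" using G by (simp add: imm_sym_def bij_is_surj)
  ultimately show ?thesis unfolding orth_iff_second_diff by (metis surjD)
qed

section \<open>Blocks and their recognition by orthogonal spaces\<close>

definition block_space :: "'n \<Rightarrow> ('n \<Rightarrow> complex ^ 'q ^ 'q) set"
  where "block_space i = {X. \<forall>k. k \<noteq> i \<longrightarrow> X k = 0}"

definition perp :: "('n::{finite,linorder} \<Rightarrow> complex ^ 'q ^ 'q) \<Rightarrow> ('n \<Rightarrow> complex ^ 'q ^ 'q) set"
  where "perp w = {v. orth w v}"

abbreviation single :: "'n \<Rightarrow> complex ^ 'q ^ 'q \<Rightarrow> 'n \<Rightarrow> complex ^ 'q ^ 'q"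
  where "single i A \<equiv> (\<lambda>_. 0)(i := A)"

lemma single_in_block_space: "single i A \<in> block_space i"
  by (simp add: block_space_def)

lemma block_space_eq_single: "X \<in> block_space i \<Longrightarrow> X = single i (X i)"
  by (auto simp: block_space_def)

lemma mat_1_neq_0: "(mat 1 :: complex ^ 'q ^ 'q) \<noteq> 0"
  by (auto simp: vec_eq_iff mat_def)

lemma cyclic_trace_update_zero: "cyclic_trace (X(i := 0, j := B)) = 0" if "i \<noteq> j"
  using that cyclic_trace_zero[of "X(i := 0, j := B)" i] by simp

lemma cyclic_trace_update_zero': "cyclic_trace (X(i := A, j := 0)) = 0"
  using cyclic_trace_zero[of "X(i := A, j := 0)" j] by simp

text \<open>The identity is nonzero and neutral on both sides, so it detects B whether or not the
  two blocks are adjacent, and in either order.\<close>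

lemma identity_pair_zeroD:
  fixes B :: "complex ^ 'q ^ 'q"
  assumes n: "3 \<le> CARD('n::{finite,linorder})" and il: "i \<noteq> (l :: 'n)"
    and z: "\<And>X. cyclic_trace (X(i := mat 1, l := B)) = 0"
  shows "B = 0"
proof (cases "adj i l")
  case False
  have n2: "2 \<le> CARD('n)" using n by simp
  show ?thesis using nonadjacent_zeroD[OF n2 il False z] mat_1_neq_0 by blast
next
  case True
  then consider "l = nx i" | "i = nx l" by (auto simp: adj_def)
  then show ?thesis
  proof cases
    case 1
    then have "B ** mat 1 = 0" using adjacent_mult_zeroI[OF n, of i "mat 1" B] z by simp
    then show ?thesis by simp
  next
    case 2
    have "cyclic_trace (X(l := B, nx l := mat 1)) = 0" for X
      using z[of X] fun_upd_twist[OF il, of X "mat 1" B] 2 by simp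
    from adjacent_mult_zeroI[OF n this] show ?thesis by simp
  qed
qed

lemma orth_selfD:
  assumes "orth w w" "i \<noteq> j"
  shows "cyclic_trace (X(i := w i, j := w j)) = 0"
  using orthD[OF assms, of X] by simp

text \<open>For v supported on two blocks only the pairs that meet these blocks can contribute; the
  three conditions list them.\<close>

lemma orth_pairI:
  fixes w v :: "'n::{finite,linorder} \<Rightarrow> complex ^ 'q ^ 'q"
  assumes ij: "i \<noteq> j" and v: "\<And>k. k \<notin> {i, j} \<Longrightarrow> v k = 0"
    and 1: "\<And>X. cyclic_trace (X(i := w i, j := v j)) + cyclic_trace (X(i := v i, j := w j)) = 0"
    and 2: "\<And>k X. k \<notin> {i, j} \<Longrightarrow> cyclic_trace (X(k := w k, i := v i)) = 0"
    and 3: "\<And>k X. k \<notin> {i, j} \<Longrightarrow> cyclic_trace (X(k := w k, j := v j)) = 0"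
  shows "orth w v"
  unfolding orth_def
proof (intro allI impI)
  fix k l :: 'n and X :: "'n \<Rightarrow> complex ^ 'q ^ 'q" assume kl: "k \<noteq> l"
  have sw: "X(l := a, k := b) = X(k := b, l := a)" for a b
    using kl by (simp add: fun_upd_twist)
  note z = cyclic_trace_update_zero[OF kl] cyclic_trace_update_zero'
  consider "k = i" "l = j" | "k = j" "l = i" | "k \<notin> {i, j}" "l \<in> {i, j}" | "k \<in> {i, j}" "l \<notin> {i, j}"
    | "k \<notin> {i, j}" "l \<notin> {i, j}" using kl by auto
  then show "cyclic_trace (X(k := w k, l := v l)) + cyclic_trace (X(k := v k, l := w l)) = 0"
  proof cases
    case 2
    then show ?thesis using 1[of X] sw by (simp add: add.commute)
  next
    case 3
    then show ?thesis using assms(4,5)[of k X] v[of k] z by auto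
  next
    case 4
    then show ?thesis using assms(4,5)[of l X] v[of l] z sw by auto
  next
    case 5
    then show ?thesis by (simp add: v z del: fun_upd_apply)
  qed (use 1 in auto)
qed

text \<open>The vector is tangent at w to the orbit of GL of the space between the two blocks. On
  the pair itself the two terms cancel by sliding R; against a third block, R slides into an
  arbitrary block and leaves a pairing of w with itself.\<close>

lemma orth_gl_tangent:
  fixes w :: "'n::{finite,linorder} \<Rightarrow> complex ^ 'q ^ 'q"
  assumes n: "3 \<le> CARD('n)" and w: "orth w w"
  shows "orth w ((\<lambda>_. 0)(i := - (R ** w i), nx i := w (nx i) ** R))"
proof (rule orth_pairI[of i "nx i"])
  have n2: "2 \<le> CARD('n)" using n by simp
  show ij: "i \<noteq> nx i" using nx_neq[OF n2] by metis
  let ?v = "(\<lambda>_. 0)(i := - (R ** w i), nx i := w (nx i) ** R)"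
  have vi: "?v i = - (R ** w i)" "?v (nx i) = w (nx i) ** R" using ij by auto
  show "cyclic_trace (X(i := w i, nx i := ?v (nx i))) + cyclic_trace (X(i := ?v i, nx i := w (nx i))) = 0" for X
    unfolding vi using ij cyclic_trace_slide[OF n2, of X i R "w i" "w (nx i)"]
      cyclic_trace_update_uminus[of "X(nx i := w (nx i))" i "R ** w i"]
    by (simp add: fun_upd_twist[of i "nx i"])
  fix k X assume k: "k \<notin> {i, nx i}"
  \<comment> \<open>The redundant update of \<open>nx i\<close> exposes the free block that absorbs
    R.\<close>
  have "cyclic_trace (X(k := w k, i := R ** w i)) = cyclic_trace ((X(k := w k))(i := R ** w i, nx i := X (nx i)))"
    using k ij by (intro arg_cong[of _ _ cyclic_trace]) auto
  also have "\<dots> = cyclic_trace ((X(nx i := X (nx i) ** R))(k := w k, i := w i))"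
    unfolding cyclic_trace_slide[OF n2] using k ij by (intro arg_cong[of _ _ cyclic_trace]) auto
  also have "\<dots> = 0" using k by (intro orth_selfD[OF w]) auto
  finally show "cyclic_trace (X(k := w k, i := ?v i)) = 0"
    unfolding vi cyclic_trace_update_uminus by simp
  have "cyclic_trace (X(k := w k, nx i := w (nx i) ** R)) =
      cyclic_trace ((X(k := w k))(i := X i, nx i := w (nx i) ** R))"
    using k ij by (intro arg_cong[of _ _ cyclic_trace]) auto
  also have "\<dots> = cyclic_trace ((X(i := R ** X i))(k := w k, nx i := w (nx i)))"
    unfolding cyclic_trace_slide[OF n2, symmetric] using k ij by (intro arg_cong[of _ _ cyclic_trace]) auto
  also have "\<dots> = 0" using k by (intro orth_selfD[OF w]) auto
  finally show "cyclic_trace (X(k := w k, nx i := ?v (nx i))) = 0"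
    unfolding vi .
qed auto

lemma matrix_mult_munit_mult:
  "(B ** munit a b ** A) $ x $ y = B $ x $ a * A $ b $ y" for A :: "complex ^ 'q ^ 'q" and B :: "complex ^ 'q ^ 'q"
proof -
  have "(B ** munit a b) $ x $ z = (if z = b then B $ x $ a else 0)" for z
    by (auto simp: matrix_matrix_mult_def munit_nth mult_if_delta)
  then have "(B ** munit a b ** A) $ x $ y = (\<Sum>z\<in>UNIV. (if z = b then B $ x $ a else 0) * A $ z $ y)"
    by (simp add: matrix_matrix_mult_def[of "B ** munit a b"])
  also have "\<dots> = (\<Sum>z\<in>UNIV. if z = b then B $ x $ a * A $ b $ y else 0)"
    by (rule sum.cong) auto
  finally show ?thesis by simp
qed

lemma matrix_mult_uminus_right: "B ** (- A) = - (B ** A)" for A :: "complex ^ 'q ^ 'r" and B :: "complex ^ 'r ^ 's"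
  by (simp add: vec_eq_iff matrix_matrix_mult_def sum_negf)

lemma matrix_add_mult_distrib: "(A + B) ** C = A ** C + B ** C" for A B :: "complex ^ 'q ^ 'r"
  by (simp add: vec_eq_iff matrix_matrix_mult_def distrib_right sum.distrib)

text \<open>Isotropy of the tangent vectors gives B R R A = 0 for every R. Replacing R by 1 + R, and
  using B A = 0, yields B R A = 0, and a matrix unit R then separates a nonzero entry of A from one
  of B.\<close>

lemma isotropic_perp_no_adjacent:
  fixes w :: "'n::{finite,linorder} \<Rightarrow> complex ^ 'q ^ 'q"
  assumes n: "3 \<le> CARD('n)" and w: "orth w w" and iso: "\<And>v. orth w v \<Longrightarrow> orth v v"
  shows "w i = 0 \<or> w (nx i) = 0"
proof -
  have n2: "2 \<le> CARD('n)" using n by simp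
  have ij: "i \<noteq> nx i" using nx_neq[OF n2] by metis
  let ?A = "w i" and ?B = "w (nx i)"
  have BA: "?B ** ?A = 0"
    using orth_selfD[OF w ij] by (rule adjacent_mult_zeroI[OF n])
  have sq: "?B ** (R ** R) ** ?A = 0" for R
  proof -
    let ?v = "(\<lambda>_. 0)(i := - (R ** ?A), nx i := ?B ** R)"
    have "orth ?v ?v" by (rule iso[OF orth_gl_tangent[OF n w]])
    from orth_selfD[OF this ij] have "cyclic_trace (X(i := - (R ** ?A), nx i := ?B ** R)) = 0" for X
      using ij by simp
    then have "(?B ** R) ** (- (R ** ?A)) = 0" by (rule adjacent_mult_zeroI[OF n])
    moreover have "(?B ** R) ** (- (R ** ?A)) = - (?B ** (R ** R) ** ?A)"
      by (simp add: matrix_mult_uminus_right matrix_mul_assoc)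
    ultimately show ?thesis by simp
  qed
  have lin: "?B ** R ** ?A = 0" for R
  proof -
    have "(mat 1 + R) ** (mat 1 + R) = mat 1 + R + R + R ** R"
      by (simp add: matrix_add_ldistrib matrix_add_mult_distrib)
    then have "?B ** (mat 1 + R + R + R ** R) ** ?A = 0" using sq[of "mat 1 + R"] by simp
    moreover have "?B ** (mat 1 + R + R + R ** R) ** ?A =
        ?B ** ?A + ?B ** R ** ?A + ?B ** R ** ?A + ?B ** (R ** R) ** ?A"
      by (simp only: matrix_add_ldistrib matrix_add_mult_distrib matrix_mul_rid)
    ultimately have "?B ** R ** ?A + ?B ** R ** ?A = 0"
      using BA sq[of R] by simp
    then show ?thesis by (simp add: vec_eq_iff)
  qed
  show ?thesis
  proof (rule ccontr)
    assume "\<not> ?thesis"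
    then obtain x a b y where "?B $ x $ a \<noteq> 0" "?A $ b $ y \<noteq> 0" by (auto simp: vec_eq_iff)
    then have "(?B ** munit a b ** ?A) $ x $ y \<noteq> 0" by (simp add: matrix_mult_munit_mult)
    then show False using lin by simp
  qed
qed

text \<open>This recognizes the blocks by orthogonality alone: such a w lives in a single block, and
  its orthogonal space is that whole block.\<close>

lemma perp_isotropic_eq_block_space:
  fixes w :: "'n::{finite,linorder} \<Rightarrow> complex ^ 'q ^ 'q"
  assumes n: "3 \<le> CARD('n)" and w: "orth w w" and iso: "\<And>v. orth w v \<Longrightarrow> orth v v"
  shows "\<exists>i. perp w = block_space i"
proof -
  have n2: "2 \<le> CARD('n)" using n by simp
  have ne: "k \<noteq> nx k" for k :: 'n using nx_neq[OF n2] by metis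
  have sep: "w i = 0 \<or> w j = 0" if "i \<noteq> j" for i j
  proof (cases "adj i j")
    case True
    then show ?thesis
      using isotropic_perp_no_adjacent[OF n w iso, of i] isotropic_perp_no_adjacent[OF n w iso, of j]
      by (auto simp: adj_def)
  next
    case False
    show ?thesis by (rule nonadjacent_zeroD[OF n2 that False orth_selfD[OF w that]])
  qed
  \<comment> \<open>The zero vector is orthogonal to everything, in particular to the tuple of
    identities, which is not isotropic.\<close>
  have "\<exists>i. w i \<noteq> 0"
  proof (rule ccontr)
    assume "\<not> ?thesis"
    then have "w = (\<lambda>_. 0)" by auto
    moreover have "orth (\<lambda>_. 0) (\<lambda>_ :: 'n. mat 1 :: complex ^ 'q ^ 'q)"
      unfolding orth_def by (auto simp: cyclic_trace_update_zero cyclic_trace_update_zero' simp del: fun_upd_apply)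
    ultimately have "orth w (\<lambda>_. mat 1)" by simp
    then have o: "orth (\<lambda>_ :: 'n. mat 1 :: complex ^ 'q ^ 'q) (\<lambda>_. mat 1)" by (rule iso)
    obtain i :: 'n where True by blast
    have "mat 1 ** (mat 1 :: complex ^ 'q ^ 'q) = 0"
      using orth_selfD[OF o ne[of i]] by (rule adjacent_mult_zeroI[OF n])
    then show False using mat_1_neq_0[where 'q='q] by simp
  qed
  then obtain i where i: "w i \<noteq> 0" by blast
  have w0: "w k = 0" if "k \<noteq> i" for k using sep[of k i] that i by auto
  have "perp w = block_space i"
  proof (intro Set.set_eqI iffI)
    fix v :: "'n \<Rightarrow> complex ^ 'q ^ 'q" assume v: "v \<in> block_space i"
    have "v k = 0" if "k \<noteq> i" for k using v that by (simp add: block_space_def)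
    then have "orth w v"
      unfolding orth_def using w0 cyclic_trace_update_zero cyclic_trace_update_zero'
      by (metis add.right_neutral)
    then show "v \<in> perp w" by (simp add: perp_def)
  next
    fix v assume "v \<in> perp w"
    then have v: "orth w v" by (simp add: perp_def)
    have "v l = 0" if l: "l \<noteq> i" for l
    proof -
      \<comment> \<open>Since w lives in block i, setting component i to the identity and erasing
        all others except l preserves orthogonality to w. Isotropy of the new vector then forces
        \<open>v l = 0\<close>.\<close>
      let ?u = "(\<lambda>_. 0)(i := mat 1, l := v l)"
      have il: "i \<noteq> l" using l by simp
      have u: "?u i = mat 1" "?u l = v l" using l by auto
      have "orth w ?u"
      proof (rule orth_pairI[OF il])
        fix X
        show "cyclic_trace (X(i := w i, l := ?u l)) + cyclic_trace (X(i := ?u i, l := w l)) = 0"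
          using orthD[OF v il, of X] w0[OF l] cyclic_trace_update_zero' unfolding u by metis
      next
        fix k and X :: "'n \<Rightarrow> complex ^ 'q ^ 'q" assume k: "k \<notin> {i, l}"
        then have "w k = 0" "k \<noteq> i" "k \<noteq> l" using w0 by auto
        then show "cyclic_trace (X(k := w k, i := ?u i)) = 0" "cyclic_trace (X(k := w k, l := ?u l)) = 0"
          using cyclic_trace_update_zero by metis+
      qed auto
      then have "orth ?u ?u" by (rule iso)
      from orth_selfD[OF this il] have z: "cyclic_trace (X(i := mat 1, l := v l)) = 0" for X
        unfolding u .
      show "v l = 0" by (rule identity_pair_zeroD[OF n il z])
    qed
    then show "v \<in> block_space i" by (simp add: block_space_def)
  qed
  then show ?thesis by blast
qed

lemma orth_same_block:
  assumes "w \<in> block_space i" "v \<in> block_space i"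
  shows "orth w v"
proof -
  have "w k = 0" "v k = 0" if "k \<noteq> i" for k using assms that by (auto simp: block_space_def)
  then show ?thesis
    unfolding orth_def using cyclic_trace_update_zero cyclic_trace_update_zero'
    by (metis add.right_neutral)
qed

text \<open>The identity in block i pairs nontrivially with any nonzero component outside that
  block.\<close>

lemma orth_block_identityD:
  fixes v :: "'n::{finite,linorder} \<Rightarrow> complex ^ 'q ^ 'q"
  assumes n: "3 \<le> CARD('n)" and v: "orth (single i (mat 1)) v"
  shows "v \<in> block_space i"
proof -
  have "v l = 0" if l: "l \<noteq> i" for l
  proof -
    have il: "i \<noteq> l" using l by simp
    have z: "cyclic_trace (X(i := mat 1, l := v l)) = 0" for X
      using orthD[OF v il, of X] l cyclic_trace_update_zero'[of X i "v i" l] by simp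
    show "v l = 0" by (rule identity_pair_zeroD[OF n il z])
  qed
  then show ?thesis by (simp add: block_space_def)
qed

text \<open>Block i is the orthogonal space of the vector with the identity in that block. A
  symmetry transports this description, together with total isotropy, to the image, where blocks are
  recognized.\<close>

lemma imm_sym_block:
  fixes G :: "('n::{finite,linorder} \<Rightarrow> complex ^ 'q ^ 'q) \<Rightarrow> 'n \<Rightarrow> complex ^ 'q ^ 'q"
  assumes n: "3 \<le> CARD('n)" and G: "imm_sym G"
  shows "\<exists>j. G ` block_space i = block_space j"
proof -
  let ?w = "single i (mat 1 :: complex ^ 'q ^ 'q)"
  have surj: "\<exists>v'. v = G v'" for v using G by (simp add: imm_sym_def bij_is_surj surjD)
  have eq: "G ` block_space i = perp (G ?w)"
  proof (intro Set.set_eqI iffI)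
    fix v assume "v \<in> G ` block_space i"
    then show "v \<in> perp (G ?w)"
      by (auto simp: perp_def imm_sym_orth[OF G] intro!: orth_same_block[OF single_in_block_space])
  next
    fix v assume v: "v \<in> perp (G ?w)"
    obtain v' where v': "v = G v'" using surj by blast
    have "v' \<in> block_space i"
      using v orth_block_identityD[OF n] by (simp add: v' perp_def imm_sym_orth[OF G])
    then show "v \<in> G ` block_space i" using v' by blast
  qed
  have iso: "orth v v" if "orth (G ?w) v" for v
  proof -
    obtain v' where v': "v = G v'" using surj by blast
    have "v' \<in> block_space i"
      using that orth_block_identityD[OF n] by (simp add: v' imm_sym_orth[OF G])
    then show ?thesis unfolding v' imm_sym_orth[OF G] by (intro orth_same_block)
  qed
  moreover have "orth (G ?w) (G ?w)"
    unfolding imm_sym_orth[OF G] by (rule orth_same_block[OF single_in_block_space single_in_block_space])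
  ultimately show ?thesis unfolding eq by (intro perp_isotropic_eq_block_space[OF n])
qed

lemma block_space_inject: "block_space i = (block_space j :: ('n \<Rightarrow> complex ^ 'q ^ 'q) set) \<Longrightarrow> i = j"
proof (rule ccontr)
  assume eq: "block_space i = (block_space j :: ('n \<Rightarrow> complex ^ 'q ^ 'q) set)" and "i \<noteq> j"
  have "single i (mat 1 :: complex ^ 'q ^ 'q) \<in> block_space j"
    using single_in_block_space[of i "mat 1 :: complex ^ 'q ^ 'q"] by (simp only: eq)
  then show False using \<open>i \<noteq> j\<close> mat_1_neq_0[where 'q='q] by (auto simp: block_space_def)
qed

text \<open>Sliding A across gathers the product B A in one block, so only this product
  matters.\<close>

lemma orth_adjacent_iff:
  assumes n: "3 \<le> CARD('n::{finite,linorder})"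
  shows "orth (single i A) (single (nx (i :: 'n)) B) \<longleftrightarrow> B ** A = 0"
proof
  have n2: "2 \<le> CARD('n)" using n by simp
  have ij: "i \<noteq> nx i" using nx_neq[OF n2] by metis
  {
    assume "orth (single i A) (single (nx i) B)"
    then have "cyclic_trace (X(i := A, nx i := B)) = 0" for X
      using orthD[of "single i A" "single (nx i) B" i "nx i" X] ij cyclic_trace_update_zero'[of X i 0 "nx i"] by simp
    then show "B ** A = 0" by (rule adjacent_mult_zeroI[OF n])
  next
    assume BA: "B ** A = 0"
    have z: "cyclic_trace (X(i := A, nx i := B)) = 0" for X
      using cyclic_trace_slide[OF n2, of X i A "mat 1" B] BA cyclic_trace_update_zero'[of X i "mat 1" "nx i"]
      by simp
    show "orth (single i A) (single (nx i) B)"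
    proof (rule orth_pairI[OF ij])
      show "cyclic_trace (X(i := single i A i, nx i := single (nx i) B (nx i))) +
          cyclic_trace (X(i := single (nx i) B i, nx i := single i A (nx i))) = 0" for X
        using z[of X] ij cyclic_trace_update_zero'[of X i 0 "nx i"] by simp
    next
      fix k and X :: "'n \<Rightarrow> complex ^ 'a ^ 'a" assume "k \<notin> {i, nx i}"
      then have k: "single i A k = 0" "k \<noteq> i" "k \<noteq> nx i" by auto
      show "cyclic_trace (X(k := single i A k, i := single (nx i) B i)) = 0"
        unfolding k(1) by (rule cyclic_trace_update_zero[OF k(2)])
      show "cyclic_trace (X(k := single i A k, nx i := single (nx i) B (nx i))) = 0"
        unfolding k(1) by (rule cyclic_trace_update_zero[OF k(3)])
    qed simp
  }
qed

text \<open>Two diagonal matrix units with different indices are nonzero and have product zero,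
  which gives a nonzero orthogonal pair in neighbouring blocks; non-adjacent blocks contain no such
  pair. For n = 3 any two different indices are adjacent.\<close>

lemma imm_sym_adj:
  fixes G :: "('n::{finite,linorder} \<Rightarrow> complex ^ 'q ^ 'q) \<Rightarrow> 'n \<Rightarrow> complex ^ 'q ^ 'q"
  assumes n: "3 \<le> CARD('n)" and q: "2 \<le> CARD('q) \<or> CARD('n) = 3" and G: "imm_sym G"
    and i: "G ` block_space i = block_space i'" and j: "G ` block_space (nx i) = block_space j'"
  shows "adj i' j'"
proof -
  have n2: "2 \<le> CARD('n)" using n by simp
  have inj: "inj G" using G by (simp add: imm_sym_def bij_is_inj)
  have ij: "i \<noteq> nx i" using nx_neq[OF n2] by metis
  have ij': "i' \<noteq> j'"
  proof
    assume "i' = j'"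
    then have "G ` block_space i = G ` block_space (nx i)" using i j by simp
    then have "block_space i = (block_space (nx i) :: ('n \<Rightarrow> complex ^ 'q ^ 'q) set)"
      using inj by (simp add: inj_image_eq_iff)
    then have "i = nx i" by (rule block_space_inject)
    then show False using ij by contradiction
  qed
  from q show ?thesis
  proof
    assume "2 \<le> CARD('q)"
    then obtain a b :: 'q where ab: "a \<noteq> b"
      using card_le_Suc0_iff_eq[of "UNIV :: 'q set"] by auto
    let ?w = "single i (munit a a)" and ?v = "single (nx i) (munit b b)"
    have prod0: "munit b b $ x $ k * munit a a $ k $ y = 0" for x k y
      using ab by (simp add: munit_nth)
    have "munit b b ** munit a a = (0 :: complex ^ 'q ^ 'q)"
      unfolding vec_eq_iff matrix_matrix_mult_def by (simp only: prod0 vec_lambda_beta) simp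
    then have "orth (G ?w) (G ?v)"
      unfolding imm_sym_orth[OF G] orth_adjacent_iff[OF n] .
    moreover have Gw: "G ?w \<in> block_space i'" "G ?v \<in> block_space j'"
      unfolding i[symmetric] j[symmetric] by (rule imageI[OF single_in_block_space])+
    ultimately have z: "cyclic_trace (X(i' := G ?w i', j' := G ?v j')) = 0" for X
      using orthD[of "G ?w" "G ?v" i' j' X] ij' cyclic_trace_update_zero'[of X i' "G ?v i'" j']
      by (simp add: block_space_def)
    show ?thesis
    proof (rule ccontr)
      assume "\<not> adj i' j'"
      from nonadjacent_zeroD[OF n2 ij' this z] have "G ?w i' = 0 \<or> G ?v j' = 0" .
      then have "G ?w = (\<lambda>_. 0) \<or> G ?v = (\<lambda>_. 0)"
        using Gw by (auto simp: block_space_def)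
      then have "?w = (\<lambda>_. 0) \<or> ?v = (\<lambda>_. 0)"
        using inj imm_sym_zero[OF G] by (metis injD)
      then have "munit a a = (0 :: complex ^ 'q ^ 'q) \<or> munit b b = (0 :: complex ^ 'q ^ 'q)"
        by (auto dest: fun_cong[of _ _ i] fun_cong[of _ _ "nx i"])
      then have "munit a a $ a $ a = (0 :: complex) \<or> munit b b $ b $ b = (0 :: complex)" by auto
      then show False by (simp add: munit_nth)
    qed
  next
    assume n3: "CARD('n) = 3"
    obtain m where m: "m < 3" "(nx ^^ m) i' = j'" using nx_transitive[of i' j'] n3 by auto
    then have "m = 1 \<or> m = 2" using ij' by (cases m) auto
    then show ?thesis
    proof
      assume "m = 2"
      then have "nx j' = (nx ^^ 3) i'" using m by (simp add: numeral_3_eq_3 numeral_2_eq_2)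
      then show ?thesis using nx_funpow_card[where 'n='n] n3 by (simp add: adj_def)
    qed (use m in \<open>auto simp: adj_def\<close>)
  qed
qed

text \<open>An injective map preserving adjacency keeps the direction of its first step: turning
  back would identify two indices at distance two, which differ for n \<ge> 3. Composing with
  \<open>rv\<close> makes the first step a forward one.\<close>

lemma dihedral_permutation:
  fixes \<pi> :: "'n::{finite,linorder} \<Rightarrow> 'n"
  assumes n: "3 \<le> CARD('n)" and inj: "inj \<pi>" and adj: "\<And>i. adj (\<pi> i) (\<pi> (nx i))"
  shows "\<exists>m. \<pi> = nx ^^ m \<or> rv \<circ> \<pi> = nx ^^ m"
proof -
  have key: "\<exists>m. \<rho> = nx ^^ m"
    if inj: "inj \<rho>" and adj: "\<And>i. adj (\<rho> i) (\<rho> (nx i))" and start: "\<rho> (nx i) = nx (\<rho> i)"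
    for \<rho> :: "'n \<Rightarrow> 'n" and i
  proof -
    have *: "\<rho> ((nx ^^ Suc k) i) = nx (\<rho> ((nx ^^ k) i))" for k
    proof (induction k)
      case (Suc k)
      let ?j = "(nx ^^ k) i"
      have "\<rho> (nx (nx ?j)) \<noteq> \<rho> ?j" using inj nx_nx_neq[OF n] by (metis injD)
      then show ?case using Suc adj[of "nx ?j"] by (auto simp: adj_def)
    qed (simp add: start)
    obtain m where m: "(nx ^^ m) i = \<rho> i" using nx_transitive by blast
    have **: "\<rho> ((nx ^^ k) i) = (nx ^^ (k + m)) i" for k
      by (induction k) (use * m in auto)
    have "\<rho> j = (nx ^^ m) j" for j
    proof -
      obtain k where "(nx ^^ k) i = j" using nx_transitive by blast
      then show ?thesis using **[of k] by (auto simp: funpow_add add.commute[of k])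
    qed
    then show ?thesis by blast
  qed
  obtain i :: 'n where True by blast
  from adj[of i] show ?thesis unfolding adj_def
  proof
    assume "\<pi> (nx i) = nx (\<pi> i)"
    then show ?thesis using key[OF inj adj] by blast
  next
    assume "\<pi> i = nx (\<pi> (nx i))"
    then have "(rv \<circ> \<pi>) (nx i) = nx ((rv \<circ> \<pi>) i)" by (simp add: rv_nx)
    moreover have "inj (rv \<circ> \<pi>)"
      using inj inj_on_inverseI[of UNIV rv "rv :: 'n \<Rightarrow> 'n"] by (intro inj_compose) auto
    moreover have "adj ((rv \<circ> \<pi>) i) ((rv \<circ> \<pi>) (nx i))" for i
      using adj[of i] by (auto simp: adj_def rv_nx)
    ultimately show ?thesis using key by blast
  qed
qed

section \<open>Symmetries preserving every block\<close>

lemma mat_nth: "mat z $ a $ b = (if a = b then z else 0)"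
  by (simp add: mat_def)

lemma mat_mult_mat: "mat a ** mat b = (mat (a * b) :: complex ^ 'q ^ 'q)"
  by (simp add: vec_eq_iff mat_nth)

lemma mat_mult_commute: "A ** mat z = mat z ** A" for A :: "complex ^ 'q ^ 'q"
proof -
  have "(\<Sum>k\<in>UNIV. A $ a $ k * mat z $ k $ b) = (\<Sum>k\<in>UNIV. if k = b then z * A $ a $ b else 0)" for a b
    by (rule sum.cong) (auto simp: mat_nth)
  then have "(A ** mat z) $ a $ b = z * A $ a $ b" for a b
    by (simp add: matrix_matrix_mult_def)
  then show ?thesis by (simp add: vec_eq_iff)
qed

text \<open>The rank-one matrix y e^T. For fixed e these matrices form a left ideal, which is a copy
  of the column space.\<close>

definition outer :: "'q \<Rightarrow> complex ^ 'q \<Rightarrow> complex ^ 'q ^ 'q"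
  where "outer e y = (\<chi> a b. if b = e then y $ a else 0)"

lemma matrix_mult_outer: "X ** outer e y = outer e (X *v y)"
  by (auto simp: outer_def vec_eq_iff matrix_matrix_mult_def matrix_vector_mult_def)

lemma outer_axis: "outer e (axis a 1) = munit a e"
  by (auto simp: outer_def vec_eq_iff axis_def munit_def)

lemma munit_mult_vector: "munit e a *v y = y $ a *s axis e 1"
proof -
  have "(\<Sum>j\<in>UNIV. munit e a $ i $ j * y $ j) = (\<Sum>j\<in>UNIV. if j = a then (if i = e then y $ a else 0) else 0)" for i
    by (rule sum.cong) (auto simp: munit_nth)
  then show ?thesis by (simp add: vec_eq_iff matrix_vector_mult_def axis_def)
qed

text \<open>The intertwiner maps \<open>y\<close> to \<open>\<theta> (y e\<^sup>T) v\<close>, where \<open>v\<close> is fixed by the idempotent \<open>\<theta> (e e\<^sup>T)\<close>.\<close>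

lemma skolem_noether_matrix:
  fixes \<theta> :: "complex ^ 'q ^ 'q \<Rightarrow> complex ^ 'q ^ 'q"
  assumes lin: "\<And>X Y z. \<theta> (X + mat z ** Y) = \<theta> X + mat z ** \<theta> Y"
    and mult: "\<And>X Y. \<theta> (X ** Y) = \<theta> X ** \<theta> Y"
    and inj: "\<And>X. \<theta> X = 0 \<Longrightarrow> X = 0"
  obtains h where "invertible h" "\<And>X. \<theta> X ** h = h ** X"
proof -
  obtain e :: 'q where True by blast
  have "munit e e \<noteq> (0 :: complex ^ 'q ^ 'q)" by (auto simp: vec_eq_iff munit_nth)
  then have "\<theta> (munit e e) \<noteq> 0" using inj by blast
  then obtain u where u: "\<theta> (munit e e) *v u \<noteq> 0"
    using matrix_eq[of "\<theta> (munit e e)" 0] by auto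
  define v where "v = \<theta> (munit e e) *v u"
  have "munit e e ** munit e e = (munit e e :: complex ^ 'q ^ 'q)"
    unfolding outer_axis[symmetric] matrix_mult_outer unfolding outer_axis munit_mult_vector by (simp add: outer_axis)
  \<comment> \<open>Multiplicativity makes the image of the idempotent \<open>munit e e\<close>
    idempotent again, so it fixes v.\<close>
  then have v: "\<theta> (munit e e) *v v = v"
    unfolding v_def matrix_vector_mul_assoc by (metis mult)
  define f where "f y = \<theta> (outer e y) *v v" for y
  have "\<theta> 0 = 0" using lin[of 0 1 0] by simp
  then have add: "\<theta> (X + Y) = \<theta> X + \<theta> Y" and scale: "\<theta> (mat z ** Y) = mat z ** \<theta> Y" for X Y z
    using lin[of X 1 Y] lin[of 0 z Y] by simp_all
  have mz: "(mat z ** A) *v y = z *s (A *v y)" for z and A :: "complex ^ 'q ^ 'q" and y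
    by (simp add: vec_eq_iff matrix_vector_mult_def sum_distrib_left mult.assoc)
  have "outer e (y + y') = outer e y + outer e y'" "outer e (z *s y) = mat z ** outer e y" for y y' z
    by (auto simp: outer_def vec_eq_iff)
  then have "Vector_Spaces.linear (*s) (*s) f"
    by unfold_locales (simp_all add: f_def add scale matrix_vector_mult_add_rdistrib mz algebra_simps
        vector_add_ldistrib vector_sadd_rdistrib vector_smult_assoc)
  then have h: "matrix f *v y = \<theta> (outer e y) *v v" for y
    by (simp add: matrix_works f_def)
  have comm: "\<theta> X *v (matrix f *v y) = matrix f *v (X *v y)" for X y
  proof -
    have "\<theta> X *v (\<theta> (outer e y) *v v) = \<theta> (outer e (X *v y)) *v v"
      by (simp add: matrix_vector_mul_assoc mult[symmetric] matrix_mult_outer)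
    then show ?thesis unfolding h .
  qed
  have "matrix f *v axis e 1 = v" by (simp add: h outer_axis v)
  have "y = 0" if y: "matrix f *v y = 0" for y
  proof (rule ccontr)
    assume "y \<noteq> 0"
    then obtain a where a: "y $ a \<noteq> 0" by (auto simp: vec_eq_iff)
    \<comment> \<open>The matrix unit moves the nonzero coordinate of y to a multiple of the basis
      vector at e, whose image v is nonzero.\<close>
    have "0 = matrix f *v (munit e a *v y)" using comm[of "munit e a" y] y by simp
    also have "\<dots> = y $ a *s v"
      using \<open>matrix f *v axis e 1 = v\<close> by (simp add: munit_mult_vector vec.scale)
    finally show False using a u by (auto simp: v_def vec_eq_iff)
  qed
  then have "invertible (matrix f)"
    unfolding invertible_left_inverse matrix_left_invertible_ker by blast
  moreover have "\<theta> X ** matrix f = matrix f ** X" for X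
    unfolding matrix_eq using comm by (simp add: matrix_vector_mul_assoc)
  ultimately show ?thesis using that by blast
qed

lemma commuting_matrix_scalar:
  fixes E :: "complex ^ 'q ^ 'q"
  assumes "\<And>X. E ** X = X ** E"
  shows "\<exists>e. E = mat e"
proof -
  \<comment> \<open>The index b is free, so this also identifies all diagonal entries with each
    other.\<close>
  have *: "E $ x $ a = (if x = a then E $ b $ b else 0)" for x a b
  proof -
    have "(mat 1 ** munit a b ** E) $ x $ b = (if x = a then E $ b $ b else 0)"
      unfolding matrix_mult_munit_mult by (simp add: mat_nth)
    moreover have "(E ** munit a b ** mat 1) $ x $ b = E $ x $ a"
      unfolding matrix_mult_munit_mult by (simp add: mat_nth)
    ultimately show ?thesis using assms[of "munit a b"] by simp
  qed
  obtain b :: 'q where True by blast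
  have "E = mat (E $ b $ b)" unfolding vec_eq_iff mat_nth by (intro allI *)
  then show ?thesis by blast
qed

text \<open>The trace is invariant under a change of basis in each space; the spaces are treated one
  at a time, each by a single slide.\<close>

lemma cyclic_trace_conjugate:
  fixes X h k :: "'n::{finite,linorder} \<Rightarrow> complex ^ 'q ^ 'q"
  assumes n: "2 \<le> CARD('n)" and kh: "\<And>i. k i ** h i = mat 1"
  shows "cyclic_trace (\<lambda>i. h (nx i) ** X i ** k i) = cyclic_trace X"
proof -
  \<comment> \<open>The change of basis is carried out only at the spaces in K.\<close>
  define Y where "Y K i = (if nx i \<in> K then h (nx i) else mat 1) ** X i ** (if i \<in> K then k i else mat 1)" for K i
  have "cyclic_trace (Y K) = cyclic_trace X" for K
  proof (induction K rule: infinite_finite_induct)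
    case (insert l K)
    let ?i = "pv l"
    have il: "?i \<noteq> l" using nx_neq[OF n, of ?i] by auto
    have l: "l = nx ?i" by simp
    have "Y (insert l K) = (Y K)(?i := h l ** Y K ?i, nx ?i := Y K l ** k l)"
    proof
      fix j
      have "nx j = l \<longleftrightarrow> j = ?i" by auto
      then show "Y (insert l K) j = ((Y K)(?i := h l ** Y K ?i, nx ?i := Y K l ** k l)) j"
        using insert.hyps il by (auto simp: Y_def matrix_mul_assoc)
    qed
    then have "cyclic_trace (Y (insert l K)) = cyclic_trace ((Y K)(?i := Y K ?i, nx ?i := (Y K l ** k l) ** h l))"
      by (simp only: cyclic_trace_slide[OF n])
    also have "(Y K)(?i := Y K ?i, nx ?i := (Y K l ** k l) ** h l) = Y K"
      by (simp add: matrix_mul_assoc[symmetric] kh)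
    finally show ?case using insert.IH by simp
  qed (simp_all add: Y_def)
  moreover have "Y UNIV = (\<lambda>i. h (nx i) ** X i ** k i)" by (simp add: Y_def fun_eq_iff)
  ultimately show ?thesis by metis
qed

lemma cyclic_trace_scale_all:
  "cyclic_trace (\<lambda>i. mat (\<epsilon> i) ** X i) = (\<Prod>i\<in>UNIV. \<epsilon> i) * cyclic_trace X"
  by (simp add: cyclic_trace_def prod.distrib sum_distrib_left)

lemma cyclic_trace_nonzero:
  assumes n: "3 \<le> CARD('n)"
  shows "\<exists>X :: 'n::{finite,linorder} \<Rightarrow> complex ^ 'q ^ 'q. cyclic_trace X \<noteq> 0"
proof (rule ccontr)
  assume a: "\<not> ?thesis"
  obtain i :: 'n where True by blast
  have "cyclic_trace (X(i := mat 1, nx i := mat 1)) = 0" for X :: "'n \<Rightarrow> complex ^ 'q ^ 'q" using a by blast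
  from adjacent_mult_zeroI[OF n this] show False using mat_1_neq_0[where 'q='q] by simp
qed

text \<open>The solution consists of partial products of \<epsilon>. Going once around the cycle is
  consistent because the total product is 1.\<close>

lemma cyclic_coboundary:
  fixes \<epsilon> :: "'n::{finite,linorder} \<Rightarrow> complex"
  assumes "(\<Prod>i\<in>UNIV. \<epsilon> i) = 1"
  shows "\<exists>\<mu>. (\<forall>i. \<mu> i \<noteq> 0) \<and> (\<forall>i. \<mu> (nx i) = \<epsilon> i * \<mu> i)"
proof -
  define \<mu> where "\<mu> i = (\<Prod>k<pos i. \<epsilon> (idx k))" for i :: 'n
  have nz: "\<epsilon> i \<noteq> 0" for i
    using assms by (metis finite UNIV_I prod_zero_iff zero_neq_one)
  have "\<mu> (nx i) = \<epsilon> i * \<mu> i" for i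
  proof (cases "Suc (pos i) = CARD('n)")
    case True
    have "\<epsilon> i * \<mu> i = (\<Prod>k<Suc (pos i). \<epsilon> (idx k))" by (simp add: \<mu>_def)
    also have "\<dots> = (\<Prod>i\<in>UNIV. \<epsilon> i)"
      unfolding True by (rule prod.reindex_bij_witness[of _ pos idx]) auto
    finally show ?thesis using assms True by (simp add: \<mu>_def nx_def)
  next
    case False
    then have "Suc (pos i) < CARD('n)" using pos_less[of i] by linarith
    then have "pos (nx i) = Suc (pos i)" by (simp add: nx_def)
    then show ?thesis by (simp add: \<mu>_def)
  qed
  moreover have "\<mu> i \<noteq> 0" for i using nz by (simp add: \<mu>_def)
  ultimately show ?thesis by blast
qed

text \<open>The components of a symmetry that maps every block to itself.\<close>

locale block_symmetry =
  fixes L :: "'n::{finite,linorder} \<Rightarrow> complex ^ 'q ^ 'q \<Rightarrow> complex ^ 'q ^ 'q"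
  assumes card_ge: "3 \<le> CARD('n)"
    and lin: "L i (X + mat z ** Y) = L i X + mat z ** L i Y"
    and surj_L: "surj (L i)"
    and inj_L: "L i X = 0 \<Longrightarrow> X = 0"
    and trace_L: "cyclic_trace (\<lambda>i. L i (W i)) = cyclic_trace W"
begin

lemma card_ge2: "2 \<le> CARD('n)"
  using card_ge by simp

lemma mult_eqI:
  assumes eq: "\<And>W. cyclic_trace (W(i := X, nx i := Y)) = cyclic_trace (W(i := X', nx i := Y'))"
  shows "L (nx i) Y ** L i X = L (nx i) Y' ** L i X'"
proof (rule adjacent_mult_eqI[OF card_ge])
  fix W :: "'n \<Rightarrow> complex ^ 'q ^ 'q"
  \<comment> \<open>Pulling the test tuple back along the surjective components lets
    \<open>trace_L\<close> remove them from both sides.\<close>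
  define W' where "W' k = inv_into UNIV (L k) (W k)" for k
  have W': "L k (W' k) = W k" for k unfolding W'_def by (rule surj_f_inv_f[OF surj_L])
  have upd: "W(i := L i A, nx i := L (nx i) B) = (\<lambda>k. L k ((W'(i := A, nx i := B)) k))" for A B
    by (auto simp: W')
  show "cyclic_trace (W(i := L i X, nx i := L (nx i) Y)) = cyclic_trace (W(i := L i X', nx i := L (nx i) Y'))"
    unfolding upd trace_L by (rule eq)
qed

text \<open>By sliding, the pairs X, Y and \<open>mat 1\<close>, \<open>Y ** X\<close> in
  neighbouring blocks have the same traces in every tuple.\<close>

lemma mult_right: "L (nx i) Y ** L i X = L (nx i) (Y ** X) ** L i (mat 1)"
  by (rule mult_eqI) (use cyclic_trace_slide[OF card_ge2, of _ i X "mat 1" Y] in simp)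

lemma mult_left: "L (nx i) Y ** L i X = L (nx i) (mat 1) ** L i (Y ** X)"
  by (rule mult_eqI) (use cyclic_trace_slide[OF card_ge2, of _ i Y X "mat 1"] in simp)

text \<open>Normalizing \<open>L i\<close> by its value at the identity gives an injective algebra
  endomorphism, which is inner by Skolem-Noether.\<close>

lemma sandwich: "\<exists>B C. invertible B \<and> invertible C \<and> (\<forall>X. L i X = B ** X ** C)"
proof -
  let ?a = "L i" and ?b = "L (nx i)"
  \<comment> \<open>Preimages of the identity turn the two product rules into one-sided inverses of
    the values at \<open>mat 1\<close>.\<close>
  obtain P where P: "?a P = mat 1" using surj_L by (metis surjD)
  obtain Q where Q: "?b Q = mat 1" using surj_L by (metis surjD)
  have "?b (Q ** P) ** ?a (mat 1) = mat 1"
    using mult_right[of i Q P] P Q by simp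
  then have inva: "invertible (?a (mat 1))" unfolding invertible_left_inverse by blast
  have "?b (mat 1) ** ?a (Q ** P) = mat 1"
    using mult_left[of i Q P] P Q by simp
  then have invb: "invertible (?b (mat 1))" unfolding invertible_right_inverse by blast
  obtain a' where a': "?a (mat 1) ** a' = mat 1" "a' ** ?a (mat 1) = mat 1"
    using inva unfolding invertible_def by blast
  obtain b' where b': "b' ** ?b (mat 1) = mat 1"
    using invb unfolding invertible_def by blast
  define \<theta> where "\<theta> X = ?a X ** a'" for X
  have a_eq: "?a X = \<theta> X ** ?a (mat 1)" for X
    by (simp add: \<theta>_def matrix_mul_assoc[symmetric] a')
  \<comment> \<open>The same \<theta> also describes the next block, normalized on the other side;
    this is what makes \<theta> multiplicative.\<close>
  have b_eq: "?b Y = ?b (mat 1) ** \<theta> Y" for Y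
  proof -
    have "?b Y = (?b Y ** ?a (mat 1)) ** a'" by (simp add: matrix_mul_assoc[symmetric] a')
    also have "\<dots> = ?b (mat 1) ** \<theta> Y"
      unfolding mult_left[of i Y "mat 1"] by (simp add: \<theta>_def matrix_mul_assoc)
    finally show ?thesis .
  qed
  have mult: "\<theta> (Y ** X) = \<theta> Y ** \<theta> X" for X Y
  proof -
    have "?b (mat 1) ** (\<theta> Y ** \<theta> X) = (?b Y ** ?a X) ** a'"
      by (simp add: b_eq[of Y] \<theta>_def[of X] matrix_mul_assoc)
    also have "\<dots> = ?b (mat 1) ** \<theta> (Y ** X)"
      unfolding mult_left[of i Y X] by (simp add: \<theta>_def matrix_mul_assoc)
    finally have "b' ** ?b (mat 1) ** (\<theta> Y ** \<theta> X) = b' ** ?b (mat 1) ** \<theta> (Y ** X)"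
      by (simp add: matrix_mul_assoc[symmetric])
    then show ?thesis using b' by simp
  qed
  have lin\<theta>: "\<theta> (X + mat z ** Y) = \<theta> X + mat z ** \<theta> Y" for X Y z
    by (simp add: \<theta>_def lin matrix_add_mult_distrib matrix_mul_assoc)
  have inj\<theta>: "X = 0" if "\<theta> X = 0" for X
    using a_eq[of X] that inj_L by simp
  from skolem_noether_matrix[of \<theta>, OF lin\<theta> mult inj\<theta>]
  obtain h where h: "invertible h" "\<And>X. \<theta> X ** h = h ** X" by blast
  obtain h' where h': "h ** h' = mat 1" "h' ** h = mat 1" using h(1) unfolding invertible_def by blast
  have "L i X = h ** X ** (h' ** ?a (mat 1))" for X
  proof -
    have "\<theta> X = (\<theta> X ** h) ** h'" by (simp add: matrix_mul_assoc[symmetric] h')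
    then show ?thesis using a_eq[of X] h(2)[of X] by (simp add: matrix_mul_assoc)
  qed
  moreover have "invertible (h' ** ?a (mat 1))"
    using inva h' by (intro invertible_mult) (auto simp: invertible_def)
  ultimately show ?thesis using h(1) by blast
qed

text \<open>At each space the factors of the two blocks meeting there are inverse to each other up
  to a scalar, since their product commutes with all matrices. Invariance of the trace makes the
  scalars multiply to 1, so they can be absorbed into the changes of basis.\<close>

lemma conjugation:
  "\<exists>h k. (\<forall>i. h i ** k i = mat 1 \<and> k i ** h i = mat 1) \<and> (\<forall>i X. L i X = h (nx i) ** X ** k i)"
proof -
  obtain B C where BC: "\<And>i. invertible (B i)" "\<And>i. invertible (C i)" "\<And>i X. L i X = B i ** X ** C i"
    using sandwich by metis
  obtain B' where B': "\<And>i. B i ** B' i = mat 1" "\<And>i. B' i ** B i = mat 1"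
    using BC(1) unfolding invertible_def by metis
  have "\<exists>e. C (nx i) ** B i = mat e" for i
  proof (rule commuting_matrix_scalar)
    fix X
    let ?j = "nx i" and ?E = "C (nx i) ** B i"
    obtain Bj Ci where inv: "Bj ** B ?j = mat 1" "C i ** Ci = mat 1"
      using BC(1)[of ?j] BC(2)[of i] unfolding invertible_def by blast
    have "L ?j (mat 1) ** L i X = L ?j X ** L i (mat 1)"
      using mult_right[of i "mat 1" X] by simp
    then have "Bj ** (B ?j ** ?E ** X ** C i) ** Ci = Bj ** (B ?j ** X ** ?E ** C i) ** Ci"
      by (simp add: BC(3) matrix_mul_assoc)
    moreover have "Bj ** (B ?j ** Z ** C i) ** Ci = Z" for Z
    proof -
      have "Bj ** (B ?j ** Z ** C i) ** Ci = (Bj ** B ?j) ** Z ** (C i ** Ci)"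
        by (simp add: matrix_mul_assoc)
      then show ?thesis by (simp add: inv)
    qed
    ultimately show "?E ** X = X ** ?E" by (metis matrix_mul_assoc)
  qed
  then obtain e where e: "\<And>i. C (nx i) ** B i = mat (e i)" by metis
  \<comment> \<open>The space i is the target of block \<open>pv i\<close>, so its change of basis
    is the left factor of that block.\<close>
  define h where "h i = B (pv i)" for i
  define k where "k i = B' (pv i)" for i
  define \<epsilon> where "\<epsilon> i = e (pv i)" for i
  have hk: "h i ** k i = mat 1" "k i ** h i = mat 1" for i by (simp_all add: h_def k_def B')
  have C: "C i = mat (\<epsilon> i) ** k i" for i
  proof -
    have "C i ** h i = mat (\<epsilon> i)" using e[of "pv i"] by (simp add: h_def \<epsilon>_def)
    then have "C i ** h i ** k i = mat (\<epsilon> i) ** k i" by simp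
    then show ?thesis by (simp add: matrix_mul_assoc[symmetric] hk)
  qed
  have L_eq: "L i X = mat (\<epsilon> i) ** (h (nx i) ** X ** k i)" for i X
    unfolding BC(3) C by (simp add: h_def matrix_mul_assoc mat_mult_commute)
  have "(\<Prod>i\<in>UNIV. \<epsilon> i) = 1"
  proof -
    \<comment> \<open>A tuple with nonzero trace allows the trace to be cancelled.\<close>
    obtain W :: "'n \<Rightarrow> complex ^ 'q ^ 'q" where W: "cyclic_trace W \<noteq> 0"
      using cyclic_trace_nonzero[OF card_ge] by blast
    have "cyclic_trace W = (\<Prod>i\<in>UNIV. \<epsilon> i) * cyclic_trace W"
      using trace_L[of W] unfolding L_eq cyclic_trace_scale_all
      using cyclic_trace_conjugate[where h = h and k = k and X = W, OF card_ge2 hk(2)] by simp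
    then show ?thesis using W by simp
  qed
  then obtain \<mu> where \<mu>: "\<And>i. \<mu> i \<noteq> 0" "\<And>i. \<mu> (nx i) = \<epsilon> i * \<mu> i"
    using cyclic_coboundary by blast
  \<comment> \<open>Rescaling by \<mu> multiplies block i by \<mu> (nx i) / \<mu> i, which is
    exactly \<epsilon> i.\<close>
  define h1 where "h1 i = mat (\<mu> i) ** h i" for i
  define k1 where "k1 i = mat (1 / \<mu> i) ** k i" for i
  have mm: "mat a ** X ** (mat b ** Y) = mat (a * b) ** (X ** Y)" for a b and X Y :: "complex ^ 'q ^ 'q"
  proof -
    have "mat a ** X ** (mat b ** Y) = mat a ** (X ** mat b) ** Y" by (simp add: matrix_mul_assoc)
    also have "\<dots> = (mat a ** mat b) ** (X ** Y)"
      unfolding mat_mult_commute[of X] by (simp add: matrix_mul_assoc)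
    finally show ?thesis by (simp add: mat_mult_mat)
  qed
  have "h1 i ** k1 i = mat 1 \<and> k1 i ** h1 i = mat 1" for i
    unfolding h1_def k1_def mm hk using \<mu>(1)[of i] by simp
  moreover have "L i X = h1 (nx i) ** X ** k1 i" for i X
  proof -
    have "h1 (nx i) ** X ** k1 i = mat (\<mu> (nx i)) ** (h (nx i) ** X) ** (mat (1 / \<mu> i) ** k i)"
      by (simp add: h1_def k1_def matrix_mul_assoc)
    also have "\<dots> = mat (\<epsilon> i) ** (h (nx i) ** X ** k i)"
      unfolding mm using \<mu>[of i] by simp
    finally show ?thesis by (simp add: L_eq)
  qed
  ultimately show ?thesis by blast
qed

end

text \<open>Additivity assembles X from its single blocks, by induction on a finite set of indices
  outside which X vanishes.\<close>

lemma imm_sym_blockwise: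
  fixes G :: "('n::{finite,linorder} \<Rightarrow> complex ^ 'q ^ 'q) \<Rightarrow> 'n \<Rightarrow> complex ^ 'q ^ 'q"
  assumes G: "imm_sym G" and bp: "\<And>i. G ` block_space i \<subseteq> block_space i"
  shows "G X i = G (single i (X i)) i"
proof -
  have z: "G (single k A) i = 0" if "i \<noteq> k" for i k A
  proof -
    have "G (single k A) \<in> block_space k" by (rule subsetD[OF bp imageI[OF single_in_block_space]])
    then show ?thesis using that by (simp add: block_space_def)
  qed
  have "\<forall>X. (\<forall>k. k \<notin> K \<longrightarrow> X k = 0) \<longrightarrow> (\<forall>i. G X i = G (single i (X i)) i)" if "finite K" for K
    using that
  proof (induction K)
    case empty
    have "G X i = G (single i (X i)) i" if "\<forall>k. X k = 0" for X i
    proof -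
      have "X = single i (X i)" using that by auto
      then show ?thesis by simp
    qed
    then show ?case by blast
  next
    case (insert l K)
    show ?case
    proof (intro allI impI)
      fix X i assume X: "\<forall>k. k \<notin> insert l K \<longrightarrow> X k = (0 :: complex ^ 'q ^ 'q)"
      let ?Y = "X(l := 0)"
      have eq: "X = (\<lambda>i. ?Y i + single l (X l) i)" by auto
      have "G X = (\<lambda>i. G ?Y i + G (single l (X l)) i)"
        by (rule trans[OF arg_cong[where f = G, OF eq] imm_sym_add[OF G, where X = ?Y]])
      then have GX: "G X i = G ?Y i + G (single l (X l)) i" by (rule fun_cong)
      have "\<forall>k. k \<notin> K \<longrightarrow> ?Y k = 0" using X by auto
      then have GY: "G ?Y i = G (single i (?Y i)) i" using insert.IH[rule_format, of ?Y i] by blast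
      show "G X i = G (single i (X i)) i"
      proof (cases "i = l")
        case True
        have "single l (0 :: complex ^ 'q ^ 'q) = (\<lambda>_. 0)" by auto
        then show ?thesis using True GX GY imm_sym_zero[OF G] by simp
      next
        case False
        then show ?thesis using GX GY z[OF False] by simp
      qed
    qed
  qed
  from this[of UNIV] show ?thesis by simp
qed

lemma imm_sym_block_preserving:
  fixes G :: "('n::{finite,linorder} \<Rightarrow> complex ^ 'q ^ 'q) \<Rightarrow> 'n \<Rightarrow> complex ^ 'q ^ 'q"
  assumes n: "3 \<le> CARD('n)" and G: "imm_sym G" and bp: "\<And>i. G ` block_space i = block_space i"
  shows "\<exists>h k. (\<forall>i. h i ** k i = mat 1 \<and> k i ** h i = mat 1) \<and> (\<forall>X i. G X i = h (nx i) ** X i ** k i)"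
proof -
  define L where "L i A = G (single i A) i" for i A
  have GL: "G X i = L i (X i)" for X i
    unfolding L_def by (rule imm_sym_blockwise[OF G]) (simp add: bp)
  have GLs: "G (single i A) = single i (L i A)" for i A
  proof -
    have "G (single i A) \<in> G ` block_space i" by (rule imageI[OF single_in_block_space])
    then have "G (single i A) \<in> block_space i" by (simp only: bp)
    then show ?thesis unfolding L_def by (rule block_space_eq_single)
  qed
  have inj: "inj G" using G by (simp add: imm_sym_def bij_is_inj)
  interpret block_symmetry L
  proof
    show "L i (X + mat z ** Y) = L i X + mat z ** L i Y" for i X z Y
    proof -
      have eq: "single i (X + mat z ** Y) = (\<lambda>k. single i X k + mat z ** single i Y k)" by auto
      show ?thesis unfolding L_def eq imm_sym_linear[OF G] ..
    qed
    show "surj (L i)" for i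
      unfolding surj_def
    proof
      fix B
      have "single i B \<in> G ` block_space i" unfolding bp by (rule single_in_block_space)
      then obtain X where "single i B = G X" by blast
      then have "L i (X i) = B" using GL[of X i] by (metis fun_upd_same)
      then show "\<exists>A. B = L i A" by blast
    qed
    show "X = 0" if "L i X = 0" for i X
    proof -
      have "G (single i X) = G (\<lambda>_. 0)" using that GLs[of i X] imm_sym_zero[OF G] by auto
      then have "single i X = (\<lambda>_. 0)" using inj by (rule injD[rotated])
      then show ?thesis by (metis fun_upd_same)
    qed
    show "cyclic_trace (\<lambda>i. L i (W i)) = cyclic_trace W" for W
      using G unfolding imm_sym_def GL[symmetric] by blast
  qed (rule n)
  show ?thesis using conjugation unfolding GL by blast
qed

section \<open>Semidirect products and dihedral groups\<close>

lemma (in group) is_semidirect_productI: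
  assumes N: "N \<lhd> G" and H: "subgroup H G" and NH: "N \<inter> H \<subseteq> {\<one>}"
    and gen: "\<And>g. g \<in> carrier G \<Longrightarrow> \<exists>x\<in>N. \<exists>h\<in>H. g = x \<otimes> h"
  shows "is_semidirect_product G N H"
proof -
  have Ns: "subgroup N G" using N by (simp add: normal_imp_subgroup)
  have Nc: "\<And>x. x \<in> N \<Longrightarrow> x \<in> carrier G" by (rule subgroup.mem_carrier[OF Ns])
  have Hc: "\<And>x. x \<in> H \<Longrightarrow> x \<in> carrier G" by (rule subgroup.mem_carrier[OF H])
  let ?P = "semidirect_product (G\<lparr>carrier := N\<rparr>) (G\<lparr>carrier := H\<rparr>) (\<lambda>h x. h \<otimes> x \<otimes> inv h)"
  let ?f = "\<lambda>(x, h). x \<otimes> h"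
  have "?f \<in> hom ?P G"
  proof (rule homI)
    fix p assume "p \<in> carrier ?P"
    then show "?f p \<in> carrier G" by (auto simp: semidirect_product_def Nc Hc)
  next
    fix p p' assume "p \<in> carrier ?P" "p' \<in> carrier ?P"
    then obtain x h y k where p: "p = (x, h)" "p' = (y, k)" and
      c: "x \<in> carrier G" "h \<in> carrier G" "y \<in> carrier G" "k \<in> carrier G"
      by (auto simp: semidirect_product_def Nc Hc)
    have "inv h \<otimes> (h \<otimes> k) = k" using c by (simp add: m_assoc[symmetric])
    then show "?f (p \<otimes>\<^bsub>?P\<^esub> p') = ?f p \<otimes> ?f p'"
      using c by (simp add: semidirect_product_def p m_assoc)
  qed
  moreover have "bij_betw ?f (carrier ?P) (carrier G)"
    unfolding bij_betw_def
  proof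
    show "inj_on ?f (carrier ?P)"
    proof (rule inj_onI)
      fix p p' assume "p \<in> carrier ?P" "p' \<in> carrier ?P" and eq: "?f p = ?f p'"
      then obtain x h y k where p: "p = (x, h)" "p' = (y, k)" and m: "x \<in> N" "h \<in> H" "y \<in> N" "k \<in> H"
        by (auto simp: semidirect_product_def)
      have c: "x \<in> carrier G" "h \<in> carrier G" "y \<in> carrier G" "k \<in> carrier G"
        using m Nc Hc by auto
      have "x \<otimes> h = y \<otimes> k" using eq by (simp add: p)
      \<comment> \<open>Separating the factors puts a common element into N and H, where only the
        unit remains.\<close>
      then have "inv y \<otimes> x = k \<otimes> inv h"
        using c by (metis inv_solve_left' inv_solve_right inv_closed m_assoc m_closed)
      moreover have "inv y \<otimes> x \<in> N" using m Ns by (simp add: subgroup.m_closed subgroup.m_inv_closed)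
      moreover have "k \<otimes> inv h \<in> H" using m H by (simp add: subgroup.m_closed subgroup.m_inv_closed)
      ultimately have "inv y \<otimes> x = \<one>" "k \<otimes> inv h = \<one>" using NH by auto
      then have "x = y" "k = h" using c by (metis inv_equality inv_inv inv_closed l_inv, metis inv_equality inv_inv inv_closed)
      then show "p = p'" by (simp add: p)
    qed
    show "?f ` carrier ?P = carrier G"
    proof (intro equalityI subsetI)
      fix g assume "g \<in> carrier G"
      then obtain x h where "x \<in> N" "h \<in> H" "g = x \<otimes> h" using gen by blast
      then show "g \<in> ?f ` carrier ?P" by (force simp: semidirect_product_def)
    qed (auto simp: semidirect_product_def Nc Hc)
  qed
  ultimately show ?thesis using N H by (simp add: is_semidirect_product_def iso_def)
qed

section \<open>Cyclic subgroups and dihedral normal forms\<close>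

lemma (in group) int_pow_mod_ord:
  assumes "a \<in> carrier G" "a [^] (n :: nat) = \<one>"
  shows "a [^] (z mod int n) = a [^] (z :: int)"
proof -
  have "a [^] z = a [^] (int n * (z div int n) + z mod int n)" by simp
  also have "\<dots> = a [^] (z mod int n)"
    unfolding int_pow_mult[OF assms(1)] int_pow_pow[OF assms(1), symmetric] int_pow_int assms(2)
    using assms(1) by simp
  finally show ?thesis by simp
qed

lemma (in group) int_pow_eq_one_dvd:
  assumes a: "a \<in> carrier G" and n: "0 < n" "a [^] (n :: nat) = \<one>"
    and ord: "\<And>k :: nat. 0 < k \<Longrightarrow> k < n \<Longrightarrow> a [^] k \<noteq> \<one>" and z: "a [^] (z :: int) = \<one>"
  shows "z mod int n = 0"
proof (rule ccontr)
  assume nz: "z mod int n \<noteq> 0"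
  define k where "k = nat (z mod int n)"
  have "0 \<le> z mod int n" "z mod int n < int n" using n by simp_all
  then have k: "int k = z mod int n" "0 < k" "k < n" using nz by (auto simp: k_def)
  have "a [^] k = a [^] (z mod int n)" by (metis int_pow_int k(1))
  then show False using int_pow_mod_ord[OF a n(2), of z] z ord[OF k(2,3)] by simp
qed

lemma (in group) generate_iso_integer_mod_group:
  assumes a: "a \<in> carrier G" and n: "0 < n" "a [^] (n :: nat) = \<one>"
    and ord: "\<And>k :: nat. 0 < k \<Longrightarrow> k < n \<Longrightarrow> a [^] k \<noteq> \<one>"
  shows "G\<lparr>carrier := generate G {a}\<rparr> \<cong> integer_mod_group n"
proof -
  let ?f = "\<lambda>z :: int. a [^] z"
  have "?f \<in> iso (integer_mod_group n) (G\<lparr>carrier := generate G {a}\<rparr>)"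
  proof (rule isoI)
    show "?f \<in> hom (integer_mod_group n) (G\<lparr>carrier := generate G {a}\<rparr>)"
      by (rule homI) (use a in \<open>auto simp: generate_pow int_pow_mod_ord[OF a n(2)] int_pow_mult\<close>)
    show "bij_betw ?f (carrier (integer_mod_group n)) (carrier (G\<lparr>carrier := generate G {a}\<rparr>))"
      unfolding bij_betw_def
    proof
      show "inj_on ?f (carrier (integer_mod_group n))"
      proof (rule inj_onI)
        fix x y assume xy: "x \<in> carrier (integer_mod_group n)" "y \<in> carrier (integer_mod_group n)"
          and eq: "a [^] x = a [^] y"
        have "a [^] (x - y) = \<one>" using a eq by (simp add: int_pow_diff)
        from int_pow_eq_one_dvd[OF a n _ this] have "(x - y) mod int n = 0" using ord by blast
        then have "x mod int n = y mod int n" by (simp add: mod_eq_dvd_iff dvd_eq_mod_eq_0)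
        then show "x = y" using xy n by (simp add: carrier_integer_mod_group)
      qed
      show "?f ` carrier (integer_mod_group n) = carrier (G\<lparr>carrier := generate G {a}\<rparr>)"
      proof (intro equalityI subsetI)
        fix x assume "x \<in> carrier (G\<lparr>carrier := generate G {a}\<rparr>)"
        then obtain z where "x = a [^] (z :: int)" using a by (auto simp: generate_pow)
        then have "x = ?f (z mod int n)" using int_pow_mod_ord[OF a n(2)] by simp
        then show "x \<in> ?f ` carrier (integer_mod_group n)"
          using n by (auto simp: carrier_integer_mod_group)
      qed (use a in \<open>auto simp: generate_pow\<close>)
    qed
  qed
  then have "integer_mod_group n \<cong> G\<lparr>carrier := generate G {a}\<rparr>" by (auto simp: is_iso_def)
  then show ?thesis by (rule group.iso_sym[OF group_integer_mod_group])
qed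

text \<open>The pair (a, e) stands for r^a s^e. This model mediates between the matrix group and the
  symmetries of the polygon.\<close>

definition dih :: "nat \<Rightarrow> (int \<times> bool) monoid"
  where "dih n = \<lparr>carrier = {0..<int n} \<times> UNIV,
    mult = (\<lambda>(a, e) (b, f). ((a + (if e then - b else b)) mod int n, e \<noteq> f)), one = (0, False)\<rparr>"

lemma group_dih:
  assumes "0 < n"
  shows "group (dih n)"
proof (rule groupI)
  fix x y z assume "x \<in> carrier (dih n)" "y \<in> carrier (dih n)" "z \<in> carrier (dih n)"
  obtain a e b f c g where xyz: "x = (a, e)" "y = (b, f)" "z = (c, g)" by (metis surj_pair)
  have 1: "(a + (b + c) mod int n) mod int n = ((a + b) mod int n + c) mod int n" for a b c :: int
    by (simp add: mod_simps algebra_simps)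
  have 2: "(a - (b + c) mod int n) mod int n = ((a - b) mod int n - c) mod int n" for a b c :: int
    by (simp add: mod_simps algebra_simps)
  show "x \<otimes>\<^bsub>dih n\<^esub> y \<otimes>\<^bsub>dih n\<^esub> z = x \<otimes>\<^bsub>dih n\<^esub> (y \<otimes>\<^bsub>dih n\<^esub> z)"
    using 1[of a b c] 1[of a b "- c"] 2[of a b c] 2[of a b "- c"]
    by (cases e; cases f) (simp_all add: dih_def xyz)
next
  fix x assume x: "x \<in> carrier (dih n)"
  then obtain a e where ae: "x = (a, e)" "0 \<le> a" "a < int n" by (auto simp: dih_def)
  \<comment> \<open>Reflections are their own inverses, while rotations are inverted by negating the
    exponent.\<close>
  then have "((if e then a else - a) mod int n, e) \<in> carrier (dih n)" using assms by (simp add: dih_def)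
  moreover have "((if e then a else - a) mod int n, e) \<otimes>\<^bsub>dih n\<^esub> x = \<one>\<^bsub>dih n\<^esub>"
    by (simp add: dih_def ae mod_simps)
  ultimately show "\<exists>y\<in>carrier (dih n). y \<otimes>\<^bsub>dih n\<^esub> x = \<one>\<^bsub>dih n\<^esub>" by blast
qed (use assms in \<open>auto simp: dih_def\<close>)

text \<open>The assumption \<open>s_notin\<close> keeps the reflection outside the rotations, so
  that the generated group has order 2n. The locale is instantiated both for the polygon and for the
  matrices.\<close>

locale dihedral_generators = group +
  fixes r s and n :: nat
  assumes r [simp]: "r \<in> carrier G" and s [simp]: "s \<in> carrier G" and n: "0 < n" "r [^] n = \<one>"
    and ord: "\<And>k :: nat. 0 < k \<Longrightarrow> k < n \<Longrightarrow> r [^] k \<noteq> \<one>"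
    and s_s: "s \<otimes> s = \<one>" and s_r: "s \<otimes> r = inv r \<otimes> s"
    and s_notin: "\<And>z :: int. s \<noteq> r [^] z"
begin

definition el :: "int \<Rightarrow> bool \<Rightarrow> 'a"
  where "el z e = r [^] z \<otimes> (if e then s else \<one>)"

lemma el_closed [simp]: "el z e \<in> carrier G"
  by (simp add: el_def)

lemma s_pow_nat: "s \<otimes> r [^] (k :: nat) = inv r [^] k \<otimes> s"
proof (induction k)
  case (Suc k)
  have "s \<otimes> r [^] Suc k = (s \<otimes> r [^] k) \<otimes> r" by (simp add: m_assoc)
  also have "\<dots> = inv r [^] k \<otimes> (s \<otimes> r)" by (simp add: Suc m_assoc)
  also have "\<dots> = inv r [^] Suc k \<otimes> s" by (simp add: s_r m_assoc)
  finally show ?case .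
qed simp

lemma s_pow: "s \<otimes> r [^] (z :: int) = r [^] (- z) \<otimes> s"
proof (cases "0 \<le> z")
  case True
  then obtain k where "z = int k" using nonneg_int_cases by blast
  then show ?thesis using s_pow_nat[of k] by (simp add: int_pow_int int_pow_neg nat_pow_inv)
next
  case False
  then obtain k where z: "z = - int k" by (metis int_cases2 of_nat_0_le_iff)
  have "s \<otimes> r [^] k = inv (r [^] k) \<otimes> s" using s_pow_nat[of k] by (simp add: nat_pow_inv)
  then have "r [^] k \<otimes> s = s \<otimes> inv (r [^] k)"
    by (metis inv_solve_left inv_solve_right m_assoc m_closed nat_pow_closed inv_closed r s)
  then show ?thesis by (simp add: z int_pow_neg int_pow_int)
qed

lemma el_mult: "el a e \<otimes> el b f = el (a + (if e then - b else b)) (e \<noteq> f)"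
proof (cases e)
  case True
  have "el a True \<otimes> el b f = r [^] a \<otimes> (s \<otimes> r [^] b) \<otimes> (if f then s else \<one>)"
    by (simp add: el_def m_assoc)
  also have "\<dots> = r [^] a \<otimes> r [^] (- b) \<otimes> (s \<otimes> (if f then s else \<one>))"
    by (simp add: s_pow m_assoc)
  also have "\<dots> = el (a - b) (\<not> f)"
    by (simp add: el_def s_s int_pow_mult[symmetric])
  finally show ?thesis using True by simp
next
  case False
  then show ?thesis by (simp add: el_def int_pow_mult m_assoc)
qed

lemma el_mod: "el (z mod int n) e = el z e"
  by (simp add: el_def int_pow_mod_ord[OF r n(2)])

lemma el_inj:
  assumes eq: "el a e = el b f"
  shows "a mod int n = b mod int n \<and> e = f"
proof -
  have *: "s = r [^] (b - a)" if "r [^] a \<otimes> s = r [^] b" for a b :: int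
  proof -
    have "s = inv (r [^] a) \<otimes> r [^] b" using that by (metis inv_solve_left int_pow_closed r s)
    then show ?thesis by (simp add: int_pow_neg[symmetric] int_pow_mult[symmetric] add.commute)
  qed
  have ef: "e = f"
    using eq *[of a b] *[of b a] s_notin by (cases e; cases f) (auto simp: el_def)
  then have "r [^] a = r [^] b" using eq by (cases f) (auto simp: el_def)
  then have "r [^] (a - b) = \<one>" by (simp add: int_pow_diff)
  from int_pow_eq_one_dvd[OF r n _ this] have "(a - b) mod int n = 0" using ord by blast
  then show ?thesis using ef by (simp add: mod_eq_dvd_iff dvd_eq_mod_eq_0)
qed

abbreviation "D \<equiv> generate G {r, s}"

lemma D_eq: "D = {el z e | z e. True}"
proof
  have "subgroup {el z e | z e. True} G"
  proof (rule subgroupI)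
    show "inv a \<in> {el z e | z e. True}" if a_el: "a \<in> {el z e | z e. True}" for a
    proof -
      obtain z e where a: "a = el z e" using a_el by blast
      have "el (if e then z else - z) e \<otimes> el z e = \<one>"
        by (simp add: el_mult) (simp add: el_def)
      then have "inv a = el (if e then z else - z) e" unfolding a by (intro inv_equality) auto
      then show ?thesis by blast
    qed
    show "a \<otimes> b \<in> {el z e | z e. True}" if "a \<in> {el z e | z e. True}" "b \<in> {el z e | z e. True}" for a b
      using that el_mult by blast
  qed auto
  moreover have "r = el 1 False" "s = el 0 True" by (simp_all add: el_def)
  ultimately show "D \<subseteq> {el z e | z e. True}" by (intro generate_subgroup_incl) blast+
  have D: "subgroup D G" by (rule generate_is_subgroup) auto
  have "r \<in> D" "s \<in> D" by (auto intro: generate.incl)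
  then have "el z e \<in> D" for z e
    unfolding el_def using D subgroup_int_pow_closed[OF D] by (auto intro!: subgroup.m_closed subgroup.one_closed)
  then show "{el z e | z e. True} \<subseteq> D" by blast
qed

lemma D_subgroup: "subgroup D G"
  by (rule generate_is_subgroup) auto

lemma el_iso: "(\<lambda>(z, e). el z e) \<in> iso (dih n) (G\<lparr>carrier := D\<rparr>)"
proof (rule isoI)
  show "(\<lambda>(z, e). el z e) \<in> hom (dih n) (G\<lparr>carrier := D\<rparr>)"
    by (rule homI) (auto simp: D_eq dih_def el_mult el_mod)
  show "bij_betw (\<lambda>(z, e). el z e) (carrier (dih n)) (carrier (G\<lparr>carrier := D\<rparr>))"
    unfolding bij_betw_def
  proof
    show "inj_on (\<lambda>(z, e). el z e) (carrier (dih n))"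
      by (rule inj_onI) (auto simp: dih_def dest!: el_inj)
    show "(\<lambda>(z, e). el z e) ` carrier (dih n) = carrier (G\<lparr>carrier := D\<rparr>)"
    proof (intro equalityI subsetI)
      fix x assume "x \<in> carrier (G\<lparr>carrier := D\<rparr>)"
      then obtain z e where "x = el (z mod int n) e" by (auto simp: D_eq el_mod)
      moreover have "(z mod int n, e) \<in> carrier (dih n)" using n by (simp add: dih_def)
      ultimately show "x \<in> (\<lambda>(z, e). el z e) ` carrier (dih n)" by force
    qed (auto simp: D_eq)
  qed
qed

lemma D_iso_dih: "G\<lparr>carrier := D\<rparr> \<cong> dih n" "dih n \<cong> G\<lparr>carrier := D\<rparr>"
proof -
  show "dih n \<cong> G\<lparr>carrier := D\<rparr>" using el_iso by (auto simp: is_iso_def)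
  then show "G\<lparr>carrier := D\<rparr> \<cong> dih n" by (rule group.iso_sym[OF group_dih[OF n(1)]])
qed

lemma card_D: "card D = 2 * n"
proof -
  have "bij_betw (\<lambda>(z, e). el z e) (carrier (dih n)) D" using el_iso by (simp add: iso_def)
  then have "card D = card (carrier (dih n))" by (simp add: bij_betw_same_card)
  then show ?thesis by (simp add: dih_def card_cartesian_product)
qed

lemma rotations_eq: "generate G {r} = {el z False | z. True}"
  by (auto simp: generate_pow el_def)

lemma reflection_eq: "generate G {s} = {\<one>, s}"
proof
  have "subgroup {\<one>, s} G"
    by (rule subgroupI) (auto simp: s_s inv_equality)
  then show "generate G {s} \<subseteq> {\<one>, s}" by (intro generate_subgroup_incl) auto
qed (auto intro: generate.intros)

lemma rotations_iso: "G\<lparr>carrier := generate G {r}\<rparr> \<cong> integer_mod_group n"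
  by (rule generate_iso_integer_mod_group[OF r n]) (rule ord)

lemma reflection_iso: "G\<lparr>carrier := generate G {s}\<rparr> \<cong> integer_mod_group 2"
proof (rule generate_iso_integer_mod_group[OF s])
  have "s \<noteq> \<one>" using s_notin[of 0] by simp
  then show "s [^] k \<noteq> \<one>" if "0 < k" "k < 2" for k :: nat
    using that by (cases k) auto
qed (simp_all add: s_s numeral_2_eq_2)

lemma D_semidirect: "is_semidirect_product (G\<lparr>carrier := D\<rparr>) (generate G {r}) (generate G {s})"
proof -
  interpret D: group "G\<lparr>carrier := D\<rparr>" by (rule subgroup_imp_group[OF D_subgroup])
  have sub: "generate G {r} \<subseteq> D" "generate G {s} \<subseteq> D" by (rule mono_generate, simp)+
  have sR: "subgroup (generate G {r}) (G\<lparr>carrier := D\<rparr>)" "subgroup (generate G {s}) (G\<lparr>carrier := D\<rparr>)"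
    using sub by (auto intro!: subgroup_incl generate_is_subgroup D_subgroup)
  show ?thesis
  proof (rule D.is_semidirect_productI[OF D.normal_invI[OF sR(1)] sR(2)])
    fix x h assume x: "x \<in> carrier (G\<lparr>carrier := D\<rparr>)" and h: "h \<in> generate G {r}"
    obtain a e where a: "x = el a e" using x by (auto simp: D_eq)
    obtain z where z: "h = el z False" using h by (auto simp: rotations_eq)
    \<comment> \<open>Conjugation by a rotation fixes every rotation, and conjugation by a
      reflection inverts it.\<close>
    have "x \<otimes> h = el (if e then - z else z) False \<otimes> x" by (simp add: a z el_mult add.commute)
    then have "x \<otimes> h \<otimes> inv x = el (if e then - z else z) False"
      by (simp add: a m_assoc)
    then show "x \<otimes>\<^bsub>G\<lparr>carrier := D\<rparr>\<^esub> h \<otimes>\<^bsub>G\<lparr>carrier := D\<rparr>\<^esub> inv\<^bsub>G\<lparr>carrier := D\<rparr>\<^esub> x \<in> generate G {r}"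
      using x by (auto simp: m_inv_consistent[OF D_subgroup] rotations_eq)
  next
    show "generate G {r} \<inter> generate G {s} \<subseteq> {\<one>\<^bsub>G\<lparr>carrier := D\<rparr>\<^esub>}"
      using s_notin by (auto simp: reflection_eq rotations_eq el_def)
  next
    fix g assume "g \<in> carrier (G\<lparr>carrier := D\<rparr>)"
    then obtain a e where g: "g = el a e" by (auto simp: D_eq)
    have "el a False \<in> generate G {r}" "(if e then s else \<one>) \<in> generate G {s}"
      by (auto simp: rotations_eq reflection_eq)
    moreover have "g = el a False \<otimes> (if e then s else \<one>)" by (simp add: g el_def)
    ultimately show "\<exists>x\<in>generate G {r}. \<exists>h\<in>generate G {s}. g = x \<otimes>\<^bsub>G\<lparr>carrier := D\<rparr>\<^esub> h"
      by (intro bexI[of _ "el a False"] bexI[of _ "if e then s else \<one>"]) (simp_all del: if_split)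
  qed
qed

end

section \<open>Symmetries of the regular polygon\<close>

lemma group_dihedral_group: "group (dihedral_group n)"
proof (rule groupI)
  let ?R = "{z :: complex. z ^ n = 1}"
  fix f g assume "f \<in> carrier (dihedral_group n)" "g \<in> carrier (dihedral_group n)"
  moreover from this have "(f \<circ> g) ` ?R = ?R" unfolding image_comp[symmetric] by (simp add: dihedral_group_def)
  ultimately show "f \<otimes>\<^bsub>dihedral_group n\<^esub> g \<in> carrier (dihedral_group n)"
    by (simp add: dihedral_group_def orthogonal_transformation_compose)
next
  let ?R = "{z :: complex. z ^ n = 1}"
  fix f assume f: "f \<in> carrier (dihedral_group n)"
  then have o: "orthogonal_transformation f" and im: "f ` ?R = ?R" by (auto simp: dihedral_group_def)
  have b: "bij f" using o by (rule orthogonal_transformation_bij)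
  let ?g = "inv_into UNIV f"
  have "?g ` ?R = ?g ` f ` ?R" by (simp only: im)
  also have "\<dots> = ?R" using b by (simp add: image_comp bij_is_inj)
  finally have "?g \<in> carrier (dihedral_group n)"
    using orthogonal_transformation_inv[OF o] by (simp add: dihedral_group_def)
  moreover have "?g \<circ> f = id" using b by (simp add: bij_is_inj)
  ultimately show "\<exists>g\<in>carrier (dihedral_group n). g \<otimes>\<^bsub>dihedral_group n\<^esub> f = \<one>\<^bsub>dihedral_group n\<^esub>"
    by (auto simp: dihedral_group_def)
qed (auto simp: dihedral_group_def id_def o_assoc)

text \<open>The images of 1 and \<i> are orthonormal, so the second is a quarter turn of the first
  in one of the two directions.\<close>

lemma orthogonal_transformation_complex_cases:
  fixes f :: "complex \<Rightarrow> complex"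
  assumes o: "orthogonal_transformation f"
  shows "f = (\<lambda>z. f 1 * z) \<or> f = (\<lambda>z. f 1 * cnj z)"
proof -
  have lin: "linear f" and ip: "\<And>v w. f v \<bullet> f w = v \<bullet> w" using o by (auto simp: orthogonal_transformation_def)
  obtain a b c d where f1: "f 1 = Complex a b" and fi: "f \<i> = Complex c d" by (metis complex.collapse)
  have 1: "a * a + b * b = 1" "c * c + d * d = 1" "a * c + b * d = 0"
    using ip[of 1 1] ip[of \<i> \<i>] ip[of 1 \<i>] by (simp_all add: f1 fi inner_complex_def)
  have fz: "f z = Re z *\<^sub>R f 1 + Im z *\<^sub>R f \<i>" for z
  proof -
    have "z = Re z *\<^sub>R 1 + Im z *\<^sub>R \<i>" by (simp add: complex_eq_iff)
    then show ?thesis using lin by (metis linear_add linear_scale)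
  qed
  \<comment> \<open>This is the determinant of f as a real 2 by 2 matrix; its sign tells rotations
    from reflections.\<close>
  define t where "t = a * d - b * c"
  have "c = - b * t" "d = a * t"
    using 1 unfolding t_def by algebra+
  moreover have "t * t = 1" using 1 unfolding t_def by algebra
  then have "t = 1 \<or> t = - 1" by (metis mult_cancel_right2 power2_eq_1_iff power2_eq_square)
  ultimately consider "c = - b" "d = a" | "c = b" "d = - a" by fastforce
  then show ?thesis
  proof cases
    case 1
    then have "f z = f 1 * z" for z
      unfolding fz[of z] f1 fi by (simp add: complex_eq_iff algebra_simps)
    then show ?thesis by blast
  next
    case 2
    then have "f z = f 1 * cnj z" for z
      unfolding fz[of z] f1 fi by (simp add: complex_eq_iff algebra_simps)
    then show ?thesis by blast
  qed
qed

text \<open>The generators are multiplication by a primitive root of unity \<omega> and complex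
  conjugation. Any symmetry sends 1 to some power of \<omega>, and this power together with the
  rotation-reflection alternative determines it.\<close>

lemma dihedral_group_iso_dih:
  assumes n: "0 < n"
  shows "dih n \<cong> dihedral_group n"
proof -
  let ?R = "{z :: complex. z ^ n = 1}"
  define \<omega> where "\<omega> = cis (2 * pi / real n)"
  define r where "r = (\<lambda>z. \<omega> * z)"
  have pow: "\<omega> ^ k = cis (2 * pi * real k / real n)" for k
  proof -
    have "real k * (2 * pi / real n) = 2 * pi * real k / real n" by simp
    then show ?thesis unfolding \<omega>_def Complex.DeMoivre by (simp only:)
  qed
  have bij: "bij_betw (\<lambda>k. \<omega> ^ k) {..<n} ?R"
    unfolding pow by (rule Complex.bij_betw_roots_unity[OF n])
  have \<omega>: "\<omega> ^ n = 1" "cmod \<omega> = 1" using n by (auto simp: pow) (simp add: \<omega>_def)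
  then have \<omega>0: "\<omega> \<noteq> 0" by auto
  interpret group "dihedral_group n" by (rule group_dihedral_group)
  have mult: "f \<otimes>\<^bsub>dihedral_group n\<^esub> g = f \<circ> g" and one: "\<one>\<^bsub>dihedral_group n\<^esub> = id" for f g
    by (simp_all add: dihedral_group_def)
  have r: "r \<in> carrier (dihedral_group n)"
  proof -
    have "orthogonal_transformation r"
      unfolding orthogonal_transformation r_def
      by (auto simp: \<omega> norm_mult linear_iff algebra_simps)
    moreover have "r ` ?R = ?R"
    proof (intro equalityI subsetI)
      fix z assume "z \<in> ?R"
      then have "z = r (z / \<omega>)" "z / \<omega> \<in> ?R" using \<omega> \<omega>0 by (auto simp: r_def power_divide)
      then show "z \<in> r ` ?R" by blast
    qed (use \<omega> in \<open>auto simp: r_def power_mult_distrib\<close>)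
    ultimately show ?thesis by (simp add: dihedral_group_def)
  qed
  have s: "cnj \<in> carrier (dihedral_group n)"
  proof -
    have "cnj ` ?R = ?R"
    proof (intro equalityI subsetI)
      fix z assume "z \<in> ?R"
      then have "z = cnj (cnj z)" "cnj z \<in> ?R" by (auto simp flip: complex_cnj_power)
      then show "z \<in> cnj ` ?R" by blast
    qed (auto simp flip: complex_cnj_power)
    moreover have "orthogonal_transformation cnj"
      unfolding orthogonal_transformation by (auto simp: linear_iff)
    ultimately show ?thesis by (simp add: dihedral_group_def)
  qed
  have rpow: "r [^]\<^bsub>dihedral_group n\<^esub> k = (\<lambda>z. \<omega> ^ k * z)" for k :: nat
    by (induction k) (auto simp: mult one r_def fun_eq_iff)
  interpret dihedral_generators "dihedral_group n" r cnj n
  proof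
    show "r [^]\<^bsub>dihedral_group n\<^esub> n = \<one>\<^bsub>dihedral_group n\<^esub>" by (simp add: rpow one \<omega> id_def)
    show "r [^]\<^bsub>dihedral_group n\<^esub> k \<noteq> \<one>\<^bsub>dihedral_group n\<^esub>" if "0 < k" "k < n" for k
    proof
      assume "r [^]\<^bsub>dihedral_group n\<^esub> k = \<one>\<^bsub>dihedral_group n\<^esub>"
      then have "\<omega> ^ k = \<omega> ^ 0" by (simp add: rpow one fun_eq_iff) (metis mult.right_neutral)
      then have "k = 0" using inj_onD[OF bij_betw_imp_inj_on[OF bij], of k 0] that by simp
      then show False using that by simp
    qed
    show "cnj \<otimes>\<^bsub>dihedral_group n\<^esub> cnj = \<one>\<^bsub>dihedral_group n\<^esub>" by (simp add: mult one fun_eq_iff)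
    show "cnj \<otimes>\<^bsub>dihedral_group n\<^esub> r = inv\<^bsub>dihedral_group n\<^esub> r \<otimes>\<^bsub>dihedral_group n\<^esub> cnj"
    proof -
      have "\<omega> * cnj \<omega> = 1" using \<omega> by (simp add: complex_norm_square[symmetric])
      then have "r \<otimes>\<^bsub>dihedral_group n\<^esub> (cnj \<otimes>\<^bsub>dihedral_group n\<^esub> r) = cnj"
        by (simp add: mult r_def fun_eq_iff mult.assoc[symmetric])
      then show ?thesis using r s by (metis inv_solve_left m_closed)
    qed
    show "cnj \<noteq> r [^]\<^bsub>dihedral_group n\<^esub> z" for z :: int
    proof
      assume eq: "cnj = r [^]\<^bsub>dihedral_group n\<^esub> z"
      have "r [^]\<^bsub>dihedral_group n\<^esub> n = \<one>\<^bsub>dihedral_group n\<^esub>" by (simp add: rpow one \<omega> id_def)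
      then have "cnj = r [^]\<^bsub>dihedral_group n\<^esub> (z mod int n)" using eq int_pow_mod_ord[OF r] by simp
      also have "\<dots> = (\<lambda>w. \<omega> ^ nat (z mod int n) * w)"
        using n by (simp flip: rpow int_pow_int)
      \<comment> \<open>The value at 1 forces the factor to be 1, which contradicts the value at
        \<i>.\<close>
      finally have "cnj 1 = \<omega> ^ nat (z mod int n) * 1" "cnj \<i> = \<omega> ^ nat (z mod int n) * \<i>"
        by (rule fun_cong)+
      then show False by (simp add: complex_eq_iff)
    qed
  qed (use r s n in auto)
  have "carrier (dihedral_group n) \<subseteq> D"
  proof
    fix f assume f: "f \<in> carrier (dihedral_group n)"
    then have "orthogonal_transformation f" "f 1 \<in> ?R" by (auto simp: dihedral_group_def)
    moreover obtain k where k: "f 1 = \<omega> ^ k" using bij \<open>f 1 \<in> ?R\<close> by (auto simp: bij_betw_def)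
    moreover have "el (int k) False = (\<lambda>z. \<omega> ^ k * z)" "el (int k) True = (\<lambda>z. \<omega> ^ k * cnj z)"
      unfolding el_def int_pow_int rpow mult one by (auto simp: fun_eq_iff)
    ultimately have "f = el (int k) False \<or> f = el (int k) True"
      using orthogonal_transformation_complex_cases[of f] by (simp only: k)
    then show "f \<in> D" unfolding D_eq by blast
  qed
  then have "D = carrier (dihedral_group n)" using D_subgroup subgroup.subset by blast
  then show ?thesis using D_iso_dih(2) by simp
qed

section \<open>The stabilizer as a matrix group\<close>

lemma carrier_GL [simp]: "g \<in> carrier GL \<longleftrightarrow> invertible g"
  and mult_GL [simp]: "mult GL = (**)"
  and one_GL [simp]: "one GL = mat 1"
  by (simp_all add: GL_def)

lemma group_GL: "group (GL :: (complex ^ 'm ^ 'm::finite) monoid)"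
proof (rule groupI)
  fix x :: "complex ^ 'm ^ 'm" assume "x \<in> carrier GL"
  then obtain y where "x ** y = mat 1" "y ** x = mat 1" by (auto simp: invertible_def)
  then show "\<exists>y\<in>carrier GL. y \<otimes>\<^bsub>GL\<^esub> x = \<one>\<^bsub>GL\<^esub>"
    by (intro bexI[of _ y]) (auto simp: invertible_def)
qed (auto simp: invertible_mult matrix_mul_assoc invertible_def[of "mat 1"] intro: exI[of _ "mat 1"])

text \<open>This is the substitution used in \<open>poly_act\<close>, read on tuples. Because of the
  transpose, a product of matrices acts with its left factor first.\<close>

definition act :: "complex ^ ('n \<times> 'q \<times> 'q) ^ ('n \<times> 'q \<times> 'q) \<Rightarrow> ('n::finite \<Rightarrow> complex ^ 'q ^ 'q::finite) \<Rightarrow> 'n \<Rightarrow> complex ^ 'q ^ 'q"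
  where "act g X = bl (transpose g *v unbl X)"

lemma act_nth: "act g X k $ a $ b = (\<Sum>p\<in>UNIV. g $ p $ (k, a, b) * unbl X $ p)"
  by (simp add: act_def vector_matrix_mult_def mult.commute)

lemma act_mult: "act (g ** h) X = act h (act g X)"
  by (simp add: act_def matrix_transpose_mul matrix_vector_mul_assoc del: transpose_matrix_vector)

lemma act_one [simp]: "act (mat 1) X = X"
  by (simp add: act_def del: transpose_matrix_vector)

lemma act_linear: "act g (\<lambda>i. X i + mat z ** Y i) = (\<lambda>i. act g X i + mat z ** act g Y i)"
proof -
  have "unbl (\<lambda>i. X i + mat z ** Y i) $ p = unbl X $ p + z * unbl Y $ p" for p
    by (cases p) simp
  then show ?thesis
    by (simp add: fun_eq_iff vec_eq_iff act_nth sum.distrib sum_distrib_left algebra_simps)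
qed

text \<open>Matrix units placed in single blocks are the standard basis, so the action determines
  all entries of g.\<close>

lemma act_single_munit: "act g (single j (munit c d)) k $ a $ b = g $ (j, c, d) $ (k, a, b)"
proof -
  have "unbl (single j (munit c d)) $ p = (if p = (j, c, d) then 1 else 0)" for p
    by (cases p) (simp add: munit_nth)
  then have "act g (single j (munit c d)) k $ a $ b = (\<Sum>p\<in>UNIV. if p = (j, c, d) then g $ (j, c, d) $ (k, a, b) else 0)"
    unfolding act_nth by (intro sum.cong) auto
  then show ?thesis by simp
qed

lemma act_eqI:
  assumes "\<And>X. act g X = act h X"
  shows "g = h"
proof -
  have "g $ (j, c, d) $ (k, a, b) = h $ (j, c, d) $ (k, a, b)" for j c d k a b
    unfolding act_single_munit[symmetric] assms ..
  then show ?thesis by (simp add: vec_eq_iff)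
qed

lemma stabilizer_IMM_iff:
  "g \<in> stabilizer IMM \<longleftrightarrow> invertible g \<and> (\<forall>X. cyclic_trace (act g X) = cyclic_trace X)"
proof -
  have "poly_act g IMM = IMM \<longleftrightarrow> (\<forall>x. cyclic_trace (bl (transpose g *v x)) = cyclic_trace (bl x))"
    by (simp only: poly_act_def fun_eq_iff IMM_eq_cyclic_trace)
  also have "\<dots> \<longleftrightarrow> (\<forall>X. cyclic_trace (act g X) = cyclic_trace X)"
    unfolding act_def by (metis bl_unbl unbl_bl)
  finally show ?thesis by (simp add: stabilizer_def)
qed

lemma subgroup_stabilizer_IMM:
  "subgroup (stabilizer (IMM :: complex ^ ('n::{finite,linorder} \<times> 'q::finite \<times> 'q) \<Rightarrow> complex)) GL"
proof -
  interpret group "GL :: (complex ^ ('n \<times> 'q \<times> 'q) ^ ('n \<times> 'q \<times> 'q)) monoid" by (rule group_GL)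
  show ?thesis
  proof (rule subgroupI)
    have "mat 1 \<in> stabilizer (IMM :: complex ^ ('n \<times> 'q \<times> 'q) \<Rightarrow> complex)"
      using one_closed by (simp add: stabilizer_IMM_iff)
    then show "stabilizer (IMM :: complex ^ ('n \<times> 'q \<times> 'q) \<Rightarrow> complex) \<noteq> {}" by blast
  next
    fix g :: "complex ^ ('n \<times> 'q \<times> 'q) ^ ('n \<times> 'q \<times> 'q)" assume g: "g \<in> stabilizer IMM"
    then have gc: "g \<in> carrier GL" by (simp add: stabilizer_IMM_iff)
    have "g ** inv\<^bsub>GL\<^esub> g = mat 1" "inv\<^bsub>GL\<^esub> g ** g = mat 1" using r_inv[OF gc] l_inv[OF gc] by simp_all
    then have "cyclic_trace (act (inv\<^bsub>GL\<^esub> g) X) = cyclic_trace X" for X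
      using g act_mult[of "inv\<^bsub>GL\<^esub> g" g X] by (simp add: stabilizer_IMM_iff) metis
    then show "inv\<^bsub>GL\<^esub> g \<in> stabilizer IMM"
      using inv_closed[OF gc] by (simp add: stabilizer_IMM_iff)
  qed (auto simp: stabilizer_IMM_iff act_mult invertible_mult)
qed

lemma imm_sym_act:
  assumes g: "g \<in> stabilizer IMM"
  shows "imm_sym (act g)"
proof -
  obtain h where h: "g ** h = mat 1" "h ** g = mat 1" using g by (auto simp: stabilizer_IMM_iff invertible_def)
  have "bij (act g)"
    by (rule bij_betw_byWitness[of _ "act h"]) (auto simp: act_mult[symmetric] h)
  then show ?thesis using g by (simp add: imm_sym_def act_linear stabilizer_IMM_iff)
qed

text \<open>Here \<open>\<pi>\<close> describes the transpose of \<open>g\<close>, which is what acts on the tuples of matrices.\<close>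

definition block_perm :: "('n \<Rightarrow> 'n) \<Rightarrow> complex ^ ('n \<times> 'q \<times> 'q) ^ ('n::finite \<times> 'q::finite \<times> 'q) \<Rightarrow> bool"
  where "block_perm \<pi> g \<longleftrightarrow> (\<forall>j c d k a b. k \<noteq> \<pi> j \<longrightarrow> g $ (j, c, d) $ (k, a, b) = 0)"

lemma block_perm_iff: "block_perm \<pi> g \<longleftrightarrow> (\<forall>i. act g ` block_space i \<subseteq> block_space (\<pi> i))"
proof
  assume g: "block_perm \<pi> g"
  show "\<forall>i. act g ` block_space i \<subseteq> block_space (\<pi> i)"
  proof (intro allI subsetI, elim imageE)
    fix i Y X assume Y: "Y = act g X" and X: "X \<in> block_space i"
    have "act g X k $ a $ b = 0" if "k \<noteq> \<pi> i" for k a b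
      unfolding act_nth
    proof (rule sum.neutral, safe)
      fix j c d
      show "g $ (j, c, d) $ (k, a, b) * unbl X $ (j, c, d) = 0"
        using g X that by (cases "j = i") (auto simp: block_perm_def block_space_def)
    qed
    then show "Y \<in> block_space (\<pi> i)" by (simp add: Y block_space_def vec_eq_iff)
  qed
next
  assume g: "\<forall>i. act g ` block_space i \<subseteq> block_space (\<pi> i)"
  show "block_perm \<pi> g" unfolding block_perm_def
  proof (intro allI impI)
    fix j c d k a b assume "k \<noteq> \<pi> j"
    moreover have "act g (single j (munit c d)) \<in> block_space (\<pi> j)"
      by (rule subsetD[OF g[rule_format] imageI[OF single_in_block_space]])
    ultimately have "act g (single j (munit c d)) k = 0" by (simp add: block_space_def)
    then show "g $ (j, c, d) $ (k, a, b) = 0" by (simp add: act_single_munit[symmetric])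
  qed
qed

text \<open>The permutations compose in reverse order, as the left factor acts first.\<close>

lemma block_perm_mult:
  assumes "block_perm \<pi> g" "block_perm \<sigma> h"
  shows "block_perm (\<sigma> \<circ> \<pi>) (g ** h)"
  unfolding block_perm_iff
proof (intro allI subsetI, elim imageE)
  fix i Y X assume Y: "Y = act (g ** h) X" and X: "X \<in> block_space i"
  have "act g X \<in> block_space (\<pi> i)"
    by (rule subsetD[OF assms(1)[unfolded block_perm_iff, rule_format] imageI[OF X]])
  then show "Y \<in> block_space ((\<sigma> \<circ> \<pi>) i)"
    unfolding Y act_mult comp_apply
    by (rule subsetD[OF assms(2)[unfolded block_perm_iff, rule_format] imageI])
qed

lemma block_perm_one: "block_perm id (mat 1)"
  by (auto simp: block_perm_def mat_def)

lemma block_perm_unique: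
  fixes g :: "complex ^ ('n \<times> 'q \<times> 'q) ^ ('n::finite \<times> 'q::finite \<times> 'q)"
  assumes g: "invertible g" and "block_perm \<pi> g" "block_perm \<sigma> g"
  shows "\<pi> = \<sigma>"
proof (rule ccontr)
  assume "\<pi> \<noteq> \<sigma>"
  then obtain j where j: "\<pi> j \<noteq> \<sigma> j" by blast
  obtain c :: 'q where True by blast
  \<comment> \<open>Two different targets for block j would make a whole row of g vanish.\<close>
  have z: "g $ (j, c, c) $ p = 0" for p
    using assms(2,3) j by (cases p) (metis block_perm_def)
  obtain h where "g ** h = mat 1" using g by (auto simp: invertible_def)
  then have "(g ** h) $ (j, c, c) $ (j, c, c) = 1" by (simp add: mat_def)
  then show False by (simp add: matrix_matrix_mult_def z)
qed

text \<open>Only the vanishing of entries is required. Closedness is what separates the different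
  block permutations topologically.\<close>

lemma closed_block_perm: "closed {g. block_perm \<pi> g}"
proof -
  have "closed {g :: complex ^ ('a \<times> 'b \<times> 'b) ^ ('a \<times> 'b \<times> 'b). k \<noteq> \<pi> j \<longrightarrow> g $ (j, c, d) $ (k, a, b) = 0}"
    for j c d k a b
    by (cases "k = \<pi> j") (auto intro!: closed_Collect_eq continuous_intros)
  then show ?thesis unfolding block_perm_def by (intro closed_Collect_all)
qed

lemma stabilizer_block_perm:
  fixes g :: "complex ^ ('n \<times> 'q \<times> 'q) ^ ('n::{finite,linorder} \<times> 'q::finite \<times> 'q)"
  assumes n: "3 \<le> CARD('n)" and g: "g \<in> stabilizer IMM"
  obtains \<pi> where "\<And>i. act g ` block_space i = block_space (\<pi> i)" "block_perm \<pi> g" "inj \<pi>"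
proof -
  have G: "imm_sym (act g)" by (rule imm_sym_act[OF g])
  obtain \<pi> where \<pi>: "\<And>i. act g ` block_space i = block_space (\<pi> i)"
    using imm_sym_block[OF n G] by metis
  have "inj \<pi>"
  proof (rule injI)
    fix i j assume "\<pi> i = \<pi> j"
    then have "act g ` block_space i = act g ` block_space j" by (simp only: \<pi>)
    moreover have "inj (act g)" using G by (simp add: imm_sym_def bij_is_inj)
    ultimately have "block_space i = (block_space j :: ('n \<Rightarrow> complex ^ 'q ^ 'q) set)"
      by (simp add: inj_image_eq_iff)
    then show "i = j" by (rule block_space_inject)
  qed
  moreover have "block_perm \<pi> g" unfolding block_perm_iff by (simp add: \<pi>)
  ultimately show ?thesis using that \<pi> by blast
qed

section \<open>The identity component\<close>

definition cinv :: "complex ^ 'q ^ 'q \<Rightarrow> complex ^ 'q ^ 'q"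
  where "cinv A = (\<chi> d b. det (\<chi> i j. if j = d then (if i = b then 1 else 0) else A $ i $ j) / det A)"

text \<open>The entries are given by Cramer's rule, which makes their continuity visible.\<close>

lemma matrix_mult_cinv:
  assumes "det A \<noteq> 0"
  shows "A ** cinv A = mat 1" "cinv A ** A = mat 1"
proof -
  have "(A ** cinv A) $ a $ b = mat 1 $ a $ b" for a b
  proof -
    define x where "x = (\<chi> d. det (\<chi> i j. if j = d then (axis b 1 :: complex ^ 'a) $ i else A $ i $ j) / det A)"
    have Ax: "A *v x = axis b 1" using cramer[OF assms] x_def by blast
    have x: "cinv A $ d $ b = x $ d" for d
      unfolding x_def cinv_def axis_def vec_lambda_beta ..
    have "(A ** cinv A) $ a $ b = (A *v x) $ a"
      by (simp add: matrix_matrix_mult_def matrix_vector_mult_def x)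
    then show ?thesis by (simp add: Ax axis_def mat_def)
  qed
  then show "A ** cinv A = mat 1" by (simp add: vec_eq_iff)
  then show "cinv A ** A = mat 1" by (simp add: matrix_left_right_inverse)
qed

lemma continuous_on_det:
  fixes A :: "'a::topological_space \<Rightarrow> complex ^ 'q ^ 'q"
  assumes "\<And>i j. continuous_on U (\<lambda>z. A z $ i $ j)"
  shows "continuous_on U (\<lambda>z. det (A z))"
  unfolding det_def by (intro continuous_on_sum continuous_on_mult continuous_on_prod continuous_on_const assms)

lemma continuous_on_cinv_nth:
  fixes A :: "'a::topological_space \<Rightarrow> complex ^ 'q ^ 'q"
  assumes A: "\<And>i j. continuous_on U (\<lambda>z. A z $ i $ j)" and nz: "\<And>z. z \<in> U \<Longrightarrow> det (A z) \<noteq> 0"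
  shows "continuous_on U (\<lambda>z. cinv (A z) $ d $ b)"
proof -
  have "continuous_on U (\<lambda>z. det (\<chi> i j. if j = d then (if i = b then 1 else 0) else A z $ i $ j))"
  proof (rule continuous_on_det)
    fix i j
    show "continuous_on U (\<lambda>z. (\<chi> i j. if j = d then (if i = b then 1 else 0) else A z $ i $ j) $ i $ j)"
      using A by (cases "j = d") simp_all
  qed
  moreover have "continuous_on U (\<lambda>z. det (A z))" by (rule continuous_on_det[OF A])
  ultimately show ?thesis using nz unfolding cinv_def by (simp add: continuous_on_divide)
qed

lemma det_line_poly:
  fixes A B :: "complex ^ 'q ^ 'q"
  shows "\<exists>p. \<forall>z. poly p z = det (A + mat z ** B)"
  by (rule exI[of _ "\<Sum>\<sigma> | \<sigma> permutes UNIV. [:of_int (sign \<sigma>):] * (\<Prod>i\<in>UNIV. [:A $ i $ \<sigma> i, B $ i $ \<sigma> i:])"])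
    (simp add: det_def poly_sum poly_prod)

text \<open>Each determinant is a polynomial in z with value 1 at z = 1, hence has finitely many
  roots. The complex plane minus a countable set is path connected.\<close>

lemma connected_nonsingular_line:
  fixes h :: "'n::finite \<Rightarrow> complex ^ 'q ^ 'q"
  shows "connected {z. \<forall>i. det (h i + mat z ** (mat 1 - h i)) \<noteq> 0}"
proof -
  have "\<forall>i. \<exists>p. \<forall>z. poly p z = det (h i + mat z ** (mat 1 - h i))"
    by (intro allI det_line_poly)
  then obtain p where p: "\<And>i z. poly (p i) z = det (h i + mat z ** (mat 1 - h i))"
    by metis
  have "poly (p i) 1 = 1" for i unfolding p by simp
  then have "p i \<noteq> 0" for i by (metis poly_0 zero_neq_one)
  then have "countable (\<Union>i. {z. poly (p i) z = 0})"
    by (intro countable_UN countable_finite poly_roots_finite) auto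
  then have "connected (- (\<Union>i. {z. poly (p i) z = 0}))"
    by (intro path_connected_imp_connected path_connected_complement_countable) auto
  moreover have "- (\<Union>i. {z. poly (p i) z = 0}) = {z. \<forall>i. det (h i + mat z ** (mat 1 - h i)) \<noteq> 0}"
    by (auto simp: p)
  ultimately show ?thesis by simp
qed

text \<open>Rows are indexed by source coordinates and columns by target coordinates, because
  \<open>act\<close> applies the transpose.\<close>

definition sandwich_matrix :: "('n \<Rightarrow> complex ^ 'q ^ 'q) \<Rightarrow> ('n \<Rightarrow> complex ^ 'q ^ 'q) \<Rightarrow>
    complex ^ ('n \<times> 'q \<times> 'q) ^ ('n::{finite,linorder} \<times> 'q::finite \<times> 'q)"
  where "sandwich_matrix h k = (\<chi> p p'. if fst p = fst p'
    then h (nx (fst p)) $ fst (snd p') $ fst (snd p) * k (fst p) $ snd (snd p) $ snd (snd p') else 0)"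

lemma act_sandwich_matrix: "act (sandwich_matrix h k) X i = h (nx i) ** X i ** k i"
proof -
  have "act (sandwich_matrix h k) X i $ a $ b = (h (nx i) ** X i ** k i) $ a $ b" for a b
  proof -
    let ?t = "\<lambda>c d. h (nx i) $ a $ c * X i $ c $ d * k i $ d $ b"
    have "act (sandwich_matrix h k) X i $ a $ b =
        (\<Sum>(j, c, d)\<in>UNIV. if j = i then ?t c d else 0)"
      unfolding act_nth by (intro sum.cong) (auto simp: sandwich_matrix_def)
    also have "\<dots> = (\<Sum>j\<in>UNIV. \<Sum>(c, d)\<in>UNIV. if j = i then ?t c d else 0)"
      unfolding UNIV_Times_UNIV[symmetric] sum.cartesian_product[symmetric] by simp
    also have "\<dots> = (\<Sum>j\<in>UNIV. if j = i then (\<Sum>(c, d)\<in>UNIV. ?t c d) else 0)"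
      by (intro sum.cong) auto
    also have "\<dots> = (\<Sum>(c, d)\<in>UNIV. ?t c d)" by simp
    also have "\<dots> = (\<Sum>c\<in>UNIV. \<Sum>d\<in>UNIV. ?t c d)"
      unfolding UNIV_Times_UNIV[symmetric] sum.cartesian_product[symmetric] ..
    also have "\<dots> = (\<Sum>d\<in>UNIV. \<Sum>c\<in>UNIV. ?t c d)" by (rule sum.swap)
    also have "\<dots> = (h (nx i) ** X i ** k i) $ a $ b"
      by (simp add: matrix_matrix_mult_def sum_distrib_right)
    finally show ?thesis .
  qed
  then show ?thesis by (simp add: vec_eq_iff)
qed

lemma sandwich_matrix_in_stabilizer:
  fixes h k :: "'n::{finite,linorder} \<Rightarrow> complex ^ 'q ^ 'q::finite"
  assumes n: "2 \<le> CARD('n)" and hk: "\<And>i. h i ** k i = mat 1" "\<And>i. k i ** h i = mat 1"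
  shows "sandwich_matrix h k \<in> stabilizer IMM"
proof -
  have "sandwich_matrix h k ** sandwich_matrix k h = mat 1"
  proof (rule act_eqI)
    fix X :: "'n \<Rightarrow> complex ^ 'q ^ 'q"
    show "act (sandwich_matrix h k ** sandwich_matrix k h) X = act (mat 1) X"
    proof
      fix i
      have "k (nx i) ** (h (nx i) ** X i ** k i) ** h i = (k (nx i) ** h (nx i)) ** X i ** (k i ** h i)"
        by (simp add: matrix_mul_assoc)
      then show "act (sandwich_matrix h k ** sandwich_matrix k h) X i = act (mat 1) X i"
        by (simp add: act_mult act_sandwich_matrix hk)
    qed
  qed
  then have "invertible (sandwich_matrix h k)" unfolding invertible_right_inverse by blast
  moreover have "act (sandwich_matrix h k) X = (\<lambda>i. h (nx i) ** X i ** k i)" for X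
    by (simp add: fun_eq_iff act_sandwich_matrix)
  ultimately show ?thesis
    using cyclic_trace_conjugate[where h = h and k = k, OF n hk(2)] by (simp add: stabilizer_IMM_iff)
qed

text \<open>Such a g is a change of basis by some h. Moving h along a complex line to the identity,
  away from the singular parameters, gives a connected set of stabilizer elements containing both g
  and the identity.\<close>

lemma stabilizer_block_diagonal_connected:
  fixes g :: "complex ^ ('n \<times> 'q \<times> 'q) ^ ('n::{finite,linorder} \<times> 'q::finite \<times> 'q)"
  assumes n: "3 \<le> CARD('n)" and g: "g \<in> stabilizer IMM" "block_perm id g"
  shows "connected_component (stabilizer IMM) (mat 1) g"
proof -
  have n2: "2 \<le> CARD('n)" using n by simp
  obtain \<pi> where \<pi>: "\<And>i. act g ` block_space i = block_space (\<pi> i)" "block_perm \<pi> g"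
    using stabilizer_block_perm[OF n g(1)] by metis
  have "\<pi> = id" using block_perm_unique[OF _ \<pi>(2) g(2)] g(1) by (simp add: stabilizer_IMM_iff)
  then have "act g ` block_space i = block_space i" for i using \<pi>(1) by simp
  from imm_sym_block_preserving[OF n imm_sym_act[OF g(1)] this]
  obtain h k where hk: "\<And>i. h i ** k i = mat 1" "\<And>i. k i ** h i = mat 1"
    and gX: "\<And>X i. act g X i = h (nx i) ** X i ** k i" by metis
  have g_eq: "g = sandwich_matrix h k"
    by (rule act_eqI) (simp add: fun_eq_iff act_sandwich_matrix gX)
  \<comment> \<open>The value is h at z = 0 and the identity at z = 1.\<close>
  define A where "A z i = h i + mat z ** (mat 1 - h i)" for z i
  define U where "U = {z. \<forall>i. det (A z i) \<noteq> 0}"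
  define \<gamma> where "\<gamma> z = sandwich_matrix (A z) (\<lambda>i. cinv (A z i))" for z
  have U: "connected U" unfolding U_def A_def by (rule connected_nonsingular_line)
  have A_nth: "A z i $ a $ b = h i $ a $ b + z * (mat 1 - h i) $ a $ b" for z i a b by (simp add: A_def)
  have contA: "continuous_on U (\<lambda>z. A z i $ a $ b)" for i a b
    unfolding A_nth by (intro continuous_intros)
  have contI: "continuous_on U (\<lambda>z. cinv (A z i) $ a $ b)" for i a b
    by (rule continuous_on_cinv_nth[OF contA]) (simp add: U_def)
  have "continuous_on U (\<lambda>z. \<gamma> z $ p $ p')" for p p'
    by (cases "fst p = fst p'")
      (auto simp: \<gamma>_def sandwich_matrix_def intro!: continuous_on_mult contA contI)
  then have "continuous_on U \<gamma>" by (intro continuous_on_vec_lambda[of U "\<lambda>p z. \<gamma> z $ p", simplified] continuous_on_vec_lambda[of U "\<lambda>p' z. \<gamma> z $ _ $ p'", simplified])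
  then have conn: "connected (\<gamma> ` U)" using U by (rule connected_continuous_image)
  have "\<gamma> ` U \<subseteq> stabilizer IMM"
    unfolding \<gamma>_def U_def using matrix_mult_cinv
    by (auto intro!: sandwich_matrix_in_stabilizer[OF n2])
  moreover have "mat 1 \<in> \<gamma> ` U"
  proof
    have A1: "A 1 i = mat 1" for i by (simp add: A_def)
    then show "1 \<in> U" by (simp add: U_def)
    have "cinv (mat 1 :: complex ^ 'q ^ 'q) = mat 1" using matrix_mult_cinv[of "mat 1 :: complex ^ 'q ^ 'q"] by simp
    then show "mat 1 = \<gamma> 1"
      unfolding \<gamma>_def by (intro act_eqI) (simp add: fun_eq_iff act_sandwich_matrix A1)
  qed
  moreover have "g \<in> \<gamma> ` U"
  proof
    have A0: "A 0 = h" by (simp add: A_def fun_eq_iff)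
    have det: "det (h i) \<noteq> 0" for i
      using hk(1)[of i] unfolding invertible_det_nz[symmetric] invertible_right_inverse by blast
    then show "0 \<in> U" by (simp add: U_def A0)
    have "cinv (h i) = k i" for i
    proof -
      have "cinv (h i) = cinv (h i) ** (h i ** k i)" by (simp add: hk)
      also have "\<dots> = (cinv (h i) ** h i) ** k i" by (simp add: matrix_mul_assoc)
      finally show ?thesis by (simp add: matrix_mult_cinv[OF det])
    qed
    then show "g = \<gamma> 0" by (simp add: \<gamma>_def A0 g_eq)
  qed
  ultimately show ?thesis using conn by (intro connected_componentI)
qed

text \<open>There are finitely many block permutations, so the matrices with a nontrivial one form a
  closed set. On the stabilizer it is disjoint from the closed set belonging to \<open>id\<close>,
  and a connected set through the identity cannot meet both.\<close>

lemma connected_component_stabilizer: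
  assumes n: "3 \<le> CARD('n::{finite,linorder})"
  shows "connected_component_set (stabilizer IMM) (mat 1) =
    {g \<in> stabilizer (IMM :: complex ^ ('n \<times> 'q::finite \<times> 'q) \<Rightarrow> complex). block_perm id g}"
proof (intro equalityI subsetI)
  let ?S = "stabilizer (IMM :: complex ^ ('n \<times> 'q \<times> 'q) \<Rightarrow> complex)"
  let ?C = "connected_component_set ?S (mat 1)"
  let ?B = "\<Union>\<pi>\<in>UNIV - {id}. {g :: complex ^ ('n \<times> 'q \<times> 'q) ^ ('n \<times> 'q \<times> 'q). block_perm \<pi> g}"
  fix g assume "g \<in> ?C"
  have CS: "?C \<subseteq> ?S" by (rule connected_component_subset)
  have one: "mat 1 \<in> ?C"
    using subgroup.one_closed[OF subgroup_stabilizer_IMM] by (simp add: connected_component_refl)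
  have "closed ?B" by (intro closed_UN) (auto simp: closed_block_perm)
  moreover have "?C \<subseteq> {g. block_perm id g} \<union> ?B"
  proof
    fix g assume "g \<in> ?C"
    then have gS: "g \<in> ?S" using CS by blast
    obtain \<pi> where "block_perm \<pi> g" by (rule stabilizer_block_perm[OF n gS])
    then show "g \<in> {g. block_perm id g} \<union> ?B" by (cases "\<pi> = id") auto
  qed
  moreover have "{g. block_perm id g} \<inter> ?B \<inter> ?C = {}"
  proof -
    have "\<pi> = id" if "g \<in> ?C" "block_perm id g" "block_perm \<pi> g" for g \<pi>
      by (rule block_perm_unique[OF _ that(3,2)]) (use that(1) CS in \<open>auto simp: stabilizer_IMM_iff\<close>)
    then show ?thesis by blast
  qed
  moreover have "{g. block_perm id g} \<inter> ?C \<noteq> {}" using one block_perm_one by blast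
  moreover have "connected ?C" by (rule connected_connected_component)
  ultimately have "?B \<inter> ?C = {}" unfolding connected_closed using closed_block_perm by blast
  then show "g \<in> {g \<in> ?S. block_perm id g}"
    using \<open>g \<in> ?C\<close> CS \<open>?C \<subseteq> {g. block_perm id g} \<union> ?B\<close> by blast
next
  fix g assume "g \<in> {g \<in> stabilizer (IMM :: complex ^ ('n \<times> 'q \<times> 'q) \<Rightarrow> complex). block_perm id g}"
  then show "g \<in> connected_component_set (stabilizer IMM) (mat 1)"
    using stabilizer_block_diagonal_connected[OF n, of g] by simp
qed

section \<open>The dihedral subgroup\<close>

definition perm_matrix :: "('m \<Rightarrow> 'm) \<Rightarrow> complex ^ 'm ^ 'm"
  where "perm_matrix \<rho> = (\<chi> p p'. if p' = \<rho> p then 1 else 0)"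

lemma perm_matrix_mult_vector: "perm_matrix \<rho> *v x = (\<chi> p. x $ \<rho> p)"
proof -
  have "(\<Sum>j\<in>UNIV. (if j = \<rho> p then 1 else 0) * x $ j) = (\<Sum>j\<in>UNIV. if j = \<rho> p then x $ \<rho> p else 0)" for p
    by (rule sum.cong) auto
  then show ?thesis by (simp add: perm_matrix_def matrix_vector_mult_def vec_eq_iff)
qed

text \<open>Coordinates are pulled back along the permutation, which reverses the order of
  composition.\<close>

lemma perm_matrix_mult: "perm_matrix \<rho> ** perm_matrix \<sigma> = perm_matrix (\<sigma> \<circ> \<rho>)"
  unfolding matrix_eq matrix_vector_mul_assoc[symmetric] perm_matrix_mult_vector by simp

lemma perm_matrix_id: "perm_matrix id = mat 1"
  by (auto simp: perm_matrix_def mat_def vec_eq_iff)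

lemma perm_matrix_inject: "perm_matrix \<rho> = perm_matrix \<sigma> \<Longrightarrow> \<rho> = \<sigma>"
proof
  fix p assume "perm_matrix \<rho> = perm_matrix \<sigma>"
  then have "perm_matrix \<rho> $ p $ \<rho> p = perm_matrix \<sigma> $ p $ \<rho> p" by simp
  then show "\<rho> p = \<sigma> p" by (simp add: perm_matrix_def split: if_splits)
qed

lemma transpose_perm_matrix:
  assumes "\<rho> \<circ> \<sigma> = id" "\<sigma> \<circ> \<rho> = id"
  shows "transpose (perm_matrix \<rho>) = perm_matrix \<sigma>"
proof -
  have "p = \<rho> p' \<longleftrightarrow> p' = \<sigma> p" for p p' using assms by (metis comp_apply id_apply)
  then show ?thesis by (simp add: transpose_def perm_matrix_def vec_eq_iff)
qed

lemma matrix_inv_eqI: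
  fixes A B :: "complex ^ 'm ^ 'm"
  assumes AB: "A ** B = mat 1" and BA: "B ** A = mat 1"
  shows "matrix_inv A = B"
proof -
  have "A ** matrix_inv A = mat 1 \<and> matrix_inv A ** A = mat 1"
    unfolding matrix_inv_def by (rule someI[of _ B]) (simp add: assms)
  then have "B = B ** (A ** matrix_inv A)" by simp
  then show ?thesis by (simp add: matrix_mul_assoc BA)
qed

text \<open>A permutation matrix is orthogonal, so the passage to the inverse transpose leaves it
  unchanged.\<close>

lemma inverse_transpose_perm:
  assumes h: "\<And>x p. h x $ p = x $ \<rho> p" and \<rho>: "\<rho> \<circ> \<sigma> = id" "\<sigma> \<circ> \<rho> = id"
  shows "inverse_transpose h = perm_matrix \<rho>"
proof -
  have "matrix h = perm_matrix \<rho>"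
    by (auto simp: matrix_def h perm_matrix_def vec_eq_iff axis_def)
  moreover have "matrix_inv (perm_matrix \<rho>) = perm_matrix \<sigma>"
    by (rule matrix_inv_eqI) (simp_all add: perm_matrix_mult \<rho> perm_matrix_id)
  ultimately show ?thesis by (simp add: inverse_transpose_def transpose_perm_matrix[OF \<rho>(2,1)])
qed

section \<open>The two generators as permutations of coordinates\<close>

definition cyc_perm :: "'n::{finite,linorder} \<times> 'q \<times> 'q \<Rightarrow> 'n \<times> 'q \<times> 'q"
  where "cyc_perm p = (case p of (i, a, b) \<Rightarrow> (nx i, a, b))"

definition tau_perm :: "'n::{finite,linorder} \<times> 'q \<times> 'q \<Rightarrow> 'n \<times> 'q \<times> 'q"
  where "tau_perm p = (case p of (i, a, b) \<Rightarrow> (rv i, b, a))"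

definition cyc_perm_inv :: "'n::{finite,linorder} \<times> 'q \<times> 'q \<Rightarrow> 'n \<times> 'q \<times> 'q"
  where "cyc_perm_inv p = (case p of (i, a, b) \<Rightarrow> (pv i, a, b))"

lemma cyc_perm_inverse: "cyc_perm \<circ> cyc_perm_inv = id" "cyc_perm_inv \<circ> cyc_perm = id"
  by (auto simp: cyc_perm_def cyc_perm_inv_def fun_eq_iff)

lemma tau_perm_inverse: "tau_perm \<circ> tau_perm = id"
  by (auto simp: tau_perm_def fun_eq_iff)

lemma cyc_nth: "cyc x $ p = x $ cyc_perm p"
proof -
  obtain i a b where p: "p = (i, a, b)" by (metis surj_pair)
  have "bl (cyc x) i $ a $ b = bl x (nx i) $ a $ b" by (simp only: bl_cyc)
  then show ?thesis by (simp add: p cyc_perm_def)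
qed

lemma tau_nth: "tau x $ p = x $ tau_perm p"
proof -
  obtain i a b where p: "p = (i, a, b)" by (metis surj_pair)
  have "bl (tau x) i $ a $ b = transpose (bl x (rv i)) $ a $ b" by (simp only: bl_tau)
  then show ?thesis by (simp add: p tau_perm_def transpose_def)
qed

lemma inverse_transpose_cyc: "inverse_transpose cyc = perm_matrix cyc_perm"
  by (rule inverse_transpose_perm[OF cyc_nth cyc_perm_inverse])

lemma inverse_transpose_tau: "inverse_transpose tau = perm_matrix tau_perm"
  by (rule inverse_transpose_perm[OF tau_nth tau_perm_inverse tau_perm_inverse])

lemma cyclic_trace_rotate: "cyclic_trace (\<lambda>i. X (nx i)) = cyclic_trace (X :: 'n::{finite,linorder} \<Rightarrow> complex ^ 'q ^ 'q)"
  unfolding cyclic_trace_def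
proof (rule sum.reindex_bij_witness[of _ "\<lambda>c i. c (nx i)" "\<lambda>c i. c (pv i)"])
  fix c :: "'n \<Rightarrow> 'q"
  show "(\<Prod>i\<in>UNIV. X i $ c (pv (nx i)) $ c (pv i)) = (\<Prod>i\<in>UNIV. X (nx i) $ c (nx i) $ c i)"
    by (rule prod.reindex_bij_witness[of _ nx pv]) auto
qed auto

lemma nx_rv: "nx (rv i) = (rv (pv i) :: 'n::{finite,linorder})"
  using rv_nx[of "pv i"] by simp

lemma cyclic_trace_reflect:
  "cyclic_trace (\<lambda>i. transpose (X (rv i))) = cyclic_trace (X :: 'n::{finite,linorder} \<Rightarrow> complex ^ 'q ^ 'q)"
  unfolding cyclic_trace_def
\<comment> \<open>Block i joins the spaces i and \<open>nx i\<close>. Hence reversing the blocks by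
  \<open>rv\<close> reflects the spaces by \<open>rv\<close> after \<open>pv\<close>, which is again
  an involution.\<close>
proof (rule sum.reindex_bij_witness[of _ "\<lambda>c i. c (rv (pv i))" "\<lambda>c i. c (rv (pv i))"])
  fix c :: "'n \<Rightarrow> 'q"
  show "(\<Prod>i\<in>UNIV. X i $ c (rv (pv (nx i))) $ c (rv (pv i))) =
      (\<Prod>i\<in>UNIV. transpose (X (rv i)) $ c (nx i) $ c i)"
    by (rule prod.reindex_bij_witness[of _ rv rv]) (auto simp: transpose_def nx_rv)
qed (auto simp: rv_nx[symmetric])

lemma perm_matrix_in_stabilizer:
  assumes \<rho>: "\<rho> \<circ> \<sigma> = id" "\<sigma> \<circ> \<rho> = id" and f: "\<And>x. IMM (perm_matrix \<rho> *v x) = IMM x"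
  shows "perm_matrix \<rho> \<in> stabilizer IMM"
proof -
  have inv: "perm_matrix \<rho> ** perm_matrix \<sigma> = mat 1" by (simp add: perm_matrix_mult \<rho> perm_matrix_id)
  then have "invertible (perm_matrix \<rho>)" unfolding invertible_right_inverse by blast
  \<comment> \<open>The transpose is the inverse permutation, for which invariance follows by
    substitution.\<close>
  moreover have "IMM (transpose (perm_matrix \<rho>) *v x) = IMM x" for x
    unfolding transpose_perm_matrix[OF \<rho>] using f[of "perm_matrix \<sigma> *v x"]
    by (simp add: matrix_vector_mul_assoc inv)
  ultimately show ?thesis by (simp only: stabilizer_def poly_act_def carrier_GL mem_Collect_eq simp_thms)
qed

lemma cyc_in_stabilizer: "perm_matrix cyc_perm \<in> stabilizer IMM"
proof (rule perm_matrix_in_stabilizer[OF cyc_perm_inverse])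
  fix x :: "complex ^ ('a::{finite,linorder} \<times> 'b::finite \<times> 'b)"
  have "perm_matrix cyc_perm *v x = cyc x" by (simp add: perm_matrix_mult_vector vec_eq_iff cyc_nth del: split_paired_All)
  moreover have "bl (cyc x) = (\<lambda>i. bl x (nx i))" by (simp add: fun_eq_iff bl_cyc)
  ultimately show "IMM (perm_matrix cyc_perm *v x) = IMM x"
    by (simp add: IMM_eq_cyclic_trace cyclic_trace_rotate)
qed

lemma tau_in_stabilizer: "perm_matrix tau_perm \<in> stabilizer IMM"
proof (rule perm_matrix_in_stabilizer[OF tau_perm_inverse tau_perm_inverse])
  fix x :: "complex ^ ('a::{finite,linorder} \<times> 'b::finite \<times> 'b)"
  have "perm_matrix tau_perm *v x = tau x" by (simp add: perm_matrix_mult_vector vec_eq_iff tau_nth del: split_paired_All)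
  moreover have "bl (tau x) = (\<lambda>i. transpose (bl x (rv i)))" by (simp add: fun_eq_iff bl_tau)
  ultimately show "IMM (perm_matrix tau_perm *v x) = IMM x"
    by (simp add: IMM_eq_cyclic_trace cyclic_trace_reflect)
qed

lemma block_perm_tau: "block_perm rv (perm_matrix tau_perm)"
  by (auto simp: block_perm_def perm_matrix_def tau_perm_def)

text \<open>A rotation commutes with \<open>nx\<close> whereas reversal inverts it; agreement would
  give \<open>nx\<close> composed with itself a fixed point.\<close>

lemma rv_neq_rotation:
  assumes "3 \<le> CARD('n::{finite,linorder})"
  shows "rv \<noteq> (nx :: 'n \<Rightarrow> 'n) ^^ k"
proof
  assume eq: "rv = (nx :: 'n \<Rightarrow> 'n) ^^ k"
  obtain i :: 'n where True by blast
  have "pv (rv i) = rv (nx i)" by (simp add: rv_nx)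
  also have "\<dots> = nx (rv i)" unfolding eq by (simp add: funpow_swap1)
  finally have "nx (nx (rv i)) = rv i" by (metis nx_pv)
  then show False using nx_nx_neq[OF assms] by blast
qed

lemma cyc_perm_funpow: "(cyc_perm ^^ k) (i, a, b) = ((nx ^^ k) i, a, b)"
  by (induction k) (auto simp: cyc_perm_def)

lemma cyc_pow: "perm_matrix cyc_perm [^]\<^bsub>GL\<^esub> (k :: nat) = perm_matrix (cyc_perm ^^ k)"
proof (induction k)
  case 0
  then show ?case by (simp add: perm_matrix_id[symmetric] id_def)
next
  case (Suc k)
  then show ?case by (simp add: perm_matrix_mult comp_def)
qed

lemma block_perm_cyc_pow: "block_perm (nx ^^ k) (perm_matrix (cyc_perm ^^ k))"
  by (auto simp: block_perm_def perm_matrix_def cyc_perm_funpow)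

lemma dihedral_generators_GL:
  fixes r s :: "complex ^ ('n::{finite,linorder} \<times> 'q::finite \<times> 'q) ^ ('n \<times> 'q \<times> 'q)"
  assumes n: "3 \<le> CARD('n)"
  defines "r \<equiv> perm_matrix cyc_perm" and "s \<equiv> perm_matrix tau_perm"
  shows "dihedral_generators GL r s CARD('n)"
proof -
  interpret group "GL :: (complex ^ ('n \<times> 'q \<times> 'q) ^ ('n \<times> 'q \<times> 'q)) monoid" by (rule group_GL)
  have r: "r \<in> carrier GL" and s: "s \<in> carrier GL"
    using cyc_in_stabilizer[where 'a='n and 'b='q] tau_in_stabilizer[where 'a='n and 'b='q]
    by (simp_all add: r_def s_def stabilizer_IMM_iff)
  have "cyc_perm ^^ CARD('n) = (id :: 'n \<times> 'q \<times> 'q \<Rightarrow> _)"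
    by (auto simp: fun_eq_iff cyc_perm_funpow nx_funpow_card)
  then have rn: "r [^]\<^bsub>GL\<^esub> CARD('n) = \<one>\<^bsub>GL\<^esub>" by (simp add: r_def cyc_pow perm_matrix_id)
  show ?thesis
  proof
    show "r \<in> carrier GL" "s \<in> carrier GL" "r [^]\<^bsub>GL\<^esub> CARD('n) = \<one>\<^bsub>GL\<^esub>" by (fact r s rn)+
    show "r [^]\<^bsub>GL\<^esub> k \<noteq> \<one>\<^bsub>GL\<^esub>" if "0 < k" "k < CARD('n)" for k
    proof
      assume "r [^]\<^bsub>GL\<^esub> k = \<one>\<^bsub>GL\<^esub>"
      then have "cyc_perm ^^ k = (id :: 'n \<times> 'q \<times> 'q \<Rightarrow> _)"
        by (intro perm_matrix_inject) (simp add: r_def cyc_pow perm_matrix_id)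
      then have "(nx ^^ k) i = i" for i :: 'n
        using cyc_perm_funpow[of k i] by (metis fst_conv id_apply)
      then show False using nx_funpow_eq_self[of k] that by (metis nat_dvd_not_less)
    qed
    show "s \<otimes>\<^bsub>GL\<^esub> s = \<one>\<^bsub>GL\<^esub>" by (simp add: s_def perm_matrix_mult tau_perm_inverse perm_matrix_id)
    \<comment> \<open>The relation r s r = s avoids inverses and reduces to a statement about index
      permutations.\<close>
    have "cyc_perm \<circ> (tau_perm \<circ> cyc_perm) = (tau_perm :: 'n \<times> 'q \<times> 'q \<Rightarrow> _)"
      by (auto simp: fun_eq_iff cyc_perm_def tau_perm_def rv_nx)
    then have "r \<otimes>\<^bsub>GL\<^esub> (s \<otimes>\<^bsub>GL\<^esub> r) = s"
      by (simp add: r_def s_def perm_matrix_mult comp_assoc)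
    then show "s \<otimes>\<^bsub>GL\<^esub> r = inv\<^bsub>GL\<^esub> r \<otimes>\<^bsub>GL\<^esub> s" using r s by (metis inv_solve_left m_closed)
    show "s \<noteq> r [^]\<^bsub>GL\<^esub> z" for z :: int
    proof
      assume "s = r [^]\<^bsub>GL\<^esub> z"
      also have "\<dots> = r [^]\<^bsub>GL\<^esub> (z mod int CARD('n))" by (simp add: int_pow_mod_ord[OF r rn])
      also have "\<dots> = r [^]\<^bsub>GL\<^esub> nat (z mod int CARD('n))" by (simp flip: int_pow_int)
      \<comment> \<open>With a reduced, natural exponent the question descends to the permutations
        of blocks.\<close>
      finally have "tau_perm = (cyc_perm :: 'n \<times> 'q \<times> 'q \<Rightarrow> _) ^^ nat (z mod int CARD('n))"
        unfolding s_def r_def cyc_pow by (rule perm_matrix_inject)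
      then have "rv = (nx :: 'n \<Rightarrow> 'n) ^^ nat (z mod int CARD('n))"
        by (metis (no_types, lifting) cyc_perm_funpow ext fst_conv tau_perm_def case_prod_conv)
      then show False using rv_neq_rotation[OF n] by blast
    qed
  qed (simp add: card_type_pos)
qed

text \<open>Elements of \<open>S0\<close> are those with trivial block permutation, which makes
  \<open>S0\<close> normal. Nontrivial elements of \<open>D\<close> permute the blocks nontrivially,
  and every block permutation in the stabilizer is dihedral, so an element of \<open>D\<close> can
  undo it.\<close>

lemma stabilizer_semidirect:
  fixes S S0 D :: "(complex ^ ('n::{finite,linorder} \<times> 'q::finite \<times> 'q) ^ ('n \<times> 'q \<times> 'q)) set"
  defines "S \<equiv> stabilizer IMM" and "S0 \<equiv> {g \<in> stabilizer IMM. block_perm id g}"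
    and "D \<equiv> generate GL {perm_matrix cyc_perm, perm_matrix tau_perm}"
  assumes n: "3 \<le> CARD('n)" and q: "2 \<le> CARD('q) \<or> CARD('n) = 3"
  shows "is_semidirect_product (GL\<lparr>carrier := S\<rparr>) S0 D"
proof -
  let ?r = "perm_matrix (cyc_perm :: 'n \<times> 'q \<times> 'q \<Rightarrow> _)" and ?s = "perm_matrix (tau_perm :: 'n \<times> 'q \<times> 'q \<Rightarrow> _)"
  interpret GL: dihedral_generators GL ?r ?s "CARD('n)" by (rule dihedral_generators_GL[OF n])
  have S: "subgroup S GL" unfolding S_def by (rule subgroup_stabilizer_IMM)
  interpret S: group "GL\<lparr>carrier := S\<rparr>" by (rule GL.subgroup_imp_group[OF S])
  have mult: "x \<otimes>\<^bsub>GL\<lparr>carrier := S\<rparr>\<^esub> y = x ** y" for x y :: "complex ^ ('n \<times> 'q \<times> 'q) ^ ('n \<times> 'q \<times> 'q)" by simp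
  have invS: "inv\<^bsub>GL\<lparr>carrier := S\<rparr>\<^esub> g \<in> S" "g ** inv\<^bsub>GL\<lparr>carrier := S\<rparr>\<^esub> g = mat 1"
    "inv\<^bsub>GL\<lparr>carrier := S\<rparr>\<^esub> g ** g = mat 1" if "g \<in> S" for g
    using S.inv_closed[of g] S.r_inv[of g] S.l_inv[of g] that by simp_all
  have mS: "g ** h \<in> S" if "g \<in> S" "h \<in> S" for g h
    using S.m_closed[of g h] that by simp
  have inv1: "invertible (mat 1 :: complex ^ ('n \<times> 'q \<times> 'q) ^ ('n \<times> 'q \<times> 'q))"
    using GL.one_closed by simp
  have perm_inv: "block_perm \<sigma> (inv\<^bsub>GL\<lparr>carrier := S\<rparr>\<^esub> g) \<Longrightarrow> \<sigma> \<circ> \<pi> = id" if "g \<in> S" "block_perm \<pi> g" for g \<pi> \<sigma>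
    using block_perm_unique[OF inv1 _ block_perm_one] block_perm_mult[OF that(2)] invS(2)[OF that(1)] by metis
  have perm_ex: "\<exists>\<pi>. block_perm \<pi> g" if "g \<in> S" for g
    using stabilizer_block_perm[OF n that[unfolded S_def]] by metis
  have mult0: "block_perm id (g ** h)" if "block_perm id g" "block_perm id h"
    for g h :: "complex ^ ('n \<times> 'q \<times> 'q) ^ ('n \<times> 'q \<times> 'q)"
    using block_perm_mult[OF that] by simp
  have S0: "subgroup S0 (GL\<lparr>carrier := S\<rparr>)"
  proof (rule S.subgroupI)
    show "S0 \<subseteq> carrier (GL\<lparr>carrier := S\<rparr>)" by (auto simp: S0_def S_def)
    show "S0 \<noteq> {}" using subgroup.one_closed[OF S] block_perm_one by (auto simp: S0_def S_def)
    show "inv\<^bsub>GL\<lparr>carrier := S\<rparr>\<^esub> g \<in> S0" if "g \<in> S0" for g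
    proof -
      have g: "g \<in> S" "block_perm id g" using that by (auto simp: S0_def S_def)
      obtain \<sigma> where \<sigma>: "block_perm \<sigma> (inv\<^bsub>GL\<lparr>carrier := S\<rparr>\<^esub> g)" using perm_ex[OF invS(1)[OF g(1)]] by blast
      then have "\<sigma> = id" using perm_inv[OF g \<sigma>] by simp
      then show ?thesis using \<sigma> invS(1)[OF g(1)] by (simp add: S0_def S_def)
    qed
    show "g \<otimes>\<^bsub>GL\<lparr>carrier := S\<rparr>\<^esub> h \<in> S0" if "g \<in> S0" "h \<in> S0" for g h
      using that mS[of g h] mult0[of g h] by (simp add: S0_def S_def)
  qed
  have D_sub: "D \<subseteq> S" unfolding D_def S_def
    by (rule GL.generate_subgroup_incl[OF _ subgroup_stabilizer_IMM]) (simp add: cyc_in_stabilizer tau_in_stabilizer)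
  have D: "subgroup D GL" unfolding D_def by (rule GL.D_subgroup)
  have rD: "perm_matrix (cyc_perm ^^ k) \<in> D" and sD: "?s \<in> D" for k
  proof -
    have "?r \<in> D" unfolding D_def by (rule generate.incl) simp
    then show "perm_matrix (cyc_perm ^^ k) \<in> D"
      using GL.subgroup_int_pow_closed[OF D, of ?r "int k"] by (simp add: int_pow_int cyc_pow)
    show "?s \<in> D" unfolding D_def by (rule generate.incl) simp
  qed
  show ?thesis
  proof (rule S.is_semidirect_productI)
    show "S0 \<lhd> GL\<lparr>carrier := S\<rparr>"
    proof (rule S.normal_invI[OF S0])
      fix g h assume "g \<in> carrier (GL\<lparr>carrier := S\<rparr>)" and h: "h \<in> S0"
      then have g: "g \<in> S" by simp
      have h: "h \<in> S" "block_perm id h" using h by (auto simp: S0_def S_def)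
      let ?g' = "inv\<^bsub>GL\<lparr>carrier := S\<rparr>\<^esub> g"
      obtain \<pi> \<sigma> where \<pi>: "block_perm \<pi> g" and \<sigma>: "block_perm \<sigma> ?g'" using perm_ex[OF g] perm_ex[OF invS(1)[OF g]] by blast
      have "block_perm (\<sigma> \<circ> (id \<circ> \<pi>)) (g ** h ** ?g')" by (intro block_perm_mult \<pi> \<sigma> h)
      then have "block_perm id (g ** h ** ?g')" using perm_inv[OF g \<pi> \<sigma>] by simp
      moreover have "g ** h ** ?g' \<in> S" using g h by (intro mS invS)
      ultimately show "g \<otimes>\<^bsub>GL\<lparr>carrier := S\<rparr>\<^esub> h \<otimes>\<^bsub>GL\<lparr>carrier := S\<rparr>\<^esub> ?g' \<in> S0"
        unfolding mult by (simp add: S0_def S_def)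
    qed
    show "subgroup D (GL\<lparr>carrier := S\<rparr>)" using GL.subgroup_incl[OF D S D_sub] .
    show "S0 \<inter> D \<subseteq> {\<one>\<^bsub>GL\<lparr>carrier := S\<rparr>\<^esub>}"
    proof
      fix g assume "g \<in> S0 \<inter> D"
      then have g: "block_perm id g" "invertible g" and "g \<in> D" by (auto simp: S0_def stabilizer_IMM_iff)
      then obtain z e where "g = GL.el z e" unfolding D_def GL.D_eq by blast
      then have gel: "g = GL.el (int (nat (z mod int CARD('n)))) e" by (simp add: GL.el_mod)
      define k where "k = nat (z mod int CARD('n))"
      have k: "k < CARD('n)" using card_type_pos[where 'n='n] by (simp add: k_def nat_less_iff)
      have g_eq: "g = perm_matrix (cyc_perm ^^ k) ** (if e then ?s else mat 1)"
        unfolding gel GL.el_def k_def[symmetric] int_pow_int cyc_pow by simp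
      show "g \<in> {\<one>\<^bsub>GL\<lparr>carrier := S\<rparr>\<^esub>}"
      proof (cases e)
        case True
        then have "block_perm (rv \<circ> (nx ^^ k)) g"
          unfolding g_eq by (simp add: block_perm_mult block_perm_cyc_pow block_perm_tau)
        then have rid: "rv \<circ> (nx ^^ k) = (id :: 'n \<Rightarrow> 'n)" by (rule block_perm_unique[OF g(2) _ g(1)])
        have "rv i = (nx ^^ k) i" for i :: 'n using fun_cong[OF rid, of i] by (metis comp_apply id_apply rv_rv)
        then show ?thesis using rv_neq_rotation[OF n, of k] by blast
      next
        case False
        then have "block_perm (nx ^^ k) g" unfolding g_eq by (simp add: block_perm_cyc_pow)
        then have "nx ^^ k = (id :: 'n \<Rightarrow> 'n)" by (rule block_perm_unique[OF g(2) _ g(1)])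
        then have "CARD('n) dvd k" using nx_funpow_eq_self[of k] by (metis id_apply)
        then have "k = 0" using k by (auto dest: dvd_imp_le)
        then show ?thesis using False by (simp add: g_eq perm_matrix_id[unfolded id_def] id_def)
      qed
    qed
    fix g assume "g \<in> carrier (GL\<lparr>carrier := S\<rparr>)"
    then have g: "g \<in> S" by simp
    obtain \<pi> where im: "\<And>i. act g ` block_space i = block_space (\<pi> i)" and \<pi>: "block_perm \<pi> g" and inj: "inj \<pi>"
      using stabilizer_block_perm[OF n g[unfolded S_def]] by metis
    have "adj (\<pi> i) (\<pi> (nx i))" for i
      by (rule imm_sym_adj[OF n q imm_sym_act[OF g[unfolded S_def]] im im])
    from dihedral_permutation[OF n inj this]
    obtain m where m: "\<pi> = nx ^^ m \<or> rv \<circ> \<pi> = nx ^^ m" by blast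
    \<comment> \<open>Since k + m is a multiple of n, the rotation by k undoes the rotation by
      m.\<close>
    define k where "k = CARD('n) * m - m"
    have "k + m = CARD('n) * m" using card_type_pos[where 'n='n] by (cases "CARD('n)") (auto simp: k_def)
    then have km: "(nx ^^ k) \<circ> (nx ^^ m) = (id :: 'n \<Rightarrow> 'n)"
      by (simp add: funpow_add[symmetric] funpow_mult[symmetric] nx_funpow_card)
    have "\<exists>d\<in>D. block_perm id (g ** d)"
      using m
    proof
      assume "\<pi> = nx ^^ m"
      then have "block_perm id (g ** perm_matrix (cyc_perm ^^ k))"
        using block_perm_mult[OF \<pi> block_perm_cyc_pow[of k]] km by simp
      then show ?thesis using rD by blast
    next
      assume "rv \<circ> \<pi> = nx ^^ m"
      then have "(nx ^^ k) \<circ> (rv \<circ> \<pi>) = id" using km by simp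
      then have "block_perm id (g ** ?s ** perm_matrix (cyc_perm ^^ k))"
        using block_perm_mult[OF block_perm_mult[OF \<pi> block_perm_tau] block_perm_cyc_pow[of k]] by simp
      then have "block_perm id (g ** (?s ** perm_matrix (cyc_perm ^^ k)))" by (simp add: matrix_mul_assoc)
      moreover have "?s ** perm_matrix (cyc_perm ^^ k) \<in> D"
        using subgroup.m_closed[OF D sD rD[of k]] by simp
      ultimately show ?thesis by blast
    qed
    then obtain d where d: "d \<in> D" "block_perm id (g ** d)" by blast
    let ?d' = "inv\<^bsub>GL\<^esub> d"
    have "d \<in> carrier GL" "?d' \<in> D" using d(1) D by (auto simp: subgroup.m_inv_closed dest: subgroup.mem_carrier)
    then have "d ** ?d' = mat 1" using GL.r_inv by simp
    then have "g = (g ** d) ** ?d'" by (simp add: matrix_mul_assoc[symmetric])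
    moreover have "g ** d \<in> S0" using mS[OF g] d D_sub by (auto simp: S0_def S_def)
    ultimately show "\<exists>x\<in>S0. \<exists>h\<in>D. g = x \<otimes>\<^bsub>GL\<lparr>carrier := S\<rparr>\<^esub> h"
      unfolding mult using \<open>?d' \<in> D\<close> by blast
  qed
qed

text \<open>The two assumptions exclude the degenerate parameters listed with \<open>IMM\<close>;
  the case (n, q) = (3, 1) stays, because every permutation of three indices is dihedral.\<close>

theorem theorem2p9:
  fixes S S0 D Zn Z2 :: "(complex ^ ('n::{finite,linorder} \<times> 'q::finite \<times> 'q) ^ ('n \<times> 'q \<times> 'q)) set"
  defines "S \<equiv> stabilizer IMM"
    and "S0 \<equiv> connected_component_set S (mat 1)"
    and "D \<equiv> generate GL {inverse_transpose cyc, inverse_transpose tau}"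
    and "Zn \<equiv> generate GL {inverse_transpose cyc}"
    and "Z2 \<equiv> generate GL {inverse_transpose tau}"
  assumes "3 \<le> CARD('n)"
    and "2 \<le> CARD('q) \<or> CARD('n) = 3"
  shows "subgroup S GL
    \<and> is_semidirect_product (GL\<lparr>carrier := S\<rparr>) S0 D
    \<and> GL\<lparr>carrier := D\<rparr> \<cong> dihedral_group CARD('n)
    \<and> card D = 2 * CARD('n)
    \<and> is_semidirect_product (GL\<lparr>carrier := D\<rparr>) Zn Z2
    \<and> GL\<lparr>carrier := Zn\<rparr> \<cong> integer_mod_group CARD('n)
    \<and> GL\<lparr>carrier := Z2\<rparr> \<cong> integer_mod_group 2"
proof -
  interpret GL: dihedral_generators GL "perm_matrix (cyc_perm :: 'n \<times> 'q \<times> 'q \<Rightarrow> _)" "perm_matrix tau_perm" "CARD('n)"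
    by (rule dihedral_generators_GL[OF assms(6)])
  have "subgroup S GL" unfolding S_def by (rule subgroup_stabilizer_IMM)
  \<comment> \<open>The generators become permutation matrices, and the identity component becomes
    the block-preserving part of the stabilizer.\<close>
  moreover have "is_semidirect_product (GL\<lparr>carrier := S\<rparr>) S0 D"
    unfolding S0_def D_def S_def inverse_transpose_cyc inverse_transpose_tau
      connected_component_stabilizer[OF assms(6)]
    by (rule stabilizer_semidirect[OF assms(6,7)])
  moreover have "GL\<lparr>carrier := D\<rparr> \<cong> dihedral_group CARD('n)"
    unfolding D_def inverse_transpose_cyc inverse_transpose_tau
    by (rule iso_trans[OF GL.D_iso_dih(1) dihedral_group_iso_dih[OF card_type_pos]])
  ultimately show ?thesis
    using GL.card_D GL.D_semidirect GL.rotations_iso GL.reflection_iso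
    unfolding D_def Zn_def Z2_def inverse_transpose_cyc inverse_transpose_tau by blast
qed

end
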